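(* For all $|c|>c_0$ there exist $\mu_{per}>0$ and $a_{per}>0$ such that for all $\mu\in(0,\mu_{per})$ there exist a number $\upsilon_\mu$ with $|\upsilon_\mu|\le1$ and maps $\omega^a_\mu:[-a_{per},a_{per}]\to\mathbb{R}$, $\psi^a_{\mu,1}:[-a_{per},a_{per}]\to C^\infty_{per}\cap\{\text{even functions}\}$, $\psi^a_{\mu,2}:[-a_{per},a_{per}]\to C^\infty_{per}\cap\{\text{odd functions}\}$ with the following properties. (1) Putting $$\mathbf{h}(x)=a\mathbf{p}^a_\mu(x):=a\begin{pmatrix}\mu\upsilon_\mu\cos(\omega^a_\mu x)\\ \sin(\omega^a_\mu x)\end{pmatrix}+a\begin{pmatrix}\mu\psi^a_{\mu,1}(\omega^a_\mu x)\\ \psi^a_{\mu,2}(\omega^a_\mu x)\end{pmatrix}$$ gives $\mathcal{G}(a\mathbf{p}^a_\mu,\mu)=0$ for all $|a|\le a_{per}$. (2) $\omega^0_\mu=\omega_\mu$, where $\omega_\mu$ is of order $\mu^{-1/2}$ in the two-sided sense (there are $0<C_1<C_2$ with $C_1\mu^{-1/2}\le\omega_\mu\le C_2\mu^{-1/2}$ for $\mu$ small), and $\mu\mapsto\omega_\mu$ is smooth. (3) $\psi^0_{\mu,1}=\psi^0_{\mu,2}=0$. (4) For all $s\ge0$ there exists $C>0$ such that for all $|a|,|\grave a|\le a_{per}$, $$|\omega^a_\mu-\omega^{\grave a}_\mu|+\|\psi^a_{\mu,1}-\psi^{\grave a}_{\mu,1}\|_{W^{s,\infty}_{per}}+\|\psi^a_{\mu,2}-\psi^{\grave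 a}_{\mu,2}\|_{W^{s,\infty}_{per}}\le C|a-\grave a|.$$
   Context: $c_0=\sqrt2$. $S^df(x)=f(x+d)$, $A=\tfrac12(S^1+S^{-1})$, $\delta=\tfrac12(S^1-S^{-1})$, acting componentwise on $\mathbb{R}^2$-valued functions on $\mathbb{R}$. $I_\mu=\mathrm{diag}(1,\mu)$, $T_\mu=\begin{pmatrix}1&-\mu A\delta\\0&1\end{pmatrix}$, $Q_0(\mathbf{g},\grave{\mathbf{g}})=(g_1\grave g_1+g_2\grave g_2,\ g_1\grave g_2+g_2\grave g_1)^T$, $Q_\mu(\boldsymbol\theta,\grave{\boldsymbol\theta})=T_\mu^{-1}Q_0(T_\mu\boldsymbol\theta,T_\mu\grave{\boldsymbol\theta})$, $$L_\mu=\begin{pmatrix}-2\delta^2(1-\mu A^2)&-2\mu A\delta(1-2A^2+\mu A^2\delta^2)\\ 2\mu A\delta&2(1+\mu A^2-\mu^2A^2\delta^2)\end{pmatrix},$$ and $\mathcal{G}(\mathbf{h},\mu)=c^2I_\mu\mathbf{h}''+L_\mu\mathbf{h}+L_\mu Q_\mu(\mathbf{h},\mathbf{h})$ (the traveling wave equation of the diatomic FPUT lattice with mass ratio $\mu$ and speed $c$). $\omega_\mu$ (the critical frequency) is the unique nonnegative solution $\omega$ of $c^2\mu\omega^2=1+\mu+\sqrt{(1+\mu)^2-4\mu\sin^2\omega}$, defined for $\mu$ small; it satisfies $\sqrt{2/(c^2\mu)}\le\omega_\mu\le\sqrt{(2+2\mu)/(c^2\mu)}$. $C^\infty_{per}$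 denotes smooth $2\pi$-periodic functions and $W^{s,\infty}_{per}$ the Sobolev space of $2\pi$-periodic functions with $s$ bounded derivatives. *)

theory Defs
  imports "HOL-Analysis.Analysis"
begin

text \<open>Scalar functions on the real line; vector-valued functions R -> R^2 are
  represented as pairs of scalar functions (componentwise action of operators).\<close>

type_synonym rfun = "real \<Rightarrow> real"
type_synonym vfun = "rfun \<times> rfun"

definition shiftop :: "real \<Rightarrow> rfun \<Rightarrow> rfun" where
  "shiftop d f = (\<lambda>x. f (x + d))"

definition Aop :: "rfun \<Rightarrow> rfun" where
  "Aop f = (\<lambda>x. (shiftop 1 f x + shiftop (-1) f x) / 2)"

definition Dop :: "rfun \<Rightarrow> rfun" where
  "Dop f = (\<lambda>x. (shiftop 1 f x - shiftop (-1) f x) / 2)"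

text \<open>T_mu and its inverse (T_mu is unipotent upper triangular).\<close>
definition Tmu :: "real \<Rightarrow> vfun \<Rightarrow> vfun" where
  "Tmu \<mu> \<theta> = ((\<lambda>x. fst \<theta> x - \<mu> * Aop (Dop (snd \<theta>)) x), snd \<theta>)"

definition Tmu_inv :: "real \<Rightarrow> vfun \<Rightarrow> vfun" where
  "Tmu_inv \<mu> \<theta> = ((\<lambda>x. fst \<theta> x + \<mu> * Aop (Dop (snd \<theta>)) x), snd \<theta>)"

definition Q0 :: "vfun \<Rightarrow> vfun \<Rightarrow> vfun" where
  "Q0 g g' = ((\<lambda>x. fst g x * fst g' x + snd g x * snd g' x),
              (\<lambda>x. fst g x * snd g' x + snd g x * fst g' x))"

definition Qmu :: "real \<Rightarrow> vfun \<Rightarrow> vfun \<Rightarrow> vfun" where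
  "Qmu \<mu> \<theta> \<theta>' = Tmu_inv \<mu> (Q0 (Tmu \<mu> \<theta>) (Tmu \<mu> \<theta>'))"

definition Lmu :: "real \<Rightarrow> vfun \<Rightarrow> vfun" where
  "Lmu \<mu> h =
    (let h1 = fst h; h2 = snd h;
         u1 = (\<lambda>x. h1 x - \<mu> * Aop (Aop h1) x);
         u2 = (\<lambda>x. h2 x - 2 * Aop (Aop h2) x + \<mu> * Aop (Aop (Dop (Dop h2))) x)
     in ((\<lambda>x. - 2 * Dop (Dop u1) x - 2 * \<mu> * Aop (Dop u2) x),
         (\<lambda>x. 2 * \<mu> * Aop (Dop h1) x
               + 2 * (h2 x + \<mu> * Aop (Aop h2) x - \<mu>^2 * Aop (Aop (Dop (Dop h2))) x))))"

definition Gop :: "real \<Rightarrow> vfun \<Rightarrow> real \<Rightarrow> vfun" where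
  "Gop c h \<mu> =
    (let Lh = Lmu \<mu> h; LQ = Lmu \<mu> (Qmu \<mu> h h)
     in ((\<lambda>x. c^2 * deriv (deriv (fst h)) x + fst Lh x + fst LQ x),
         (\<lambda>x. c^2 * \<mu> * deriv (deriv (snd h)) x + snd Lh x + snd LQ x)))"

definition omega_crit :: "real \<Rightarrow> real \<Rightarrow> real" where
  "omega_crit c \<mu> = (THE \<omega>. \<omega> \<ge> 0 \<and>
      c^2 * \<mu> * \<omega>^2 = 1 + \<mu> + sqrt ((1 + \<mu>)^2 - 4 * \<mu> * (sin \<omega>)^2))"

definition smooth_on :: "real set \<Rightarrow> rfun \<Rightarrow> bool" where
  "smooth_on S f \<longleftrightarrow> (\<forall>k. \<forall>x\<in>S. ((deriv ^^ k) f) differentiable (at x))"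

definition periodic_2pi :: "rfun \<Rightarrow> bool" where
  "periodic_2pi f \<longleftrightarrow> (\<forall>x. f (x + 2 * pi) = f x)"

definition Cinf_per_even :: "rfun \<Rightarrow> bool" where
  "Cinf_per_even f \<longleftrightarrow> smooth_on UNIV f \<and> periodic_2pi f \<and> (\<forall>x. f (-x) = f x)"

definition Cinf_per_odd :: "rfun \<Rightarrow> bool" where
  "Cinf_per_odd f \<longleftrightarrow> smooth_on UNIV f \<and> periodic_2pi f \<and> (\<forall>x. f (-x) = - f x)"

definition W_norm :: "nat \<Rightarrow> rfun \<Rightarrow> real" where
  "W_norm s f = (\<Sum>k\<le>s. (SUP x. \<bar>(deriv ^^ k) f x\<bar>))"

end

theory Submission
  imports Defs
begin

text \<open>With \<open>g = T h\<close> the equation reads \<open>c\<^sup>2 g'' + (shifts of z) = 0\<close> with the local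
  nonlinearity \<open>z = g + Q0 g g\<close>. Put \<open>m = sqrt \<mu>\<close>, \<open>g1(x) = a m H(\<omega> x)\<close>, \<open>g2(x) = a G(\<omega> x)\<close> and
  \<open>c\<^sup>2 \<mu> \<omega>\<^sup>2 = 2 + m s\<close>. In these variables the system becomes \<open>H'' = O(m)\<close> and
  \<open>G'' + G = m (\<dots>)\<close>, and \<open>\<omega>\<close> is a Lipschitz function of \<open>s\<close> uniformly in \<open>\<mu>\<close>. Solvability of the
  second equation determines \<open>s\<close>, and integrating twice gives a contraction for \<open>(s, H, G)\<close> in the
  sup metric whose constant is small with \<open>m\<close> and \<open>a\<close>, uniformly in \<open>\<mu>\<close>. The loss of one derivative
  when shifts are differentiated in \<open>\<omega>\<close> is absorbed by requiring \<open>H\<close> and \<open>G\<close> to be Lipschitz.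
  At \<open>a = 0\<close> the fixed point is the critical linear mode. Every family in \<open>a\<close> gains two derivatives
  from the equation and loses one in a shift, so the Lipschitz dependence on \<open>a\<close> bootstraps to all
  orders. The critical frequency is smooth because \<open>\<mu>\<close> is an explicit function of \<open>\<omega>\<close>.\<close>

subsection \<open>Antiderivatives of periodic functions\<close>

text \<open>The obstacle is uniformity in \<mu>. The scaled shift 2 \<omega> has size 1/m and
  depends on the unknown s. Measuring the detuning of
  \<open>c\<^sup>2 \<mu> \<omega>\<^sup>2\<close> from 2 in units of m keeps the derivative of
  \<omega> in s bounded, because the m under the root cancels the 1/m in front. The weight m on the
  first component comes from the same balance: it leaves a factor m on both right-hand sides.
  Factoring a out of the unknowns makes a = 0 a regular member of the family with a nontrivial
  solution. With H even and G odd, the first equation is always solvable and the second leaves one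
  condition, orthogonality to sin, which is matched by the one free number s. The update of s
  carries no overall factor m. It contracts because s and G - sin are both small and because the
  remaining terms carry a or m. The constants are deliberately crude: the bound 1/1000000 on m and
  on a absorbs all numerical factors, and becomes 10^(-12) for \<mu>.\<close>

definition prim :: "rfun \<Rightarrow> rfun" where
  "prim f y = (LBINT s=0..y. f s)"

lemma prim_deriv:
  assumes "continuous_on UNIV f"
  shows "(prim f has_real_derivative f y) (at y)"
proof -
  define b where "b = \<bar>y\<bar> + 1"
  have "((\<lambda>u. LBINT s=0..u. f s) has_vector_derivative f y) (at y within {-b..b})"
    using interval_integral_FTC2[of "-b" 0 b f y] continuous_on_subset[OF assms]
    by (auto simp: b_def zero_ereal_def)
  then have "((\<lambda>u. LBINT s=0..u. f s) has_vector_derivative f y) (at y within {-b<..<b})"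
    by (rule has_vector_derivative_within_subset) auto
  then have "((\<lambda>u. LBINT s=0..u. f s) has_vector_derivative f y) (at y)"
    using has_vector_derivative_within_open[of y "{-b<..<b}"] unfolding b_def
    by (metis abs_less_iff greaterThanLessThan_iff less_add_one minus_less_iff open_greaterThanLessThan)
  then show ?thesis
    unfolding prim_def[abs_def] has_real_derivative_iff_has_vector_derivative .
qed

lemma prim_0 [simp]: "prim f 0 = 0"
  by (simp add: prim_def zero_ereal_def flip: zero_ereal_def)

lemma prim_unique:
  assumes "continuous_on UNIV f" "\<And>y. (g has_real_derivative f y) (at y)"
  shows "prim f y = g y - g 0"
proof -
  have "((\<lambda>y. prim f y - g y) has_real_derivative 0) (at y)" for y
    using DERIV_diff[OF prim_deriv[OF assms(1), of y] assms(2)[of y]] by simp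
  then have "prim f y - g y = prim f 0 - g 0"
    using DERIV_const_ratio_const[of 0 y] DERIV_isconst_all by blast
  then show ?thesis by simp
qed

lemma continuous_prim:
  assumes "continuous_on UNIV f"
  shows "continuous_on S (prim f)"
  using prim_deriv[OF assms] by (meson DERIV_isCont continuous_at_imp_continuous_on)

lemma prim_cong: "(\<And>x. f x = g x) \<Longrightarrow> prim f y = prim g y"
  by (simp add: prim_def)

lemma prim_lincomb:
  assumes "continuous_on UNIV f" "continuous_on UNIV g"
  shows "prim (\<lambda>x. k * f x + l * g x) y = k * prim f y + l * prim g y"
proof -
  have "((\<lambda>x. k * prim f x + l * prim g x) has_real_derivative k * f y + l * g y) (at y)" for y
    using assms by (auto intro!: derivative_eq_intros prim_deriv)
  moreover have "continuous_on UNIV (\<lambda>x. k * f x + l * g x)"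
    using assms by (intro continuous_intros)
  ultimately show ?thesis
    using prim_unique[of "\<lambda>x. k * f x + l * g x" "\<lambda>x. k * prim f x + l * prim g x" y] by simp
qed

lemma prim_diff:
  assumes "continuous_on UNIV f" "continuous_on UNIV g"
  shows "prim (\<lambda>x. f x - g x) y = prim f y - prim g y"
  using prim_lincomb[OF assms, of 1 "-1" y] by simp

lemma prim_bound:
  assumes "continuous_on UNIV f" "\<And>x. \<bar>f x\<bar> \<le> B"
  shows "\<bar>prim f y - prim f z\<bar> \<le> B * \<bar>y - z\<bar>"
  using field_differentiable_bound[of UNIV "prim f" f B y z] assms prim_deriv[OF assms(1)]
  by auto

lemma prim_even:
  assumes "continuous_on UNIV f" "\<And>x. f (-x) = - f x"
  shows "prim f (-y) = prim f y"
proof -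
  have "((\<lambda>y. prim f (-y)) has_real_derivative f y) (at y)" for y
    using DERIV_chain2[OF prim_deriv[OF assms(1)], where g=uminus and x=y and Db="-1" and s=UNIV]
      DERIV_minus[OF DERIV_ident] assms(2) DERIV_minus by fastforce
  from prim_unique[OF assms(1) this, of y] show ?thesis by simp
qed

lemma prim_odd:
  assumes "continuous_on UNIV f" "\<And>x. f (-x) = f x"
  shows "prim f (-y) = - prim f y"
proof -
  have "((\<lambda>y. - prim f (-y)) has_real_derivative f y) (at y)" for y
    using DERIV_chain2[OF prim_deriv[OF assms(1)], where g=uminus and x=y and Db="-1" and s=UNIV]
      DERIV_minus[OF DERIV_ident] assms(2) DERIV_minus by fastforce
  from prim_unique[OF assms(1) this, of y] show ?thesis by simp
qed

lemma prim_shift: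
  assumes "continuous_on UNIV f"
  shows "prim (\<lambda>x. f (x + d)) y = prim f (y + d) - prim f d"
proof -
  have "((\<lambda>y. prim f (y + d)) has_real_derivative f (y + d)) (at y)" for y
    using prim_deriv[OF assms, of "y + d"] by (simp add: DERIV_shift)
  moreover have "continuous_on UNIV (\<lambda>x. f (x + d))"
    by (intro continuous_on_compose2[OF assms] continuous_intros) auto
  ultimately show ?thesis
    using prim_unique[of "\<lambda>x. f (x + d)" "\<lambda>y. prim f (y + d)" y] by simp
qed

lemma prim_periodic_add:
  assumes "continuous_on UNIV f" "periodic_2pi f"
  shows "prim f (y + 2 * pi) = prim f y + prim f (2 * pi)"
  using prim_shift[OF assms(1), of "2 * pi" y] assms(2)
  by (simp add: periodic_2pi_def)

text \<open>For a continuous periodic function, zero mean is exactly the condition for the primitive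
  to be periodic again.\<close>

definition mean_free :: "rfun \<Rightarrow> bool" where
  "mean_free f \<longleftrightarrow> continuous_on UNIV f \<and> periodic_2pi f \<and> prim f (2 * pi) = 0"

text \<open>The primitive of an odd function is even, so it agrees at -pi and pi; but these two
  values differ by the integral over one period.\<close>

lemma mean_free_odd:
  assumes "continuous_on UNIV f" "periodic_2pi f" "\<And>x. f (-x) = - f x"
  shows "mean_free f"
proof -
  have "prim f (-pi + 2 * pi) = prim f (-pi) + prim f (2 * pi)"
    using prim_periodic_add[OF assms(1,2)] .
  then show ?thesis using prim_even[OF assms(1,3), of pi] assms by (auto simp: mean_free_def)
qed

lemma periodic_prim: "mean_free f \<Longrightarrow> periodic_2pi (prim f)"
  using prim_periodic_add[of f] by (auto simp: mean_free_def periodic_2pi_def)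

lemma periodic_int:
  assumes "periodic_2pi f"
  shows "f (x + 2 * pi * of_int k) = f x"
proof -
  have *: "f (x + 2 * pi * real n) = f x" for x n
  proof (induct n)
    case (Suc n)
    have "f (x + 2 * pi * real (Suc n)) = f (x + 2 * pi * real n + 2 * pi)"
      by (simp add: algebra_simps)
    then show ?case using Suc assms by (simp add: periodic_2pi_def)
  qed simp
  \<comment> \<open>For negative k the natural-number case is applied at the shifted point and leads
    back to x.\<close>
  show ?thesis
    using *[of x "nat k"] *[of "x + 2 * pi * of_int k" "nat (-k)"]
    by (cases "k \<ge> 0") (auto simp: algebra_simps)
qed

lemma periodic_bound:
  assumes "periodic_2pi f" "\<And>x. 0 \<le> x \<Longrightarrow> x \<le> 2 * pi \<Longrightarrow> \<bar>f x\<bar> \<le> B"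
  shows "\<bar>f x\<bar> \<le> B"
proof -
  define k where "k = \<lfloor>x / (2 * pi)\<rfloor>"
  have "of_int k \<le> x / (2 * pi)" "x / (2 * pi) < of_int k + 1"
    unfolding k_def by linarith+
  then have "0 \<le> x + 2 * pi * of_int (-k)" "x + 2 * pi * of_int (-k) \<le> 2 * pi"
    by (auto simp: field_simps)
  with assms(2) have "\<bar>f (x + 2 * pi * of_int (-k))\<bar> \<le> B" by blast
  then show ?thesis using periodic_int[OF assms(1)] by metis
qed

text \<open>A periodic primitive can grow only over one period, and 7 exceeds 2 pi.\<close>

lemma mean_free_prim_bound:
  assumes "mean_free f" "\<And>x. \<bar>f x\<bar> \<le> B"
  shows "\<bar>prim f y\<bar> \<le> 7 * B"
proof (rule periodic_bound[OF periodic_prim[OF assms(1)]])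
  fix x :: real assume x: "0 \<le> x" "x \<le> 2 * pi"
  have "0 \<le> B" using assms(2)[of 0] by linarith
  have "\<bar>prim f x - prim f 0\<bar> \<le> B * \<bar>x - 0\<bar>"
    using assms by (intro prim_bound) (auto simp: mean_free_def)
  also have "\<dots> \<le> B * 7"
    using x \<open>0 \<le> B\<close> pi_less_4 pi_approx by (intro mult_left_mono) auto
  finally show "\<bar>prim f x\<bar> \<le> 7 * B" by simp
qed

lemma mean_free_lincomb:
  "mean_free f \<Longrightarrow> mean_free g \<Longrightarrow> mean_free (\<lambda>x. k * f x + l * g x)"
  by (auto simp: mean_free_def periodic_2pi_def prim_lincomb intro!: continuous_intros)

lemma mean_free_diff: "mean_free f \<Longrightarrow> mean_free g \<Longrightarrow> mean_free (\<lambda>x. f x - g x)"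
  using mean_free_lincomb[of f g 1 "-1"] by simp

lemma mean_free_prim_diff_bound:
  assumes "mean_free f" "mean_free g" "\<And>x. \<bar>f x - g x\<bar> \<le> B"
  shows "\<bar>prim f y - prim g y\<bar> \<le> 7 * B"
  using mean_free_prim_bound[OF mean_free_diff[OF assms(1,2)] assms(3), of y] assms(1,2)
  by (simp add: prim_diff mean_free_def)

lemma prim_sin_sq: "prim (\<lambda>x. sin x * sin x) (2 * pi) = pi"
proof -
  have "((\<lambda>x. x / 2 - sin x * cos x / 2) has_real_derivative sin x * sin x) (at x)" for x :: real
  proof -
    have "((\<lambda>x. x / 2 - sin x * cos x / 2) has_real_derivative
        1 / 2 - (cos x * cos x - sin x * sin x) / 2) (at x)"
      by (auto intro!: derivative_eq_intros simp: field_simps)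
    moreover have "1 / 2 - (cos x * cos x - sin x * sin x) / 2 = sin x * sin x"
      using sin_cos_squared_add3[of x] by argo
    ultimately show ?thesis by simp
  qed
  moreover have "continuous_on UNIV (\<lambda>x::real. sin x * sin x)" by (intro continuous_intros)
  ultimately show ?thesis using prim_unique[of "\<lambda>x. sin x * sin x" "\<lambda>x. x / 2 - sin x * cos x / 2" "2 * pi"] by simp
qed

subsection \<open>Contractions on triples of a number and two functions\<close>

type_synonym state = "real \<times> rfun \<times> rfun"

text \<open>A comparison at scale \<delta> in place of a distance: the components are plain
  functions, so no supremum has to be formed or shown finite.\<close>

fun near :: "real \<Rightarrow> state \<Rightarrow> state \<Rightarrow> bool" where
  "near \<delta> (s, H, G) (s', H', G') \<longleftrightarrow>
     \<bar>s - s'\<bar> \<le> \<delta> \<and> (\<forall>y. \<bar>H y - H' y\<bar> \<le> \<delta>) \<and> (\<forall>y. \<bar>G y - G' y\<bar> \<le> \<delta>)"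

text \<open>Banach's theorem, transported to raw functions by embedding D into pairs of bounded
  continuous functions. Pointwise closedness of D is more than enough for closedness in the sup
  metric.\<close>

lemma near_contraction_fixed_point:
  fixes D :: "state set" and \<Phi> :: "state \<Rightarrow> state"
  assumes ne: "D \<noteq> {}"
    and reg: "\<And>s H G. (s, H, G) \<in> D \<Longrightarrow> H \<in> bcontfun \<and> G \<in> bcontfun"
    and lim: "\<And>S HH GG s H G. (\<And>n::nat. (S n, HH n, GG n) \<in> D) \<Longrightarrow> S \<longlonglongrightarrow> s \<Longrightarrow>
      (\<And>y. (\<lambda>n. HH n y) \<longlonglongrightarrow> H y) \<Longrightarrow> (\<And>y. (\<lambda>n. GG n y) \<longlonglongrightarrow> G y) \<Longrightarrow> (s, H, G) \<in> D"
    and maps: "\<And>p. p \<in> D \<Longrightarrow> \<Phi> p \<in> D"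
    and contr: "\<And>p p' \<delta>. p \<in> D \<Longrightarrow> p' \<in> D \<Longrightarrow> near \<delta> p p' \<Longrightarrow> near (\<delta> / 4) (\<Phi> p) (\<Phi> p')"
  shows "\<exists>p\<in>D. \<Phi> p = p"
proof -
  define e :: "real \<times> (real \<Rightarrow>\<^sub>C real) \<times> (real \<Rightarrow>\<^sub>C real) \<Rightarrow> state"
    where "e = (\<lambda>(s, H, G). (s, apply_bcontfun H, apply_bcontfun G))"
  define i :: "state \<Rightarrow> real \<times> (real \<Rightarrow>\<^sub>C real) \<times> (real \<Rightarrow>\<^sub>C real)"
    where "i = (\<lambda>(s, H, G). (s, Bcontfun H, Bcontfun G))"
  define S where "S = {p. e p \<in> D}"
  have ei: "e (i p) = p" if "p \<in> D" for p
  proof -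
    obtain s H G where p: "p = (s, H, G)" by (cases p)
    then show ?thesis using reg[of s H G] that by (simp add: e_def i_def Bcontfun_inverse)
  qed
  have "closed S"
    unfolding closed_sequential_limits
  proof (intro allI impI, elim conjE)
    fix x l assume x: "\<forall>n. x n \<in> S" and xl: "x \<longlonglongrightarrow> l"
    obtain s H G where l: "l = (s, H, G)" by (cases l)
    have "(s, apply_bcontfun H, apply_bcontfun G) \<in> D"
    proof (rule lim)
      show "(fst (x n), apply_bcontfun (fst (snd (x n))), apply_bcontfun (snd (snd (x n)))) \<in> D" for n
        using x[rule_format, of n] by (auto simp: S_def e_def split: prod.splits)
      show "(\<lambda>n. fst (x n)) \<longlonglongrightarrow> s"
        using tendsto_fst[OF xl] by (simp add: l)
      have "(\<lambda>n. fst (snd (x n))) \<longlonglongrightarrow> H" "(\<lambda>n. snd (snd (x n))) \<longlonglongrightarrow> G"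
        using tendsto_fst[OF tendsto_snd[OF xl]] tendsto_snd[OF tendsto_snd[OF xl]] by (simp_all add: l)
      then show "(\<lambda>n. apply_bcontfun (fst (snd (x n))) y) \<longlonglongrightarrow> apply_bcontfun H y"
          "(\<lambda>n. apply_bcontfun (snd (snd (x n))) y) \<longlonglongrightarrow> apply_bcontfun G y" for y
        by (auto dest!: tendsto_bcontfun_uniform_limit tendsto_uniform_limitI[where x=y])
    qed
    then show "l \<in> S" by (simp add: S_def l e_def)
  qed
  moreover have "S \<noteq> {}" using ne ei unfolding S_def by (metis (mono_tags) empty_iff equals0I mem_Collect_eq)
  moreover have "(\<lambda>p. i (\<Phi> (e p))) ` S \<subseteq> S"
    unfolding S_def by (intro image_subsetI CollectI) (simp add: ei maps)
  moreover have "dist (i (\<Phi> (e p))) (i (\<Phi> (e p'))) \<le> 3 / 4 * dist p p'" if "p \<in> S" "p' \<in> S" for p p'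
  proof -
    \<comment> \<open>The product distance is at most the sum of the three component distances, so
      the factor 1/4 per component becomes 3/4.\<close>
    have tri: "dist u v \<le> 3 * \<delta>"
      if "near \<delta> (e u) (e v)" for u v and \<delta> :: real
    proof -
      obtain s H G where u: "u = (s, H, G)" by (cases u)
      obtain s' H' G' where v: "v = (s', H', G')" by (cases v)
      have "dist s s' \<le> \<delta>" "dist H H' \<le> \<delta>" "dist G G' \<le> \<delta>"
        using that by (auto simp: u v e_def dist_real_def intro!: dist_bound)
      moreover have "dist u v \<le> dist s s' + dist (H, G) (H', G')"
        unfolding u v dist_Pair_Pair[of s] by (rule sqrt_sum_squares_le_sum) auto
      moreover have "dist (H, G) (H', G') \<le> dist H H' + dist G G'"
        unfolding dist_Pair_Pair by (rule sqrt_sum_squares_le_sum) auto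
      ultimately show ?thesis by linarith
    qed
    have "near (dist p p') (e p) (e p')"
    proof -
      obtain s H G where u: "p = (s, H, G)" by (cases p)
      obtain s' H' G' where v: "p' = (s', H', G')" by (cases p')
      have "dist s s' \<le> dist p p'" "dist H H' \<le> dist p p'" "dist G G' \<le> dist p p'"
        using dist_fst_le[of p p'] dist_fst_le[of "snd p" "snd p'"] dist_snd_le[of "snd p" "snd p'"]
          dist_snd_le[of p p'] by (auto simp: u v)
      then show ?thesis
        unfolding u v e_def using dist_bounded[of H _ H'] dist_bounded[of G _ G']
        by (auto simp: dist_real_def intro: order_trans)
    qed
    then have "near (dist p p' / 4) (\<Phi> (e p)) (\<Phi> (e p'))"
      using that by (intro contr) (auto simp: S_def)
    then have "near (dist p p' / 4) (e (i (\<Phi> (e p)))) (e (i (\<Phi> (e p'))))"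
      using that ei maps by (simp add: S_def)
    from tri[OF this] show ?thesis by simp
  qed
  ultimately have "\<exists>!x\<in>S. i (\<Phi> (e x)) = x"
    by (intro Banach_fix[where c="3/4"]) (auto simp: complete_eq_closed)
  then obtain x where "x \<in> S" "i (\<Phi> (e x)) = x" by blast
  then have "e x \<in> D" and "e x = e (i (\<Phi> (e x)))" by (simp_all add: S_def)
  then show ?thesis using ei[OF maps] by metis
qed

text \<open>Each use improves a bound t to t / 4 + e. Since 2 e lies above the fixed value 4 e / 3,
  the excess over 2 e decays geometrically from the initial bound B.\<close>

lemma near_fixed_points:
  assumes "near B p p'" "0 \<le> e"
    and "\<And>\<delta>. near \<delta> p p' \<Longrightarrow> near (\<delta> / 4 + e) p p'"
  shows "near (2 * e) p p'"
proof -
  have *: "near (B / 4 ^ n + 2 * e) p p'" for n :: nat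
  proof (induct n)
    case 0
    then show ?case using assms(1,2) by (cases p; cases p') (fastforce intro: order_trans)
  next
    case (Suc n)
    have "B / 4 ^ n / 4 + 2 * e / 4 + e \<le> B / 4 ^ Suc n + 2 * e" using assms(2) by simp
    then show ?case using assms(3)[OF Suc]
      by (cases p; cases p') (fastforce simp: add_divide_distrib intro: order_trans)
  qed
  have "(\<lambda>n. B / 4 ^ n + 2 * e) \<longlonglongrightarrow> 0 + 2 * e"
    by (intro tendsto_intros LIMSEQ_divide_realpow_zero) auto
  then have le: "t \<le> 2 * e" if "\<And>n::nat. t \<le> B / 4 ^ n + 2 * e" for t
    using that by (intro LIMSEQ_le_const[of _ "2 * e"]) auto
  show ?thesis
    using * by (cases p; cases p') (auto intro!: le)
qed

subsection \<open>The rescaled fixed point problem\<close>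

text \<open>\<open>Xf\<close> and \<open>Yf\<close> are the components of \<open>z / a\<close>. With \<open>S\<close> the shift by \<open>d = 2 \<omega>\<close> in the scaled
  variable \<open>y = \<omega> x\<close>, \<open>row1\<close> is \<open>2 \<delta>\<^sup>2 X + 2 A \<delta> Y\<close> and \<open>row2\<close> is \<open>2 A \<delta> X + 2 A\<^sup>2 Y\<close>; the system is
  \<open>(2 + m s) H'' = m rhs1\<close> and \<open>(2 + m s) (G'' + G) = m (s G - nonlin)\<close>.\<close>

definition wspeed :: "real \<Rightarrow> real \<Rightarrow> real \<Rightarrow> real" where
  "wspeed c m s = sqrt (2 + m * s) / (\<bar>c\<bar> * m)"

definition Xf :: "real \<Rightarrow> real \<Rightarrow> rfun \<Rightarrow> rfun \<Rightarrow> rfun" where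
  "Xf m a H G = (\<lambda>y. m * H y + a * (m\<^sup>2 * (H y * H y) + G y * G y))"

definition Yf :: "real \<Rightarrow> real \<Rightarrow> rfun \<Rightarrow> rfun \<Rightarrow> rfun" where
  "Yf m a H G = (\<lambda>y. G y + 2 * a * m * (H y * G y))"

definition row1 :: "real \<Rightarrow> rfun \<Rightarrow> rfun \<Rightarrow> rfun" where
  "row1 d X Y = (\<lambda>y. (X (y + d) + Y (y + d) - 2 * X y + X (y + (-d)) - Y (y + (-d))) / 2)"

definition row2 :: "real \<Rightarrow> rfun \<Rightarrow> rfun \<Rightarrow> rfun" where
  "row2 d X Y = (\<lambda>y. (X (y + d) - X (y + (-d)) + Y (y + d) + 2 * Y y + Y (y + (-d))) / 2)"

definition rhs1 :: "real \<Rightarrow> real \<Rightarrow> real \<Rightarrow> state \<Rightarrow> rfun" where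
  "rhs1 c m a = (\<lambda>(s, H, G). row1 (2 * wspeed c m s) (Xf m a H G) (Yf m a H G))"

definition nonlin :: "real \<Rightarrow> real \<Rightarrow> real \<Rightarrow> state \<Rightarrow> rfun" where
  "nonlin c m a = (\<lambda>(s, H, G) y. 4 * a * (H y * G y) +
     m * row2 (2 * wspeed c m s) (Xf m a H G) (Yf m a H G) y)"

text \<open>The term s G is split into s sin and s (G - sin). The second part is a product of two
  small quantities and joins the nonlinearity; the first determines the new s.\<close>

definition defect :: "real \<Rightarrow> real \<Rightarrow> real \<Rightarrow> state \<Rightarrow> rfun" where
  "defect c m a = (\<lambda>(s, H, G) y. nonlin c m a (s, H, G) y - s * (G y - sin y))"

text \<open>\<open>next_s\<close> makes \<open>rhs2\<close> orthogonal to \<open>sin\<close>. The free constants of integration are fixed by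
  \<open>H (pi / 2) = 0\<close>, \<open>H' 0 = 0\<close>, \<open>G 0 = 0\<close> and \<open>G' 0 = 1\<close>, which is compatible with the linear mode
  \<open>(k cos, sin)\<close>.\<close>

definition next_s :: "real \<Rightarrow> real \<Rightarrow> real \<Rightarrow> state \<Rightarrow> real" where
  "next_s c m a p = prim (\<lambda>y. defect c m a p y * sin y) (2 * pi) / pi"

definition rhs2 :: "real \<Rightarrow> real \<Rightarrow> real \<Rightarrow> state \<Rightarrow> rfun" where
  "rhs2 c m a p = (\<lambda>y. m / (2 + m * fst p) * (next_s c m a p * sin y - defect c m a p y))"

definition next_H :: "real \<Rightarrow> real \<Rightarrow> real \<Rightarrow> state \<Rightarrow> rfun" where
  "next_H c m a p = (\<lambda>y. m / (2 + m * fst p) *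
     (prim (prim (rhs1 c m a p)) y - prim (prim (rhs1 c m a p)) (pi / 2)))"

definition next_G :: "real \<Rightarrow> real \<Rightarrow> real \<Rightarrow> state \<Rightarrow> rfun" where
  "next_G c m a p = (\<lambda>y. sin y + sin y * prim (\<lambda>s. cos s * rhs2 c m a p s) y
     - cos y * prim (\<lambda>s. sin s * rhs2 c m a p s) y)"

definition picard :: "real \<Rightarrow> real \<Rightarrow> real \<Rightarrow> state \<Rightarrow> state" where
  "picard c m a p = (next_s c m a p, next_H c m a p, next_G c m a p)"

text \<open>The Lipschitz bounds pay for a change of the shift, the parities are those respected by
  the two rows, and closeness of G to sin keeps the solution away from zero.\<close>

definition adm :: "state set" where
  "adm = {(s, H, G). \<bar>s\<bar> \<le> 1 / 100 \<and>
     (\<forall>y. \<bar>H y\<bar> \<le> 1) \<and> (\<forall>x y. \<bar>H x - H y\<bar> \<le> \<bar>x - y\<bar>) \<and>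
     periodic_2pi H \<and> (\<forall>y. H (-y) = H y) \<and>
     (\<forall>y. \<bar>G y - sin y\<bar> \<le> 1 / 100) \<and> (\<forall>x y. \<bar>G x - G y\<bar> \<le> 2 * \<bar>x - y\<bar>) \<and>
     periodic_2pi G \<and> (\<forall>y. G (-y) = - G y)}"

section \<open>Elementary estimates and the dependence of the frequency on s\<close>

lemma lipschitz_continuous:
  fixes f :: rfun
  assumes "\<And>x y. \<bar>f x - f y\<bar> \<le> L * \<bar>x - y\<bar>"
  shows "continuous_on S f"
proof (rule lipschitz_on_continuous_on[of "\<bar>L\<bar>"])
  have "\<bar>f x - f y\<bar> \<le> \<bar>L\<bar> * \<bar>x - y\<bar>" for x y
    by (rule order_trans[OF assms]) (auto intro!: mult_right_mono)
  then show "\<bar>L\<bar>-lipschitz_on S f"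
    by (intro lipschitz_onI) (auto simp: dist_real_def)
qed

text \<open>One factor is changed at a time, so the bounds concern f' and g. Several difference
  estimates below therefore bound a but leave a' free.\<close>

lemma mult_diff_bound:
  fixes f g f' g' :: real
  assumes "\<bar>f - f'\<bar> \<le> p" "\<bar>g - g'\<bar> \<le> q" "\<bar>f'\<bar> \<le> B" "\<bar>g\<bar> \<le> C"
  shows "\<bar>f * g - f' * g'\<bar> \<le> p * C + B * q"
proof -
  have "f * g - f' * g' = (f - f') * g + f' * (g - g')" by (simp add: algebra_simps)
  also have "\<bar>\<dots>\<bar> \<le> \<bar>f - f'\<bar> * \<bar>g\<bar> + \<bar>f'\<bar> * \<bar>g - g'\<bar>" by (metis abs_mult abs_triangle_ineq)
  also have "\<dots> \<le> p * C + B * q" using assms by (intro add_mono mult_mono) auto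
  finally show ?thesis .
qed

lemma abs_mult_le:
  fixes f g :: real
  shows "\<bar>f\<bar> \<le> B \<Longrightarrow> \<bar>g\<bar> \<le> C \<Longrightarrow> \<bar>f * g\<bar> \<le> B * C"
  unfolding abs_mult by (rule mult_mono) auto

locale small =
  fixes c m :: real
  assumes c: "1 \<le> \<bar>c\<bar>" and m: "0 < m" "m \<le> 1 / 1000000"
begin

lemma admD:
  assumes "(s, H, G) \<in> adm"
  shows "\<bar>s\<bar> \<le> 1 / 100" "\<bar>H y\<bar> \<le> 1" "\<bar>H x - H y\<bar> \<le> \<bar>x - y\<bar>" "periodic_2pi H" "H (-y) = H y"
    "\<bar>G y - sin y\<bar> \<le> 1 / 100" "\<bar>G x - G y\<bar> \<le> 2 * \<bar>x - y\<bar>" "periodic_2pi G" "G (-y) = - G y"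
    "\<bar>G y\<bar> \<le> 2" "continuous_on S H" "continuous_on S G"
proof -
  have "\<bar>G y - sin y\<bar> \<le> 1 / 100" using assms by (auto simp: adm_def)
  then show "\<bar>G y\<bar> \<le> 2" using abs_sin_le_one[of y] by linarith
  show "continuous_on S H" "continuous_on S G"
    using assms lipschitz_continuous[of H 1] lipschitz_continuous[of G 2] by (auto simp: adm_def)
qed (use assms in \<open>auto simp: adm_def\<close>)

lemma lam_bounds:
  assumes "\<bar>s\<bar> \<le> 1 / 100"
  shows "1 \<le> 2 + m * s" "0 < 2 + m * s" "2 + m * s \<le> 3" "\<bar>m / (2 + m * s)\<bar> \<le> m"
proof -
  have "\<bar>m * s\<bar> \<le> (1 / 1000000) * (1 / 100)" using assms m by (intro abs_mult_le) auto
  then show "1 \<le> 2 + m * s" "0 < 2 + m * s" "2 + m * s \<le> 3" by (auto simp: abs_le_iff)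
  then show "\<bar>m / (2 + m * s)\<bar> \<le> m" using m by (simp add: divide_le_eq)
qed

lemma lam_diff:
  assumes "\<bar>s\<bar> \<le> 1 / 100" "\<bar>s'\<bar> \<le> 1 / 100"
  shows "\<bar>m / (2 + m * s) - m / (2 + m * s')\<bar> \<le> m * \<bar>s - s'\<bar>"
proof -
  note b = lam_bounds[OF assms(1)] lam_bounds[OF assms(2)]
  have "m / (2 + m * s) - m / (2 + m * s') = (m / (2 + m * s)) * ((m / (2 + m * s')) * (s' - s))"
    using b by (simp add: field_simps)
  also have "\<bar>\<dots>\<bar> \<le> m * (1 * \<bar>s' - s\<bar>)"
    using b m by (intro abs_mult_le) auto
  finally show ?thesis by (simp add: abs_minus_commute)
qed

text \<open>By (u - v) (u + v) = m (s - s') the difference of the roots has a factor m, which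
  cancels the m in the denominator. All constants independent of m rest on this
  cancellation.\<close>

lemma wspeed_diff:
  assumes "\<bar>s\<bar> \<le> 1 / 100" "\<bar>s'\<bar> \<le> 1 / 100"
  shows "\<bar>2 * wspeed c m s - 2 * wspeed c m s'\<bar> \<le> \<bar>s - s'\<bar>"
proof -
  note b = lam_bounds[OF assms(1)] lam_bounds[OF assms(2)]
  define u v where "u = sqrt (2 + m * s)" and "v = sqrt (2 + m * s')"
  have uv: "1 \<le> u" "1 \<le> v" using b by (auto simp: u_def v_def)
  have "(u - v) * (u + v) = m * (s - s')"
    using b by (simp add: u_def v_def algebra_simps flip: power2_eq_square)
  then have "\<bar>(u - v) * (u + v)\<bar> = \<bar>m * (s - s')\<bar>" by simp
  then have "\<bar>u - v\<bar> * (u + v) = m * \<bar>s - s'\<bar>"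
    using uv m by (simp add: abs_mult)
  moreover have "\<bar>u - v\<bar> * 2 \<le> \<bar>u - v\<bar> * (u + v)" using uv by (intro mult_left_mono) auto
  ultimately have *: "2 * \<bar>u - v\<bar> \<le> m * \<bar>s - s'\<bar>" by simp
  have "2 * wspeed c m s - 2 * wspeed c m s' = 2 * (u - v) / (\<bar>c\<bar> * m)"
    by (simp add: wspeed_def u_def v_def diff_divide_distrib)
  then have "\<bar>2 * wspeed c m s - 2 * wspeed c m s'\<bar> = 2 * \<bar>u - v\<bar> / (\<bar>c\<bar> * m)"
    using m c by (simp only: abs_divide abs_mult)
  also have "\<dots> \<le> m * \<bar>s - s'\<bar> / (\<bar>c\<bar> * m)"
    using * m c by (intro divide_right_mono) auto
  also have "\<dots> \<le> \<bar>s - s'\<bar>" using m c by (auto simp: divide_le_eq mult_le_cancel_left1)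
  finally show ?thesis .
qed

end

subsection \<open>Uniform estimates\<close>

text \<open>The constants 6 = 1 + 5 and 11 = 1 + 10 are what \<open>Xf\<close> yields when m and |a|
  are replaced by 1; \<open>Yf\<close> satisfies them as well.\<close>

definition tame :: "rfun \<Rightarrow> bool" where
  "tame f \<longleftrightarrow> (\<forall>y. \<bar>f y\<bar> \<le> 6) \<and> (\<forall>x y. \<bar>f x - f y\<bar> \<le> 11 * \<bar>x - y\<bar>) \<and> periodic_2pi f"

text \<open>The shift is changed in X, at the price of its Lipschitz constant; X and X' are then
  compared at the same point.\<close>

lemma tame_shift_diff:
  assumes "tame X" "\<And>y. \<bar>X y - X' y\<bar> \<le> K" "\<bar>d - d'\<bar> \<le> \<delta>"
  shows "\<bar>X (y + d) - X' (y + d')\<bar> \<le> K + 11 * \<delta>"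
proof -
  have "\<bar>X (y + d) - X (y + d')\<bar> \<le> 11 * \<bar>(y + d) - (y + d')\<bar>" using assms(1) unfolding tame_def by blast
  then have "\<bar>X (y + d) - X (y + d')\<bar> \<le> 11 * \<delta>" using assms(3) by simp
  then show ?thesis using assms(2)[of "y + d'"] by linarith
qed

lemma row_diff:
  assumes "tame X" "tame Y" "\<And>y. \<bar>X y - X' y\<bar> \<le> K" "\<And>y. \<bar>Y y - Y' y\<bar> \<le> K" "\<bar>d - d'\<bar> \<le> \<delta>"
  shows "\<bar>row1 d X Y y - row1 d' X' Y' y\<bar> \<le> 3 * K + 22 * \<delta>"
    and "\<bar>row2 d X Y y - row2 d' X' Y' y\<bar> \<le> 3 * K + 22 * \<delta>"
proof -
  \<comment> \<open>Backward shifts are written \<open>y + (-d)\<close>, so the forward estimate is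
    reused with -d.\<close>
  have m: "\<bar>(-d) - (-d')\<bar> \<le> \<delta>" using assms(5) by linarith
  note * = tame_shift_diff[OF assms(1,3,5), of y] tame_shift_diff[OF assms(2,4,5), of y]
    tame_shift_diff[OF assms(1,3) m, of y] tame_shift_diff[OF assms(2,4) m, of y]
    assms(3)[of y] assms(4)[of y]
  then show "\<bar>row1 d X Y y - row1 d' X' Y' y\<bar> \<le> 3 * K + 22 * \<delta>"
    unfolding row1_def
    by argo
  show "\<bar>row2 d X Y y - row2 d' X' Y' y\<bar> \<le> 3 * K + 22 * \<delta>"
    using * unfolding row2_def
    by argo
qed

lemma row_bound:
  assumes "tame X" "tame Y"
  shows "\<bar>row1 d X Y y\<bar> \<le> 18" "\<bar>row2 d X Y y\<bar> \<le> 18"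
proof -
  have "\<bar>X z\<bar> \<le> 6" "\<bar>Y z\<bar> \<le> 6" for z using assms by (auto simp: tame_def)
  note * = this(1)[of "y + d"] this(1)[of y] this(1)[of "y + (-d)"]
    this(2)[of "y + d"] this(2)[of y] this(2)[of "y + (-d)"]
  show "\<bar>row1 d X Y y\<bar> \<le> 18" using * unfolding row1_def
    by argo
  show "\<bar>row2 d X Y y\<bar> \<le> 18" using * unfolding row2_def
    by argo
qed

lemma continuous_tame: "tame f \<Longrightarrow> continuous_on S f"
  by (rule lipschitz_continuous[where L=11]) (auto simp: tame_def)

lemma continuous_shift:
  fixes f :: rfun
  shows "continuous_on UNIV f \<Longrightarrow> continuous_on UNIV (\<lambda>x. f (x + d))"
  by (rule continuous_on_compose2[of UNIV f]) (auto intro!: continuous_intros)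

lemma continuous_row:
  assumes "continuous_on UNIV X" "continuous_on UNIV Y"
  shows "continuous_on UNIV (row1 d X Y)" "continuous_on UNIV (row2 d X Y)"
  unfolding row1_def row2_def using assms
  by (intro continuous_intros continuous_shift; simp)+

lemma periodic_shift: "periodic_2pi f \<Longrightarrow> f (x + 2 * pi + d) = f (x + d)"
  unfolding periodic_2pi_def by (metis add.commute add.left_commute)

lemma periodic_row:
  assumes "periodic_2pi X" "periodic_2pi Y"
  shows "periodic_2pi (row1 d X Y)" "periodic_2pi (row2 d X Y)"
  using assms periodic_shift[OF assms(1)] periodic_shift[OF assms(2)] periodic_shift[OF assms(1), of _ 0]
    periodic_shift[OF assms(2), of _ 0]
  by (auto simp: periodic_2pi_def row1_def row2_def simp del: add_uminus_conv_diff)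

lemma row1_even:
  assumes "\<And>y. X (-y) = X y" "\<And>y. Y (-y) = - Y y"
  shows "row1 d X Y (-y) = row1 d X Y y"
  using assms(1)[of "y + d"] assms(2)[of "y + d"] assms(1)[of "y - d"] assms(2)[of "y - d"] assms(1)[of y]
  unfolding row1_def minus_add_distrib minus_diff_eq minus_minus
  by (simp add: algebra_simps)

lemma row2_odd:
  assumes "\<And>y. X (-y) = X y" "\<And>y. Y (-y) = - Y y"
  shows "row2 d X Y (-y) = - row2 d X Y y"
  using assms(1)[of "y + d"] assms(2)[of "y + d"] assms(1)[of "y - d"] assms(2)[of "y - d"] assms(2)[of y]
  unfolding row2_def minus_add_distrib minus_diff_eq minus_minus
  by (simp add: field_simps)

text \<open>The first row is a difference operator applied to a periodic function, so the means of the
  shifted copies cancel; this makes the first equation solvable.\<close>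

lemma row1_mean_free:
  assumes X: "continuous_on UNIV X" "periodic_2pi X" and Y: "continuous_on UNIV Y" "periodic_2pi Y"
  shows "mean_free (row1 d X Y)"
proof -
  let ?P = "\<lambda>y. (prim X (y + d) + prim Y (y + d) - 2 * prim X y + prim X (y + (-d)) - prim Y (y + (-d))) / 2"
  have sh: "((\<lambda>y. prim f (y + e)) has_real_derivative f (y + e)) (at y)" if "continuous_on UNIV f" for f e y
    using prim_deriv[OF that, of "y + e"] by (simp add: DERIV_shift)
  have "(?P has_real_derivative row1 d X Y y) (at y)" for y
    unfolding row1_def
    by (intro DERIV_cdivide DERIV_add DERIV_diff DERIV_cmult sh X Y prim_deriv)
  then have "prim (row1 d X Y) (2 * pi) = ?P (2 * pi) - ?P 0"
    by (rule prim_unique[OF continuous_row(1)[OF X(1) Y(1)]])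
  also have "\<dots> = 0"
    using prim_periodic_add[OF X, of d] prim_periodic_add[OF X, of "-d"]
      prim_periodic_add[OF Y, of d] prim_periodic_add[OF Y, of "-d"]
    by (simp add: add.commute field_simps)
  finally show ?thesis
    using X Y by (simp add: mean_free_def continuous_row periodic_row)
qed

section \<open>Bounds for the rescaled nonlinearity\<close>

context small
begin

lemma a_small:
  fixes a :: real
  assumes "\<bar>a\<bar> \<le> 1 / 1000000" "\<bar>x\<bar> \<le> B" "0 \<le> B"
  shows "\<bar>a * x\<bar> \<le> B / 1000000"
  using abs_mult_le[OF assms(1,2)] by simp

lemma m_small:
  assumes "\<bar>x\<bar> \<le> B" "0 \<le> B"
  shows "\<bar>m * x\<bar> \<le> B / 1000000"
  using a_small[of m x B] assms m by simp

lemma Xf_quad: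
  assumes "(s, H, G) \<in> adm"
  shows "\<bar>m\<^sup>2 * (H y * H y) + G y * G y\<bar> \<le> 5"
    and "\<bar>(m\<^sup>2 * (H y * H y) + G y * G y) - (m\<^sup>2 * (H x * H x) + G x * G x)\<bar> \<le> 10 * \<bar>y - x\<bar>"
proof -
  note d = admD[OF assms]
  have m2: "\<bar>m\<^sup>2\<bar> \<le> 1" using m by (simp add: power_le_one)
  have "\<bar>m\<^sup>2 * (H y * H y)\<bar> \<le> 1 * (1 * 1)" "\<bar>G y * G y\<bar> \<le> 2 * 2"
    by (intro abs_mult_le m2 d)+
  then show "\<bar>m\<^sup>2 * (H y * H y) + G y * G y\<bar> \<le> 5" by linarith
  have "\<bar>H y * H y - H x * H x\<bar> \<le> \<bar>y - x\<bar> * 1 + 1 * \<bar>y - x\<bar>"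
    by (intro mult_diff_bound d)
  then have "\<bar>m\<^sup>2 * (H y * H y - H x * H x)\<bar> \<le> 1 * (2 * \<bar>y - x\<bar>)"
    by (intro abs_mult_le m2) simp
  moreover have "\<bar>G y * G y - G x * G x\<bar> \<le> (2 * \<bar>y - x\<bar>) * 2 + 2 * (2 * \<bar>y - x\<bar>)"
    by (intro mult_diff_bound d)
  ultimately show "\<bar>(m\<^sup>2 * (H y * H y) + G y * G y) - (m\<^sup>2 * (H x * H x) + G x * G x)\<bar> \<le> 10 * \<bar>y - x\<bar>"
    unfolding right_diff_distrib by linarith
qed

lemma tame_Xf:
  assumes "(s, H, G) \<in> adm" "\<bar>a\<bar> \<le> 1 / 1000000"
  shows "tame (Xf m a H G)"
  unfolding tame_def
proof (intro conjI allI)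
  note d = admD[OF assms(1)]
  fix x y
  have "\<bar>m * H y\<bar> \<le> 1 / 1000000" using m_small[OF d(2)] by simp
  moreover have "\<bar>a * (m\<^sup>2 * (H y * H y) + G y * G y)\<bar> \<le> 5 / 1000000"
    by (intro a_small assms Xf_quad[OF assms(1)]) auto
  ultimately show "\<bar>Xf m a H G y\<bar> \<le> 6" by (simp add: Xf_def)
  have "\<bar>m * (H x - H y)\<bar> \<le> \<bar>x - y\<bar> / 1000000" by (intro m_small d) simp
  moreover have "\<bar>a * ((m\<^sup>2 * (H x * H x) + G x * G x) - (m\<^sup>2 * (H y * H y) + G y * G y))\<bar>
      \<le> (10 * \<bar>x - y\<bar>) / 1000000"
    by (intro a_small assms Xf_quad[OF assms(1)]) auto
  ultimately show "\<bar>Xf m a H G x - Xf m a H G y\<bar> \<le> 11 * \<bar>x - y\<bar>"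
    unfolding Xf_def right_diff_distrib by linarith
  show "periodic_2pi (Xf m a H G)"
    using d(4,8) by (simp add: periodic_2pi_def Xf_def)
qed

lemma tame_Yf:
  assumes "(s, H, G) \<in> adm" "\<bar>a\<bar> \<le> 1 / 1000000"
  shows "tame (Yf m a H G)"
  unfolding tame_def
proof (intro conjI allI)
  note d = admD[OF assms(1)]
  fix x y
  have "\<bar>m * a\<bar> \<le> 1 / 2" using m_small[of a 1] assms(2) by simp
  then have am: "\<bar>2 * a * m\<bar> \<le> 1" by (simp add: abs_mult mult_ac)
  have "\<bar>2 * a * m * (H y * G y)\<bar> \<le> 1 * (1 * 2)" by (intro abs_mult_le am d)
  then show "\<bar>Yf m a H G y\<bar> \<le> 6" using d(10)[of y] unfolding Yf_def by linarith
  have "\<bar>H x * G x - H y * G y\<bar> \<le> \<bar>x - y\<bar> * 2 + 1 * (2 * \<bar>x - y\<bar>)"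
    by (intro mult_diff_bound d)
  then have "\<bar>2 * a * m * (H x * G x - H y * G y)\<bar> \<le> 1 * (4 * \<bar>x - y\<bar>)"
    by (intro abs_mult_le am) simp
  then show "\<bar>Yf m a H G x - Yf m a H G y\<bar> \<le> 11 * \<bar>x - y\<bar>"
    using d(7)[of x y] unfolding Yf_def right_diff_distrib
    by argo
  show "periodic_2pi (Yf m a H G)"
    using d(4,8) by (simp add: periodic_2pi_def Yf_def)
qed

text \<open>Here 7 = 1 + 6, from the linear and the quadratic part with m and |a| replaced by 1; a
  change of a meets the bound 5 of \<open>Xf_quad\<close>.\<close>

lemma Xf_diff:
  assumes p: "(s, H, G) \<in> adm" "(s', H', G') \<in> adm" and a: "\<bar>a\<bar> \<le> 1 / 1000000"
    and n: "near \<delta> (s, H, G) (s', H', G')"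
  shows "\<bar>Xf m a H G y - Xf m a' H' G' y\<bar> \<le> 7 * (\<delta> + \<bar>a - a'\<bar>)"
proof -
  note d = admD[OF p(1)] and d' = admD[OF p(2)]
  have n: "\<bar>H y - H' y\<bar> \<le> \<delta>" "\<bar>G y - G' y\<bar> \<le> \<delta>" and "0 \<le> \<delta>" using n by auto
  have m2: "\<bar>m\<^sup>2\<bar> \<le> 1" using m by (simp add: power_le_one)
  have "\<bar>m * (H y - H' y)\<bar> \<le> 1 * \<delta>" using m by (intro abs_mult_le n) auto
  moreover have "\<bar>H y * H y - H' y * H' y\<bar> \<le> \<delta> * 1 + 1 * \<delta>"
    by (intro mult_diff_bound d d' n)
  then have "\<bar>m\<^sup>2 * (H y * H y - H' y * H' y)\<bar> \<le> 1 * (2 * \<delta>)"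
    by (intro abs_mult_le m2) simp
  moreover have "\<bar>G y * G y - G' y * G' y\<bar> \<le> \<delta> * 2 + 2 * \<delta>"
    by (intro mult_diff_bound d d' n)
  ultimately have q: "\<bar>(m\<^sup>2 * (H y * H y) + G y * G y) - (m\<^sup>2 * (H' y * H' y) + G' y * G' y)\<bar> \<le> 6 * \<delta>"
    and l: "\<bar>m * H y - m * H' y\<bar> \<le> \<delta>"
    unfolding right_diff_distrib by linarith+
  have "\<bar>(m\<^sup>2 * (H y * H y) + G y * G y) * a - (m\<^sup>2 * (H' y * H' y) + G' y * G' y) * a'\<bar>
    \<le> (6 * \<delta>) * (1 / 1000000) + 5 * \<bar>a - a'\<bar>"
    by (rule mult_diff_bound[OF q order_refl Xf_quad(1)[OF p(2)] a])
  moreover have "Xf m a H G y - Xf m a' H' G' y = (m * H y - m * H' y) +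
    ((m\<^sup>2 * (H y * H y) + G y * G y) * a - (m\<^sup>2 * (H' y * H' y) + G' y * G' y) * a')"
    by (simp add: Xf_def mult_ac)
  moreover have "(6 * \<delta>) * (1 / 1000000) \<le> 6 * \<delta>" using \<open>0 \<le> \<delta>\<close> by simp
  ultimately show ?thesis using l \<open>0 \<le> \<delta>\<close> abs_ge_zero[of "a - a'"] unfolding abs_le_iff[of "Xf m a H G y - Xf m a' H' G' y"] by (smt (verit, best))
qed

lemma Yf_diff:
  assumes p: "(s, H, G) \<in> adm" "(s', H', G') \<in> adm" and a: "\<bar>a\<bar> \<le> 1 / 1000000"
    and n: "near \<delta> (s, H, G) (s', H', G')"
  shows "\<bar>Yf m a H G y - Yf m a' H' G' y\<bar> \<le> 7 * (\<delta> + \<bar>a - a'\<bar>)"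
proof -
  note d = admD[OF p(1)] and d' = admD[OF p(2)]
  have n: "\<bar>H y - H' y\<bar> \<le> \<delta>" "\<bar>G y - G' y\<bar> \<le> \<delta>" and "0 \<le> \<delta>" using n by auto
  have q: "\<bar>H y * G y - H' y * G' y\<bar> \<le> \<delta> * 2 + 1 * \<delta>"
    by (intro mult_diff_bound d d' n)
  have b: "\<bar>H' y * G' y\<bar> \<le> 1 * 2" by (intro abs_mult_le d')
  have "\<bar>H y * G y * a - H' y * G' y * a'\<bar> \<le> (\<delta> * 2 + 1 * \<delta>) * (1 / 1000000) + (1 * 2) * \<bar>a - a'\<bar>"
    by (rule mult_diff_bound[OF q order_refl b a])
  moreover have "(\<delta> * 2 + 1 * \<delta>) * (1 / 1000000) \<le> 3 * \<delta>" using \<open>0 \<le> \<delta>\<close> by simp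
  ultimately have "\<bar>m * (H y * G y * a - H' y * G' y * a')\<bar> \<le> 1 * (3 * \<delta> + 2 * \<bar>a - a'\<bar>)"
    using m by (intro abs_mult_le) auto
  moreover have "Yf m a H G y - Yf m a' H' G' y = (G y - G' y) +
      2 * (m * (H y * G y * a - H' y * G' y * a'))"
    by (simp add: Yf_def algebra_simps)
  ultimately show ?thesis using n \<open>0 \<le> \<delta>\<close> abs_ge_zero[of "a - a'"] by (smt (verit, best))
qed

end

lemma mult_sin_bound: "\<bar>f\<bar> \<le> B \<Longrightarrow> \<bar>f * sin x\<bar> \<le> B" "\<bar>f\<bar> \<le> B \<Longrightarrow> \<bar>sin x * f\<bar> \<le> B"
    "\<bar>f\<bar> \<le> B \<Longrightarrow> \<bar>cos x * f\<bar> \<le> B" for f x :: real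
  using abs_mult_le[of f B "sin x" 1] abs_mult_le[of "cos x" 1 f B] by (simp_all add: mult.commute)

section \<open>The two right-hand sides and their solvability\<close>

context small
begin

lemma rhs1_mean_free:
  assumes "p \<in> adm" "\<bar>a\<bar> \<le> 1 / 1000000"
  shows "mean_free (rhs1 c m a p)"
proof -
  obtain s H G where p: "p = (s, H, G)" by (cases p)
  have "tame (Xf m a H G)" "tame (Yf m a H G)" using tame_Xf tame_Yf assms p by auto
  then show ?thesis
    unfolding p rhs1_def by (auto intro!: row1_mean_free continuous_tame simp: tame_def)
qed

lemma rhs1_even:
  assumes "p \<in> adm"
  shows "rhs1 c m a p (-y) = rhs1 c m a p y"
proof -
  obtain s H G where p: "p = (s, H, G)" by (cases p)
  show ?thesis
    using admD(5,9)[OF assms[unfolded p]] unfolding p rhs1_def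
    by (auto intro!: row1_even simp: Xf_def Yf_def)
qed

lemma rhs1_bound:
  assumes "p \<in> adm" "\<bar>a\<bar> \<le> 1 / 1000000"
  shows "\<bar>rhs1 c m a p y\<bar> \<le> 18"
proof -
  obtain s H G where p: "p = (s, H, G)" by (cases p)
  have "tame (Xf m a H G)" "tame (Yf m a H G)" using tame_Xf tame_Yf assms p by auto
  then show ?thesis unfolding p rhs1_def by (auto intro!: row_bound)
qed

text \<open>Here 43 = 3 * 7 + 22: the state enters through X and Y with constant 7, and through the
  shift, whose change is at most \<delta> because s is a component of the state.\<close>

lemma rows_diff:
  fixes a a' s s' :: real and H G H' G' :: rfun
  assumes p: "(s, H, G) \<in> adm" "(s', H', G') \<in> adm"
    and a: "\<bar>a\<bar> \<le> 1 / 1000000" and n: "near \<delta> (s, H, G) (s', H', G')"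
  defines "X \<equiv> Xf m a H G" and "Y \<equiv> Yf m a H G" and "X' \<equiv> Xf m a' H' G'" and "Y' \<equiv> Yf m a' H' G'"
  shows "\<bar>row1 (2 * wspeed c m s) X Y y - row1 (2 * wspeed c m s') X' Y' y\<bar> \<le> 43 * (\<delta> + \<bar>a - a'\<bar>)"
    and "\<bar>row2 (2 * wspeed c m s) X Y y - row2 (2 * wspeed c m s') X' Y' y\<bar> \<le> 43 * (\<delta> + \<bar>a - a'\<bar>)"
proof -
  have d: "\<bar>2 * wspeed c m s - 2 * wspeed c m s'\<bar> \<le> \<delta>"
    using wspeed_diff[OF admD(1)[OF p(1)] admD(1)[OF p(2)]] n by simp
  have t: "tame X" "tame Y" unfolding X_def Y_def using tame_Xf tame_Yf p a by auto
  have X: "\<bar>X y - X' y\<bar> \<le> 7 * (\<delta> + \<bar>a - a'\<bar>)" and Y: "\<bar>Y y - Y' y\<bar> \<le> 7 * (\<delta> + \<bar>a - a'\<bar>)" for y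
    unfolding X_def Y_def X'_def Y'_def by (intro Xf_diff[OF p a n] Yf_diff[OF p a n])+
  show "\<bar>row1 (2 * wspeed c m s) X Y y - row1 (2 * wspeed c m s') X' Y' y\<bar> \<le> 43 * (\<delta> + \<bar>a - a'\<bar>)"
    using row_diff(1)[OF t X Y d, of y] abs_ge_zero[of "a - a'"] by argo
  show "\<bar>row2 (2 * wspeed c m s) X Y y - row2 (2 * wspeed c m s') X' Y' y\<bar> \<le> 43 * (\<delta> + \<bar>a - a'\<bar>)"
    using row_diff(2)[OF t X Y d, of y] abs_ge_zero[of "a - a'"] by argo
qed

lemma rhs1_diff:
  assumes "p \<in> adm" "p' \<in> adm" "\<bar>a\<bar> \<le> 1 / 1000000" "near \<delta> p p'"
  shows "\<bar>rhs1 c m a p y - rhs1 c m a' p' y\<bar> \<le> 43 * (\<delta> + \<bar>a - a'\<bar>)"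
  using assms rows_diff(1) by (cases p; cases p') (simp add: rhs1_def)

lemma nonlin_bound:
  assumes "(s, H, G) \<in> adm" "\<bar>a\<bar> \<le> 1 / 1000000"
  shows "\<bar>nonlin c m a (s, H, G) y\<bar> \<le> 26 / 1000000"
proof -
  note d = admD[OF assms(1)]
  have "\<bar>H y * G y\<bar> \<le> 1 * 2" by (intro abs_mult_le d)
  then have "\<bar>a * (H y * G y)\<bar> \<le> 2 / 1000000" by (intro a_small assms) auto
  moreover have "\<bar>m * row2 (2 * wspeed c m s) (Xf m a H G) (Yf m a H G) y\<bar> \<le> 18 / 1000000"
    by (intro m_small row_bound tame_Xf[OF assms] tame_Yf[OF assms]) auto
  ultimately show ?thesis unfolding nonlin_def by (simp add: mult.assoc) argo
qed

text \<open>The product H G carries the factor a and \<open>row2\<close> the factor m, so a change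
  of state costs at most (12 + 43) / 1000000 per unit. A change of a costs 8 + 43 / 1000000.\<close>

lemma nonlin_diff:
  assumes p: "(s, H, G) \<in> adm" "(s', H', G') \<in> adm"
    and a: "\<bar>a\<bar> \<le> 1 / 1000000" and n: "near \<delta> (s, H, G) (s', H', G')"
  shows "\<bar>nonlin c m a (s, H, G) y - nonlin c m a' (s', H', G') y\<bar> \<le> \<delta> / 10000 + 9 * \<bar>a - a'\<bar>"
proof -
  note d = admD[OF p(1)] and d' = admD[OF p(2)]
  have n': "\<bar>H y - H' y\<bar> \<le> \<delta>" "\<bar>G y - G' y\<bar> \<le> \<delta>" and "0 \<le> \<delta>" using n by auto
  have q: "\<bar>H y * G y - H' y * G' y\<bar> \<le> \<delta> * 2 + 1 * \<delta>" by (intro mult_diff_bound d d' n')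
  have b: "\<bar>H' y * G' y\<bar> \<le> 1 * 2" by (intro abs_mult_le d')
  have 1: "\<bar>H y * G y * a - H' y * G' y * a'\<bar> \<le> (\<delta> * 2 + 1 * \<delta>) * (1 / 1000000) + (1 * 2) * \<bar>a - a'\<bar>"
    by (rule mult_diff_bound[OF q order_refl b a])
  let ?R = "row2 (2 * wspeed c m s) (Xf m a H G) (Yf m a H G) y
    - row2 (2 * wspeed c m s') (Xf m a' H' G') (Yf m a' H' G') y"
  have 2: "\<bar>m * ?R\<bar> \<le> 43 * (\<delta> + \<bar>a - a'\<bar>) / 1000000"
    using \<open>0 \<le> \<delta>\<close> by (intro m_small rows_diff[OF p a n]) auto
  have "nonlin c m a (s, H, G) y - nonlin c m a' (s', H', G') y
    = 4 * (H y * G y * a - H' y * G' y * a') + m * ?R"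
    by (simp add: nonlin_def algebra_simps)
  with 1 2 show ?thesis using \<open>0 \<le> \<delta>\<close> abs_ge_zero[of "a - a'"] by argo
qed

lemma defect_bound:
  assumes "p \<in> adm" "\<bar>a\<bar> \<le> 1 / 1000000"
  shows "\<bar>defect c m a p y\<bar> \<le> 2 / 10000"
proof -
  obtain s H G where p: "p = (s, H, G)" by (cases p)
  have "\<bar>s * (G y - sin y)\<bar> \<le> (1 / 100) * (1 / 100)"
    by (intro abs_mult_le admD[OF assms(1)[unfolded p]])
  moreover have "defect c m a p y = nonlin c m a (s, H, G) y - s * (G y - sin y)" by (simp add: p defect_def)
  ultimately show ?thesis
    using nonlin_bound[OF assms(1)[unfolded p] assms(2), of y] by argo
qed

text \<open>The constant 1/40 is dominated by 2/100 from the product s (G - sin), both of whose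
  factors are at most 1/100.\<close>

lemma defect_diff:
  assumes "p \<in> adm" "p' \<in> adm" "\<bar>a\<bar> \<le> 1 / 1000000" "near \<delta> p p'"
  shows "\<bar>defect c m a p y - defect c m a' p' y\<bar> \<le> \<delta> / 40 + 9 * \<bar>a - a'\<bar>"
proof -
  obtain s H G s' H' G' where p: "p = (s, H, G)" "p' = (s', H', G')" by (cases p, cases p')
  note d = admD[OF assms(1)[unfolded p]] and d' = admD[OF assms(2)[unfolded p]]
  have n: "\<bar>s - s'\<bar> \<le> \<delta>" "\<bar>(G y - sin y) - (G' y - sin y)\<bar> \<le> \<delta>" "0 \<le> \<delta>"
    using assms(4) by (auto simp: p)
  have "\<bar>s * (G y - sin y) - s' * (G' y - sin y)\<bar> \<le> \<delta> * (1 / 100) + (1 / 100) * \<delta>"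
    by (intro mult_diff_bound d d' n)
  then show ?thesis
    using nonlin_diff[OF assms(1,2)[unfolded p] assms(3) assms(4)[unfolded p], of y a'] n(3)
    unfolding p defect_def prod.case by argo
qed

lemma defect_props:
  assumes "p \<in> adm" "\<bar>a\<bar> \<le> 1 / 1000000"
  shows "continuous_on UNIV (defect c m a p)" "periodic_2pi (defect c m a p)"
    "defect c m a p (-y) = - defect c m a p y"
proof -
  obtain s H G where p: "p = (s, H, G)" by (cases p)
  note d = admD[OF assms(1)[unfolded p]]
  have t: "tame (Xf m a H G)" "tame (Yf m a H G)" using tame_Xf tame_Yf assms p by auto
  show "continuous_on UNIV (defect c m a p)"
    unfolding p defect_def nonlin_def prod.case
    by (intro continuous_intros d continuous_row continuous_tame t)
  have "periodic_2pi (row2 (2 * wspeed c m s) (Xf m a H G) (Yf m a H G))"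
    using t by (intro periodic_row) (auto simp: tame_def)
  then show "periodic_2pi (defect c m a p)"
    using d(4,8) by (simp add: p defect_def nonlin_def periodic_2pi_def)
  have "row2 (2 * wspeed c m s) (Xf m a H G) (Yf m a H G) (-y) = - row2 (2 * wspeed c m s) (Xf m a H G) (Yf m a H G) y"
    using d(5,9) by (intro row2_odd) (auto simp: Xf_def Yf_def)
  then show "defect c m a p (-y) = - defect c m a p y"
    using d(5,9) by (simp add: p defect_def nonlin_def algebra_simps)
qed

lemma prim_2pi_bound:
  assumes "continuous_on UNIV f" "\<And>x. \<bar>f x\<bar> \<le> B"
  shows "\<bar>prim f (2 * pi) / pi\<bar> \<le> 2 * B"
  using prim_bound[OF assms, of "2 * pi" 0] by (simp add: divide_le_eq abs_mult mult_ac)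

lemma next_s_bound:
  assumes "p \<in> adm" "\<bar>a\<bar> \<le> 1 / 1000000"
  shows "\<bar>next_s c m a p\<bar> \<le> 4 / 10000"
proof -
  have "continuous_on UNIV (\<lambda>y. defect c m a p y * sin y)" by (intro continuous_intros defect_props assms)
  from prim_2pi_bound[OF this mult_sin_bound(1)[OF defect_bound[OF assms]]] show ?thesis
    by (simp add: next_s_def)
qed

lemma next_s_diff:
  assumes "p \<in> adm" "p' \<in> adm" "\<bar>a\<bar> \<le> 1 / 1000000" "\<bar>a'\<bar> \<le> 1 / 1000000" "near \<delta> p p'"
  shows "\<bar>next_s c m a p - next_s c m a' p'\<bar> \<le> \<delta> / 20 + 18 * \<bar>a - a'\<bar>"
proof -
  let ?f = "\<lambda>y. defect c m a p y * sin y" and ?g = "\<lambda>y. defect c m a' p' y * sin y"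
  have c: "continuous_on UNIV ?f" "continuous_on UNIV ?g"
    by (intro continuous_intros defect_props assms)+
  have b: "\<bar>?f y - ?g y\<bar> \<le> \<delta> / 40 + 9 * \<bar>a - a'\<bar>" for y
    using mult_sin_bound(1)[OF defect_diff[OF assms(1,2,3,5), of y a']] by (simp add: left_diff_distrib)
  have "\<bar>prim (\<lambda>y. ?f y - ?g y) (2 * pi) / pi\<bar> \<le> 2 * (\<delta> / 40 + 9 * \<bar>a - a'\<bar>)"
    by (intro prim_2pi_bound b) (intro continuous_intros defect_props assms)
  then show ?thesis using c by (simp add: next_s_def prim_diff diff_divide_distrib)
qed

lemma rhs2_props:
  assumes "p \<in> adm" "\<bar>a\<bar> \<le> 1 / 1000000"
  shows "continuous_on UNIV (rhs2 c m a p)" "periodic_2pi (rhs2 c m a p)"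
    "rhs2 c m a p (-y) = - rhs2 c m a p y" "\<bar>rhs2 c m a p y\<bar> \<le> m"
proof -
  note E = defect_props[OF assms]
  show "continuous_on UNIV (rhs2 c m a p)" unfolding rhs2_def by (intro continuous_intros E)
  show "periodic_2pi (rhs2 c m a p)" using E(2) by (simp add: rhs2_def periodic_2pi_def)
  show "rhs2 c m a p (-y) = - rhs2 c m a p y" using E(3) by (simp add: rhs2_def algebra_simps)
  have "\<bar>fst p\<bar> \<le> 1 / 100" using admD(1) assms(1) by (cases p) auto
  moreover have "\<bar>next_s c m a p * sin y - defect c m a p y\<bar> \<le> 1"
    using mult_sin_bound(1)[OF next_s_bound[OF assms], of y] defect_bound[OF assms, of y] by argo
  ultimately have "\<bar>rhs2 c m a p y\<bar> \<le> m * 1"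
    unfolding rhs2_def by (intro abs_mult_le lam_bounds)
  then show "\<bar>rhs2 c m a p y\<bar> \<le> m" by simp
qed

lemma rhs2_diff:
  assumes "p \<in> adm" "p' \<in> adm" "\<bar>a\<bar> \<le> 1 / 1000000" "\<bar>a'\<bar> \<le> 1 / 1000000" "near \<delta> p p'"
  shows "\<bar>rhs2 c m a p y - rhs2 c m a' p' y\<bar> \<le> m * (2 * \<delta> + 27 * \<bar>a - a'\<bar>)"
proof -
  have s: "\<bar>fst p\<bar> \<le> 1 / 100" "\<bar>fst p'\<bar> \<le> 1 / 100" using admD(1) assms(1,2) by (cases p; cases p'; auto)+
  have n: "\<bar>fst p - fst p'\<bar> \<le> \<delta>" using assms(5) by (cases p; cases p') auto
  define z z' where "z = next_s c m a p * sin y - defect c m a p y"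
    and "z' = next_s c m a' p' * sin y - defect c m a' p' y"
  have z: "\<bar>z\<bar> \<le> 1"
    using mult_sin_bound(1)[OF next_s_bound[OF assms(1,3)], of y] defect_bound[OF assms(1,3), of y]
    unfolding z_def by argo
  have "\<bar>(next_s c m a p - next_s c m a' p') * sin y\<bar> \<le> \<delta> / 20 + 18 * \<bar>a - a'\<bar>"
    by (intro mult_sin_bound next_s_diff assms)
  then have zz: "\<bar>z - z'\<bar> \<le> \<delta> + 27 * \<bar>a - a'\<bar>"
    using defect_diff[OF assms(1,2,3,5), of y a'] n unfolding z_def z'_def left_diff_distrib by argo
  have "\<bar>m / (2 + m * fst p) * z - m / (2 + m * fst p') * z'\<bar>
    \<le> (m * \<bar>fst p - fst p'\<bar>) * 1 + m * (\<delta> + 27 * \<bar>a - a'\<bar>)"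
    by (intro mult_diff_bound lam_diff s zz z lam_bounds)
  also have "\<dots> = m * (\<bar>fst p - fst p'\<bar> + \<delta> + 27 * \<bar>a - a'\<bar>)" by (simp add: algebra_simps)
  also have "\<dots> \<le> m * (2 * \<delta> + 27 * \<bar>a - a'\<bar>)" using n m by (intro mult_left_mono) auto
  finally show ?thesis by (simp add: rhs2_def z_def z'_def)
qed

text \<open>These are the two solvability conditions for G'' + G = \<open>rhs2\<close> among
  periodic functions. Against cos the integrand is odd; against sin the choice of
  \<open>next_s\<close> makes the integral vanish.\<close>

lemma rhs2_mean_free:
  assumes "p \<in> adm" "\<bar>a\<bar> \<le> 1 / 1000000"
  shows "mean_free (\<lambda>y. cos y * rhs2 c m a p y)" "mean_free (\<lambda>y. sin y * rhs2 c m a p y)"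
proof -
  note F = rhs2_props[OF assms]
  show "mean_free (\<lambda>y. cos y * rhs2 c m a p y)"
    using F(2,3) by (intro mean_free_odd continuous_intros F(1)) (auto simp: periodic_2pi_def)
  define l where "l = m / (2 + m * fst p)"
  have "prim (\<lambda>y. sin y * rhs2 c m a p y) (2 * pi) =
    prim (\<lambda>y. (l * next_s c m a p) * (sin y * sin y) + (- l) * (defect c m a p y * sin y)) (2 * pi)"
    by (intro prim_cong) (simp add: rhs2_def l_def algebra_simps)
  also have "\<dots> = l * next_s c m a p * pi - l * prim (\<lambda>y. defect c m a p y * sin y) (2 * pi)"
    by (subst prim_lincomb) (auto intro!: continuous_intros defect_props assms simp: prim_sin_sq)
  also have "\<dots> = 0" by (simp add: next_s_def)
  finally show "mean_free (\<lambda>y. sin y * rhs2 c m a p y)"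
    using F(1,2) by (auto simp: mean_free_def periodic_2pi_def intro!: continuous_intros)
qed

end

lemma periodicI_lincomb:
  "periodic_2pi f \<Longrightarrow> periodic_2pi (\<lambda>y. k * (f y - l))"
  by (simp add: periodic_2pi_def)

lemma lipschitz_of_deriv:
  fixes f f' :: rfun
  assumes "\<And>y. (f has_real_derivative f' y) (at y)" "\<And>y. \<bar>f' y\<bar> \<le> B"
  shows "\<bar>f x - f y\<bar> \<le> B * \<bar>x - y\<bar>"
  using field_differentiable_bound[of UNIV f f' B x y] assms by auto

section \<open>The iteration on \<open>adm\<close>: invariance, contraction and fixed points\<close>

context small
begin

text \<open>Since \<open>rhs1\<close> is even, its primitive from 0 is odd and hence again of mean
  zero, so the second integration needs no further condition. The bounds are 126 = 7 * 18 and 882 =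
  7 * 126.\<close>

lemma prim_rhs1:
  assumes "p \<in> adm" "\<bar>a\<bar> \<le> 1 / 1000000"
  shows "mean_free (prim (rhs1 c m a p))" "prim (rhs1 c m a p) (-y) = - prim (rhs1 c m a p) y"
    "\<bar>prim (rhs1 c m a p) y\<bar> \<le> 126" "\<bar>prim (prim (rhs1 c m a p)) y\<bar> \<le> 882"
    "prim (prim (rhs1 c m a p)) (-y) = prim (prim (rhs1 c m a p)) y"
proof -
  have F: "mean_free (rhs1 c m a p)" using rhs1_mean_free[OF assms] .
  then have cF: "continuous_on UNIV (rhs1 c m a p)" by (simp add: mean_free_def)
  show odd: "prim (rhs1 c m a p) (-y) = - prim (rhs1 c m a p) y" for y
    by (intro prim_odd cF rhs1_even assms)
  show P: "mean_free (prim (rhs1 c m a p))"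
    by (intro mean_free_odd continuous_prim cF periodic_prim F odd)
  show b: "\<bar>prim (rhs1 c m a p) y\<bar> \<le> 126" for y
    using mean_free_prim_bound[OF F rhs1_bound[OF assms]] by simp
  show "\<bar>prim (prim (rhs1 c m a p)) y\<bar> \<le> 882"
    using mean_free_prim_bound[OF P b] by simp
  show "prim (prim (rhs1 c m a p)) (-y) = prim (prim (rhs1 c m a p)) y"
    by (intro prim_even continuous_prim cF odd)
qed

lemma next_H_deriv:
  assumes "p \<in> adm" "\<bar>a\<bar> \<le> 1 / 1000000"
  shows "(next_H c m a p has_real_derivative m / (2 + m * fst p) * prim (rhs1 c m a p) y) (at y)"
    and "((\<lambda>y. m / (2 + m * fst p) * prim (rhs1 c m a p) y) has_real_derivative
      m / (2 + m * fst p) * rhs1 c m a p y) (at y)"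
proof -
  have c: "continuous_on UNIV (rhs1 c m a p)" "continuous_on UNIV (prim (rhs1 c m a p))"
    using rhs1_mean_free[OF assms] by (auto simp: mean_free_def intro!: continuous_prim)
  show "(next_H c m a p has_real_derivative m / (2 + m * fst p) * prim (rhs1 c m a p) y) (at y)"
    unfolding next_H_def
    by (rule derivative_eq_intros prim_deriv c refl)+ simp
  show "((\<lambda>y. m / (2 + m * fst p) * prim (rhs1 c m a p) y) has_real_derivative
      m / (2 + m * fst p) * rhs1 c m a p y) (at y)"
    by (rule DERIV_cmult[OF prim_deriv[OF c(1)]])
qed

text \<open>Variation of constants: the derivatives of the two coefficients cancel in the first
  derivative and combine to \<open>rhs2\<close> in the second.\<close>

lemma next_G_deriv:
  assumes "p \<in> adm" "\<bar>a\<bar> \<le> 1 / 1000000"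
  defines "G' \<equiv> \<lambda>y. cos y + cos y * prim (\<lambda>s. cos s * rhs2 c m a p s) y
     + sin y * prim (\<lambda>s. sin s * rhs2 c m a p s) y"
  shows "(next_G c m a p has_real_derivative G' y) (at y)"
    and "(G' has_real_derivative rhs2 c m a p y - next_G c m a p y) (at y)"
proof -
  have c: "continuous_on UNIV (\<lambda>s. cos s * rhs2 c m a p s)" "continuous_on UNIV (\<lambda>s. sin s * rhs2 c m a p s)"
    by (intro continuous_intros rhs2_props assms)+
  note d = prim_deriv[OF c(1), of y] prim_deriv[OF c(2), of y]
  show "(next_G c m a p has_real_derivative G' y) (at y)"
    unfolding next_G_def G'_def
    by (rule derivative_eq_intros d refl)+ (simp add: algebra_simps)
  have sc: "cos y * cos y = 1 - sin y * sin y"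
    using sin_cos_squared_add3[of y] by linarith
  show "(G' has_real_derivative rhs2 c m a p y - next_G c m a p y) (at y)"
    unfolding G'_def next_G_def
    by (rule derivative_eq_intros d refl)+ (simp add: algebra_simps sc flip: mult.assoc)
qed

lemma rhs2_prim_bound:
  assumes "p \<in> adm" "\<bar>a\<bar> \<le> 1 / 1000000"
  shows "\<bar>prim (\<lambda>s. cos s * rhs2 c m a p s) y\<bar> \<le> 7 * m" "\<bar>prim (\<lambda>s. sin s * rhs2 c m a p s) y\<bar> \<le> 7 * m"
  by (intro mean_free_prim_bound rhs2_mean_free assms mult_sin_bound rhs2_props)+

text \<open>Smallness of m beats the crude constants: 1764 m and 126 m are below 1, and 14 m is
  below 1/100.\<close>

lemma picard_adm:
  assumes "p \<in> adm" "\<bar>a\<bar> \<le> 1 / 1000000"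
  shows "picard c m a p \<in> adm"
proof -
  let ?H = "next_H c m a p" and ?G = "next_G c m a p"
  note P1 = prim_rhs1[OF assms] and P2 = rhs2_prim_bound[OF assms] and F = rhs2_props[OF assms]
  have s: "\<bar>fst p\<bar> \<le> 1 / 100" using admD(1) assms(1) by (cases p) auto
  note l = lam_bounds(4)[OF s]
  have "\<bar>next_s c m a p\<bar> \<le> 1 / 100" using next_s_bound[OF assms] by argo
  moreover have "\<bar>?H y\<bar> \<le> 1" for y
  proof -
    have "\<bar>prim (prim (rhs1 c m a p)) y - prim (prim (rhs1 c m a p)) (pi / 2)\<bar> \<le> 1764"
      using P1(4)[of y] P1(4)[of "pi / 2"] by argo
    from abs_mult_le[OF l this] show ?thesis using m unfolding next_H_def by argo
  qed
  moreover have "\<bar>?H x - ?H y\<bar> \<le> 1 * \<bar>x - y\<bar>" for x y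
  proof (rule lipschitz_of_deriv[OF next_H_deriv(1)[OF assms]])
    fix y show "\<bar>m / (2 + m * fst p) * prim (rhs1 c m a p) y\<bar> \<le> 1"
      using abs_mult_le[OF l P1(3)[of y]] m by argo
  qed
  moreover have "periodic_2pi ?H"
    unfolding next_H_def by (intro periodicI_lincomb periodic_prim P1)
  moreover have "?H (-y) = ?H y" for y unfolding next_H_def P1(5) ..
  moreover have "\<bar>?G y - sin y\<bar> \<le> 1 / 100" for y
    using mult_sin_bound(2)[OF P2(1), of y y] mult_sin_bound(3)[OF P2(2), of y y] m
    unfolding next_G_def by argo
  moreover have "\<bar>?G x - ?G y\<bar> \<le> 2 * \<bar>x - y\<bar>" for x y
  proof (rule lipschitz_of_deriv[OF next_G_deriv(1)[OF assms]])
    fix y show "\<bar>cos y + cos y * prim (\<lambda>s. cos s * rhs2 c m a p s) y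
     + sin y * prim (\<lambda>s. sin s * rhs2 c m a p s) y\<bar> \<le> 2"
      using mult_sin_bound(3)[OF P2(1), of y y] mult_sin_bound(2)[OF P2(2), of y y] m
        abs_cos_le_one[of y] by argo
  qed
  moreover have "periodic_2pi ?G"
    using periodic_prim[OF rhs2_mean_free(1)[OF assms]] periodic_prim[OF rhs2_mean_free(2)[OF assms]]
    by (simp add: next_G_def periodic_2pi_def)
  moreover have "?G (-y) = - ?G y" for y
  proof -
    have "prim (\<lambda>s. cos s * rhs2 c m a p s) (-y) = prim (\<lambda>s. cos s * rhs2 c m a p s) y"
      by (intro prim_even continuous_intros F) (simp add: F)
    moreover have "prim (\<lambda>s. sin s * rhs2 c m a p s) (-y) = - prim (\<lambda>s. sin s * rhs2 c m a p s) y"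
      by (intro prim_odd continuous_intros F) (simp add: F)
    ultimately show ?thesis by (simp add: next_G_def)
  qed
  ultimately show ?thesis by (simp add: picard_def adm_def)
qed

text \<open>The updates of H and G carry a factor m that outweighs their large constants. The update
  of s has the constant 1/20 instead, and it supplies the 18 in front of |a - a'|.\<close>

lemma picard_near:
  assumes p: "p \<in> adm" "p' \<in> adm" and a: "\<bar>a\<bar> \<le> 1 / 1000000" "\<bar>a'\<bar> \<le> 1 / 1000000"
    and n: "near \<delta> p p'"
  shows "near (\<delta> / 4 + 18 * \<bar>a - a'\<bar>) (picard c m a p) (picard c m a' p')"
proof -
  let ?e = "\<bar>a - a'\<bar>"
  have d0: "0 \<le> \<delta>" using n by (cases p; cases p') auto
  note e0 = abs_ge_zero[of "a - a'"]
  have s: "\<bar>fst p\<bar> \<le> 1 / 100" "\<bar>fst p'\<bar> \<le> 1 / 100" using admD(1) p by (cases p; cases p'; auto)+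
  have ns: "\<bar>fst p - fst p'\<bar> \<le> \<delta>" using n by (cases p; cases p') auto
  have "\<bar>next_s c m a p - next_s c m a' p'\<bar> \<le> \<delta> / 4 + 18 * ?e"
    using next_s_diff[OF p a n] d0 by argo
  moreover have "\<bar>next_H c m a p y - next_H c m a' p' y\<bar> \<le> \<delta> / 4 + 18 * ?e" for y
  proof -
    have "\<bar>prim (rhs1 c m a p) y - prim (rhs1 c m a' p') y\<bar> \<le> 7 * (43 * (\<delta> + ?e))" for y
      by (intro mean_free_prim_diff_bound rhs1_mean_free rhs1_diff p a n)
    then have PP: "\<bar>prim (prim (rhs1 c m a p)) y - prim (prim (rhs1 c m a' p')) y\<bar> \<le> 7 * (7 * (43 * (\<delta> + ?e)))" for y
      by (intro mean_free_prim_diff_bound[OF prim_rhs1(1)[OF p(1) a(1)] prim_rhs1(1)[OF p(2) a(2)]])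
    define z z' where "z = prim (prim (rhs1 c m a p)) y - prim (prim (rhs1 c m a p)) (pi / 2)"
      and "z' = prim (prim (rhs1 c m a' p')) y - prim (prim (rhs1 c m a' p')) (pi / 2)"
    \<comment> \<open>4214 = 2 * 7 * 7 * 43: two integrations, and two evaluation points y and pi /
      2.\<close>
    have zz: "\<bar>z - z'\<bar> \<le> 4214 * (\<delta> + ?e)"
      using PP[of y] PP[of "pi / 2"] unfolding z_def z'_def by argo
    have z: "\<bar>z\<bar> \<le> 1764"
      using prim_rhs1(4)[OF p(1) a(1), of y] prim_rhs1(4)[OF p(1) a(1), of "pi / 2"] unfolding z_def by argo
    have "\<bar>m / (2 + m * fst p) * z - m / (2 + m * fst p') * z'\<bar>
      \<le> (m * \<bar>fst p - fst p'\<bar>) * 1764 + m * (4214 * (\<delta> + ?e))"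
      by (intro mult_diff_bound lam_diff s zz z lam_bounds)
    also have "\<dots> = m * (1764 * \<bar>fst p - fst p'\<bar> + 4214 * (\<delta> + ?e))" by (simp add: algebra_simps)
    also have "\<dots> \<le> 1 / 1000000 * (1764 * \<delta> + 4214 * (\<delta> + ?e))"
      using ns m d0 by (intro mult_mono) auto
    also have "\<dots> \<le> \<delta> / 4 + 18 * ?e" using d0 e0 by argo
    finally show ?thesis by (simp add: next_H_def z_def z'_def)
  qed
  moreover have "\<bar>next_G c m a p y - next_G c m a' p' y\<bar> \<le> \<delta> / 4 + 18 * ?e" for y
  proof -
    let ?B = "m * (2 * \<delta> + 27 * ?e)"
    have F: "\<bar>cos y * rhs2 c m a p y - cos y * rhs2 c m a' p' y\<bar> \<le> ?B"
      "\<bar>sin y * rhs2 c m a p y - sin y * rhs2 c m a' p' y\<bar> \<le> ?B" for y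
      unfolding right_diff_distrib[symmetric] by (intro mult_sin_bound rhs2_diff p a n)+
    have "\<bar>prim (\<lambda>s. cos s * rhs2 c m a p s) y - prim (\<lambda>s. cos s * rhs2 c m a' p' s) y\<bar> \<le> 7 * ?B"
      "\<bar>prim (\<lambda>s. sin s * rhs2 c m a p s) y - prim (\<lambda>s. sin s * rhs2 c m a' p' s) y\<bar> \<le> 7 * ?B"
      by (intro mean_free_prim_diff_bound rhs2_mean_free p a F)+
    from mult_sin_bound(2)[OF this(1), of y] mult_sin_bound(3)[OF this(2), of y]
    have "\<bar>next_G c m a p y - next_G c m a' p' y\<bar> \<le> m * (14 * (2 * \<delta> + 27 * ?e))"
      unfolding next_G_def right_diff_distrib by argo
    also have "\<dots> \<le> 1 / 1000000 * (14 * (2 * \<delta> + 27 * ?e))"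
      using m d0 by (intro mult_right_mono) auto
    also have "\<dots> \<le> \<delta> / 4 + 18 * ?e" using d0 e0 by argo
    finally show ?thesis .
  qed
  ultimately show ?thesis by (simp add: picard_def)
qed

lemma adm_bcontfun:
  assumes "(s, H, G) \<in> adm"
  shows "H \<in> bcontfun \<and> G \<in> bcontfun"
proof -
  have "bounded (range H)" "bounded (range G)"
    unfolding bounded_iff using admD(2,10)[OF assms] by (auto simp: real_norm_def)
  then show ?thesis
    unfolding bcontfun_def using admD(11,12)[OF assms] by blast
qed

text \<open>This is why \<open>adm\<close> bounds difference quotients and not derivatives: such
  conditions pass to pointwise limits.\<close>

lemma adm_limit:
  assumes D: "\<And>n::nat. (S n, HH n, GG n) \<in> adm" and lim: "S \<longlonglongrightarrow> s"
    "\<And>y. (\<lambda>n. HH n y) \<longlonglongrightarrow> H y" "\<And>y. (\<lambda>n. GG n y) \<longlonglongrightarrow> G y"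
  shows "(s, H, G) \<in> adm"
proof -
  note d = admD[OF D]
  have le: "\<bar>l\<bar> \<le> B" if "f \<longlonglongrightarrow> l" "\<And>n. \<bar>f n\<bar> \<le> B" for f :: "nat \<Rightarrow> real" and l B
    using LIMSEQ_le_const2[OF tendsto_rabs[OF that(1)]] that(2) by blast
  have "\<bar>s\<bar> \<le> 1 / 100" by (rule le[OF lim(1) d(1)])
  moreover have "\<bar>H y\<bar> \<le> 1" for y by (rule le[OF lim(2) d(2)])
  moreover have "\<bar>H x - H y\<bar> \<le> \<bar>x - y\<bar>" for x y
    by (rule le[OF tendsto_diff[OF lim(2) lim(2)] d(3)])
  moreover have "\<bar>G y - sin y\<bar> \<le> 1 / 100" for y
    by (rule le[OF tendsto_diff[OF lim(3) tendsto_const] d(6)])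
  moreover have "\<bar>G x - G y\<bar> \<le> 2 * \<bar>x - y\<bar>" for x y
    by (rule le[OF tendsto_diff[OF lim(3) lim(3)] d(7)])
  moreover have "periodic_2pi H" unfolding periodic_2pi_def
  proof
    fix x show "H (x + 2 * pi) = H x"
      using lim(2)[of "x + 2 * pi"] lim(2)[of x] d(4) by (intro LIMSEQ_unique) (auto simp: periodic_2pi_def)
  qed
  moreover have "periodic_2pi G" unfolding periodic_2pi_def
  proof
    fix x show "G (x + 2 * pi) = G x"
      using lim(3)[of "x + 2 * pi"] lim(3)[of x] d(8) by (intro LIMSEQ_unique) (auto simp: periodic_2pi_def)
  qed
  moreover have "H (-y) = H y" for y
    using lim(2)[of "-y"] lim(2)[of y] unfolding d(5) by (rule LIMSEQ_unique)
  moreover have "G (-y) = - G y" for y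
    using lim(3)[of "-y"] tendsto_minus[OF lim(3)[of y]] unfolding d(9) by (rule LIMSEQ_unique)
  ultimately show ?thesis by (simp add: adm_def)
qed

text \<open>The initial bound for \<open>near_fixed_points\<close>; 4 is the worst case, two
  functions G bounded by 2.\<close>

lemma near_adm:
  assumes "p \<in> adm" "p' \<in> adm"
  shows "near 4 p p'"
proof -
  obtain s H G s' H' G' where p: "p = (s, H, G)" "p' = (s', H', G')" by (cases p, cases p')
  note d = admD[OF assms(1)[unfolded p]] and d' = admD[OF assms(2)[unfolded p]]
  have "\<bar>s - s'\<bar> \<le> 4" using d(1) d'(1) by argo
  moreover have "\<bar>H y - H' y\<bar> \<le> 4" for y using d(2)[of y] d'(2)[of y] by argo
  moreover have "\<bar>G y - G' y\<bar> \<le> 4" for y using d(10)[of y] d'(10)[of y] by argo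
  ultimately show ?thesis by (simp add: p)
qed

text \<open>36 is twice the constant 18 of \<open>picard_near\<close>. The case a = a' is
  uniqueness.\<close>

lemma fixed_points_near:
  assumes "p \<in> adm" "p' \<in> adm" "\<bar>a\<bar> \<le> 1 / 1000000" "\<bar>a'\<bar> \<le> 1 / 1000000"
    and "picard c m a p = p" "picard c m a' p' = p'"
  shows "near (36 * \<bar>a - a'\<bar>) p p'"
  using near_fixed_points[OF near_adm[OF assms(1,2)], of "18 * \<bar>a - a'\<bar>"] picard_near[OF assms(1-4)] assms(5,6)
  by auto

lemma fixed_point_exists:
  assumes "\<bar>a\<bar> \<le> 1 / 1000000"
  shows "\<exists>p\<in>adm. picard c m a p = p"
proof (rule near_contraction_fixed_point)
  have "\<bar>sin x - sin y\<bar> \<le> 2 * \<bar>x - y\<bar>" for x y :: real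
    by (rule lipschitz_of_deriv[OF DERIV_sin]) (rule order_trans[OF abs_cos_le_one], simp)
  then have "(0, \<lambda>y. 0, sin) \<in> adm"
    by (simp add: adm_def periodic_2pi_def)
  then show "adm \<noteq> {}" by blast
  show "H \<in> bcontfun \<and> G \<in> bcontfun" if "(s, H, G) \<in> adm" for s H G
    using that by (rule adm_bcontfun)
  show "(s, H, G) \<in> adm" if "\<And>n::nat. (S n, HH n, GG n) \<in> adm" "S \<longlonglongrightarrow> s"
    "\<And>y. (\<lambda>n. HH n y) \<longlonglongrightarrow> H y" "\<And>y. (\<lambda>n. GG n y) \<longlonglongrightarrow> G y" for S HH GG s H G
    using that by (rule adm_limit)
  show "picard c m a p \<in> adm" if "p \<in> adm" for p
    using that assms by (rule picard_adm)
  show "near (\<delta> / 4) (picard c m a p) (picard c m a p')" if "p \<in> adm" "p' \<in> adm" "near \<delta> p p'" for p p' \<delta>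
    using picard_near[OF that(1,2) assms assms that(3)] by simp
qed

end

subsection \<open>Families depending Lipschitz continuously on the amplitude in all derivatives\<close>

text \<open>The derivatives are witnesses and not iterates of \<open>deriv\<close>, so closure rules
  follow by induction on the order. The bound on values is included because products need
  it.\<close>

fun lip_family :: "real set \<Rightarrow> nat \<Rightarrow> (real \<Rightarrow> rfun) \<Rightarrow> bool" where
  "lip_family A 0 f \<longleftrightarrow> (\<exists>C. \<forall>a\<in>A. \<forall>a'\<in>A. \<forall>x. \<bar>f a x\<bar> \<le> C \<and> \<bar>f a x - f a' x\<bar> \<le> C * \<bar>a - a'\<bar>)"
| "lip_family A (Suc n) f \<longleftrightarrow> lip_family A 0 f \<and>
     (\<exists>f'. (\<forall>a\<in>A. \<forall>x. (f a has_real_derivative f' a x) (at x)) \<and> lip_family A n f')"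

declare lip_family.simps [simp del]

lemma lip_family_SucE:
  assumes "lip_family A (Suc n) f"
  obtains f' where "lip_family A 0 f" "\<And>a x. a \<in> A \<Longrightarrow> (f a has_real_derivative f' a x) (at x)"
    "lip_family A n f'"
  using assms unfolding lip_family.simps(2) by blast

lemma lip_family_0I:
  assumes "\<And>a x. a \<in> A \<Longrightarrow> \<bar>f a x\<bar> \<le> B"
    "\<And>a a' x. a \<in> A \<Longrightarrow> a' \<in> A \<Longrightarrow> \<bar>f a x - f a' x\<bar> \<le> L * \<bar>a - a'\<bar>"
  shows "lip_family A 0 f"
  unfolding lip_family.simps
proof (intro exI[of _ "max B L"] ballI allI conjI)
  fix a a' x assume "a \<in> A" "a' \<in> A"
  then show "\<bar>f a x\<bar> \<le> max B L" using assms(1) by (simp add: le_max_iff_disj)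
  have "L * \<bar>a - a'\<bar> \<le> max B L * \<bar>a - a'\<bar>" by (intro mult_right_mono) auto
  then show "\<bar>f a x - f a' x\<bar> \<le> max B L * \<bar>a - a'\<bar>"
    using assms(2) \<open>a \<in> A\<close> \<open>a' \<in> A\<close> by (meson order_trans)
qed

lemma lip_family_0E:
  assumes "lip_family A 0 f"
  obtains C where "0 \<le> C" "\<And>a x. a \<in> A \<Longrightarrow> \<bar>f a x\<bar> \<le> C"
    "\<And>a a' x. a \<in> A \<Longrightarrow> a' \<in> A \<Longrightarrow> \<bar>f a x - f a' x\<bar> \<le> C * \<bar>a - a'\<bar>"
proof -
  obtain C where C: "\<forall>a\<in>A. \<forall>a'\<in>A. \<forall>x. \<bar>f a x\<bar> \<le> C \<and> \<bar>f a x - f a' x\<bar> \<le> C * \<bar>a - a'\<bar>"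
    using assms unfolding lip_family.simps by blast
  show ?thesis
  proof (rule that[of "max C 0"])
    show "\<bar>f a x\<bar> \<le> max C 0" if "a \<in> A" for a x using C that by (simp add: le_max_iff_disj)
    show "\<bar>f a x - f a' x\<bar> \<le> max C 0 * \<bar>a - a'\<bar>" if "a \<in> A" "a' \<in> A" for a a' x
      using C that order_trans[OF _ mult_right_mono[of C "max C 0" "\<bar>a - a'\<bar>"]] by simp
  qed simp
qed

lemma lip_family_SucI:
  assumes "lip_family A 0 f" "\<And>a x. a \<in> A \<Longrightarrow> (f a has_real_derivative f' a x) (at x)" "lip_family A n f'"
  shows "lip_family A (Suc n) f"
  using assms unfolding lip_family.simps(2) by blast

lemma lip_family_zero:
  assumes "lip_family A n f"
  shows "lip_family A 0 f"
proof (cases n)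
  case (Suc k)
  with assms have "lip_family A (Suc k) f" by simp
  then show ?thesis by (rule lip_family_SucE)
qed (use assms in simp)

lemma lip_family_lower: "lip_family A (Suc n) f \<Longrightarrow> lip_family A n f"
proof (induct n arbitrary: f)
  case 0
  then show ?case by (rule lip_family_SucE)
next
  case (Suc n)
  obtain f' where f: "lip_family A 0 f" "\<And>a x. a \<in> A \<Longrightarrow> (f a has_real_derivative f' a x) (at x)"
    "lip_family A (Suc n) f'" by (rule lip_family_SucE[OF Suc.prems]) (rule that)
  show ?case by (rule lip_family_SucI[OF f(1,2) Suc.hyps[OF f(3)]])
qed

lemma lip_family_cong:
  assumes "lip_family A n f" "\<And>a. a \<in> A \<Longrightarrow> f a = g a"
  shows "lip_family A n g"
proof -
  have 0: "lip_family A 0 g"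
    using lip_family_zero[OF assms(1)] assms(2) by (simp add: lip_family.simps(1))
  show ?thesis
  proof (cases n)
    case (Suc k)
    with assms(1) have "lip_family A (Suc k) f" by simp
    then obtain f' where "lip_family A 0 f" and f: "\<And>a x. a \<in> A \<Longrightarrow> (f a has_real_derivative f' a x) (at x)"
      "lip_family A k f'" by (rule lip_family_SucE) (rule that)
    show ?thesis
      unfolding Suc by (rule lip_family_SucI[OF 0 _ f(2)]) (simp add: f(1) flip: assms(2))
  qed (use 0 in simp)
qed

lemma lip_family_add:
  "lip_family A n f \<Longrightarrow> lip_family A n g \<Longrightarrow> lip_family A n (\<lambda>a x. f a x + g a x)"
proof (induct n arbitrary: f g)
  case 0
  obtain B where B: "0 \<le> B" "\<And>a x. a \<in> A \<Longrightarrow> \<bar>f a x\<bar> \<le> B"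
    "\<And>a a' x. a \<in> A \<Longrightarrow> a' \<in> A \<Longrightarrow> \<bar>f a x - f a' x\<bar> \<le> B * \<bar>a - a'\<bar>"
    by (rule lip_family_0E[OF 0(1)]) (rule that)
  obtain C where C: "0 \<le> C" "\<And>a x. a \<in> A \<Longrightarrow> \<bar>g a x\<bar> \<le> C"
    "\<And>a a' x. a \<in> A \<Longrightarrow> a' \<in> A \<Longrightarrow> \<bar>g a x - g a' x\<bar> \<le> C * \<bar>a - a'\<bar>"
    by (rule lip_family_0E[OF 0(2)]) (rule that)
  note * = B(2,3) C(2,3)
  show ?case
  proof (rule lip_family_0I[of _ _ "B + C" "B + C"])
    fix a a' x assume A: "a \<in> A" "a' \<in> A"
    show "\<bar>f a x + g a x\<bar> \<le> B + C" using *(1,3)[OF A(1), of x] by linarith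
    show "\<bar>f a x + g a x - (f a' x + g a' x)\<bar> \<le> (B + C) * \<bar>a - a'\<bar>"
      using *(2,4)[OF A, of x] unfolding distrib_right by linarith
  qed
next
  case (Suc n)
  obtain f' where f: "lip_family A 0 f" "\<And>a x. a \<in> A \<Longrightarrow> (f a has_real_derivative f' a x) (at x)"
    "lip_family A n f'" by (rule lip_family_SucE[OF Suc.prems(1)]) (rule that)
  obtain g' where g: "lip_family A 0 g" "\<And>a x. a \<in> A \<Longrightarrow> (g a has_real_derivative g' a x) (at x)"
    "lip_family A n g'" by (rule lip_family_SucE[OF Suc.prems(2)]) (rule that)
  note * = f(2,3) g(2,3)
  show ?case
  proof (rule lip_family_SucI[of A _ "\<lambda>a x. f' a x + g' a x"])
    show "lip_family A 0 (\<lambda>a x. f a x + g a x)"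
      by (rule lip_family_zero[OF Suc.hyps[OF lip_family_lower[OF Suc.prems(1)] lip_family_lower[OF Suc.prems(2)]]])
    show "((\<lambda>x. f a x + g a x) has_real_derivative f' a x + g' a x) (at x)" if "a \<in> A" for a x
      using that by (intro DERIV_add *)
  qed (intro Suc.hyps *)
qed

lemma lip_family_mult:
  "lip_family A n f \<Longrightarrow> lip_family A n g \<Longrightarrow> lip_family A n (\<lambda>a x. f a x * g a x)"
proof (induct n arbitrary: f g)
  case 0
  obtain B where B: "0 \<le> B" "\<And>a x. a \<in> A \<Longrightarrow> \<bar>f a x\<bar> \<le> B"
    "\<And>a a' x. a \<in> A \<Longrightarrow> a' \<in> A \<Longrightarrow> \<bar>f a x - f a' x\<bar> \<le> B * \<bar>a - a'\<bar>"
    by (rule lip_family_0E[OF 0(1)]) (rule that)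
  obtain C where C: "0 \<le> C" "\<And>a x. a \<in> A \<Longrightarrow> \<bar>g a x\<bar> \<le> C"
    "\<And>a a' x. a \<in> A \<Longrightarrow> a' \<in> A \<Longrightarrow> \<bar>g a x - g a' x\<bar> \<le> C * \<bar>a - a'\<bar>"
    by (rule lip_family_0E[OF 0(2)]) (rule that)
  note * = B(2,3) C(2,3)
  show ?case
  proof (rule lip_family_0I[of _ _ "B * C" "B * C + B * C"])
    fix a a' x assume A: "a \<in> A" "a' \<in> A"
    show "\<bar>f a x * g a x\<bar> \<le> B * C" by (intro abs_mult_le * A)
    have "\<bar>f a x * g a x - f a' x * g a' x\<bar> \<le> (B * \<bar>a - a'\<bar>) * C + B * (C * \<bar>a - a'\<bar>)"
      by (intro mult_diff_bound * A)
    then show "\<bar>f a x * g a x - f a' x * g a' x\<bar> \<le> (B * C + B * C) * \<bar>a - a'\<bar>"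
      by (simp add: algebra_simps)
  qed
next
  case (Suc n)
  obtain f' where f: "lip_family A 0 f" "\<And>a x. a \<in> A \<Longrightarrow> (f a has_real_derivative f' a x) (at x)"
    "lip_family A n f'" by (rule lip_family_SucE[OF Suc.prems(1)]) (rule that)
  obtain g' where g: "lip_family A 0 g" "\<And>a x. a \<in> A \<Longrightarrow> (g a has_real_derivative g' a x) (at x)"
    "lip_family A n g'" by (rule lip_family_SucE[OF Suc.prems(2)]) (rule that)
  note * = f(2,3) g(2,3)
  note lower = lip_family_lower[OF Suc.prems(1)] lip_family_lower[OF Suc.prems(2)]
  show ?case
  proof (rule lip_family_SucI)
    show "lip_family A 0 (\<lambda>a x. f a x * g a x)"
      by (rule lip_family_zero[OF Suc.hyps[OF lower]])
    show "((\<lambda>x. f a x * g a x) has_real_derivative f' a x * g a x + g' a x * f a x) (at x)" if "a \<in> A" for a x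
      using that by (intro DERIV_mult *)
  qed (intro lip_family_add Suc.hyps lower *)
qed

lemma lip_family_param:
  assumes "\<And>a. a \<in> A \<Longrightarrow> \<bar>k a\<bar> \<le> B" "\<And>a a'. a \<in> A \<Longrightarrow> a' \<in> A \<Longrightarrow> \<bar>k a - k a'\<bar> \<le> L * \<bar>a - a'\<bar>"
  shows "lip_family A n (\<lambda>a x. k a)"
proof (cases n)
  case 0
  show ?thesis unfolding 0 by (rule lip_family_0I[OF assms])
next
  case (Suc k')
  have z: "lip_family A n (\<lambda>a x. 0)" for n
  proof (induct n)
    case 0
    show ?case by (rule lip_family_0I[of _ _ 0 0]) auto
  next
    case (Suc n)
    show ?case by (rule lip_family_SucI[OF lip_family_zero[OF Suc] _ Suc]) auto
  qed
  show ?thesis unfolding Suc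
    by (rule lip_family_SucI[OF lip_family_0I[OF assms] _ z]) auto
qed

lemma lip_family_const [simp]: "lip_family A n (\<lambda>a x. k)"
  by (rule lip_family_param[of _ _ "\<bar>k\<bar>" 0]) auto

lemma lip_family_scale: "lip_family A n f \<Longrightarrow> lip_family A n (\<lambda>a x. k * f a x)"
  by (intro lip_family_mult) auto

lemma lip_family_diff:
  "lip_family A n f \<Longrightarrow> lip_family A n g \<Longrightarrow> lip_family A n (\<lambda>a x. f a x - g a x)"
  using lip_family_add[of A n f "\<lambda>a x. -1 * g a x"] lip_family_scale[of A n g "-1"] by simp

lemma lip_family_sin_cos: "lip_family A n (\<lambda>a. sin)" "lip_family A n (\<lambda>a. cos)"
proof (induct n)
  case 0
  show "lip_family A 0 (\<lambda>a. sin)" "lip_family A 0 (\<lambda>a. cos)"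
    by (rule lip_family_0I[of _ _ 1 0]; simp)+
next
  case (Suc n)
  show "lip_family A (Suc n) (\<lambda>a. sin)"
    by (rule lip_family_SucI[of _ _ "\<lambda>a. cos"]) (auto intro: lip_family_zero[OF Suc(1)] Suc(2))
  show "lip_family A (Suc n) (\<lambda>a. cos)"
    by (rule lip_family_SucI[of _ _ "\<lambda>a x. (-1) * sin x"])
       (auto intro: lip_family_zero[OF Suc(2)] Suc(1) lip_family_scale[of _ _ "\<lambda>a. sin" "-1", simplified])
qed

text \<open>A Lipschitz bound in x takes the place of a derivative. This starts the bootstrap, when
  no derivative is yet known to depend well on a.\<close>

lemma lip_family_shift_0:
  assumes f: "lip_family A 0 f" and L: "\<And>a x y. a \<in> A \<Longrightarrow> \<bar>f a x - f a y\<bar> \<le> L * \<bar>x - y\<bar>" "0 \<le> L"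
    and d: "\<And>a a'. a \<in> A \<Longrightarrow> a' \<in> A \<Longrightarrow> \<bar>d a - d a'\<bar> \<le> K * \<bar>a - a'\<bar>"
  shows "lip_family A 0 (\<lambda>a x. f a (x + d a))"
proof -
  obtain C where "0 \<le> C" and C: "\<And>a x. a \<in> A \<Longrightarrow> \<bar>f a x\<bar> \<le> C"
    "\<And>a a' x. a \<in> A \<Longrightarrow> a' \<in> A \<Longrightarrow> \<bar>f a x - f a' x\<bar> \<le> C * \<bar>a - a'\<bar>"
    by (rule lip_family_0E[OF f]) (rule that)
  show ?thesis
  proof (rule lip_family_0I[of _ _ C "L * K + C"])
    fix a a' x assume A: "a \<in> A" "a' \<in> A"
    show "\<bar>f a (x + d a)\<bar> \<le> C" using C A by blast
    have "\<bar>f a (x + d a) - f a (x + d a')\<bar> \<le> L * \<bar>(x + d a) - (x + d a')\<bar>" by (rule L(1)[OF A(1)])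
    also have "\<dots> \<le> L * (K * \<bar>a - a'\<bar>)" using d[OF A] L(2) by (intro mult_left_mono) auto
    finally show "\<bar>f a (x + d a) - f a' (x + d a')\<bar> \<le> (L * K + C) * \<bar>a - a'\<bar>"
      using C(2)[OF A, of "x + d a'"] by (simp add: algebra_simps)
  qed
qed

text \<open>The shift varies with a, so comparing two members moves the argument and costs one
  derivative.\<close>

lemma lip_family_shift:
  assumes "lip_family A (Suc n) f"
    and d: "\<And>a a'. a \<in> A \<Longrightarrow> a' \<in> A \<Longrightarrow> \<bar>d a - d a'\<bar> \<le> K * \<bar>a - a'\<bar>"
  shows "lip_family A n (\<lambda>a x. f a (x + d a))"
  using assms(1)
proof (induct n arbitrary: f)
  case (0 f)
  then obtain f' where f: "lip_family A 0 f" "\<And>a x. a \<in> A \<Longrightarrow> (f a has_real_derivative f' a x) (at x)"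
    "lip_family A 0 f'" by (rule lip_family_SucE) (rule that)
  obtain C where C: "0 \<le> C" "\<And>a x. a \<in> A \<Longrightarrow> \<bar>f' a x\<bar> \<le> C"
    by (rule lip_family_0E[OF f(3)]) (rule that)
  show ?case
    by (rule lip_family_shift_0[OF f(1) _ C(1) d]) (auto intro: lipschitz_of_deriv f(2) C(2))
next
  case (Suc n)
  obtain f' where "lip_family A 0 f" and f: "\<And>a x. a \<in> A \<Longrightarrow> (f a has_real_derivative f' a x) (at x)"
    "lip_family A (Suc n) f'" by (rule lip_family_SucE[OF Suc.prems]) (rule that)
  show ?case
  proof (rule lip_family_SucI)
    show "lip_family A 0 (\<lambda>a x. f a (x + d a))"
      by (rule lip_family_zero[OF Suc.hyps[OF lip_family_lower[OF Suc.prems]]])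
    show "((\<lambda>x. f a (x + d a)) has_real_derivative f' a (x + d a)) (at x)" if "a \<in> A" for a x
      using f(1)[OF that, of "x + d a"] by (simp add: DERIV_shift)
    show "lip_family A n (\<lambda>a x. f' a (x + d a))" by (rule Suc.hyps[OF f(2)])
  qed
qed

text \<open>Mean zero excludes linear growth, so the bounds survive integration on the whole
  line.\<close>

lemma lip_family_prim:
  assumes "lip_family A 0 f" "\<And>a. a \<in> A \<Longrightarrow> mean_free (f a)"
  shows "lip_family A 0 (\<lambda>a. prim (f a))"
proof -
  obtain C where "0 \<le> C" and C: "\<And>a x. a \<in> A \<Longrightarrow> \<bar>f a x\<bar> \<le> C"
    "\<And>a a' x. a \<in> A \<Longrightarrow> a' \<in> A \<Longrightarrow> \<bar>f a x - f a' x\<bar> \<le> C * \<bar>a - a'\<bar>"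
    by (rule lip_family_0E[OF assms(1)]) (rule that)
  show ?thesis
  proof (rule lip_family_0I[of _ _ "7 * C" "7 * C"])
    fix a a' x assume A: "a \<in> A" "a' \<in> A"
    show "\<bar>prim (f a) x\<bar> \<le> 7 * C" by (intro mean_free_prim_bound assms C A)
    show "\<bar>prim (f a) x - prim (f a') x\<bar> \<le> 7 * C * \<bar>a - a'\<bar>"
      unfolding mult.assoc by (intro mean_free_prim_diff_bound assms C A)
  qed
qed

lemma lip_family_deriv:
  assumes "lip_family A (Suc n) f"
  shows "lip_family A n (\<lambda>a. deriv (f a))"
proof -
  obtain f' where "lip_family A 0 f" and f: "\<And>a x. a \<in> A \<Longrightarrow> (f a has_real_derivative f' a x) (at x)"
    "lip_family A n f'" by (rule lip_family_SucE[OF assms]) (rule that)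
  show ?thesis by (rule lip_family_cong[OF f(2)]) (auto intro!: ext DERIV_imp_deriv[symmetric] f(1))
qed

lemma lip_family_funpow_deriv:
  "lip_family A (n + k) f \<Longrightarrow> lip_family A n (\<lambda>a. (deriv ^^ k) (f a))"
proof (induct k arbitrary: f)
  case (Suc k)
  have "lip_family A (n + k) (\<lambda>a. deriv (f a))" using Suc.prems by (intro lip_family_deriv) simp
  from Suc.hyps[OF this] show ?case by (simp add: funpow_swap1)
qed simp

lemma lip_family_smooth:
  assumes "\<And>n. lip_family A n f" "a \<in> A"
  shows "(deriv ^^ k) (f a) differentiable (at x)"
proof -
  have "lip_family A (Suc 0) (\<lambda>a. (deriv ^^ k) (f a))" by (rule lip_family_funpow_deriv[OF assms(1)])
  then show ?thesis by (rule lip_family_SucE) (use assms(2) in \<open>auto simp: real_differentiable_def\<close>)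
qed

lemma funpow_deriv_diff:
  fixes f g :: rfun
  assumes "\<And>k x. (deriv ^^ k) f differentiable (at x)" "\<And>k x. (deriv ^^ k) g differentiable (at x)"
  shows "(deriv ^^ k) (\<lambda>x. f x - g x) = (\<lambda>x. (deriv ^^ k) f x - (deriv ^^ k) g x)"
proof (induct k)
  case (Suc k)
  have "deriv (\<lambda>x. (deriv ^^ k) f x - (deriv ^^ k) g x) x = deriv ((deriv ^^ k) f) x - deriv ((deriv ^^ k) g) x" for x
    using assms by (intro deriv_diff) (simp_all add: field_differentiable_def real_differentiable_def)
  with Suc show ?case by auto
qed simp

text \<open>The norm is a finite sum of suprema, so the Lipschitz constants of the derivatives up to
  order s add up.\<close>

lemma lip_family_W_norm:
  assumes f: "\<And>n. lip_family A n f"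
  shows "\<exists>C\<ge>0. \<forall>a\<in>A. \<forall>a'\<in>A. W_norm s (\<lambda>x. f a x - f a' x) \<le> C * \<bar>a - a'\<bar>"
proof -
  have "\<exists>C\<ge>0. \<forall>a\<in>A. \<forall>a'\<in>A. \<forall>x. \<bar>(deriv ^^ k) (f a) x - (deriv ^^ k) (f a') x\<bar> \<le> C * \<bar>a - a'\<bar>" for k
    by (rule lip_family_0E[OF lip_family_funpow_deriv[OF f, of 0 k]]) blast
  then obtain C where C: "\<And>k. 0 \<le> C k" "\<And>k a a' x. a \<in> A \<Longrightarrow> a' \<in> A \<Longrightarrow>
    \<bar>(deriv ^^ k) (f a) x - (deriv ^^ k) (f a') x\<bar> \<le> C k * \<bar>a - a'\<bar>" by metis
  show ?thesis
  proof (intro exI[of _ "sum C {..s}"] conjI ballI)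
    show "0 \<le> sum C {..s}" by (intro sum_nonneg C)
    fix a a' assume A: "a \<in> A" "a' \<in> A"
    have "(deriv ^^ k) (\<lambda>x. f a x - f a' x) = (\<lambda>x. (deriv ^^ k) (f a) x - (deriv ^^ k) (f a') x)" for k
      by (intro funpow_deriv_diff lip_family_smooth[OF f] A)
    then show "W_norm s (\<lambda>x. f a x - f a' x) \<le> sum C {..s} * \<bar>a - a'\<bar>"
      unfolding W_norm_def sum_distrib_right using C(2)[OF A] by (auto intro!: sum_mono cSUP_least)
  qed
qed

subsection \<open>The branch of fixed points\<close>

text \<open>Written as an interval so that unfolding it gives the amplitude range of the theorem
  with \<open>a_per\<close> equal to 1/1000000.\<close>

definition amps :: "real set" where "amps = {- (1 / 1000000) .. 1 / 1000000}"

lemma amps_iff: "a \<in> amps \<longleftrightarrow> \<bar>a\<bar> \<le> 1 / 1000000"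
  by (auto simp: amps_def)

context small
begin

text \<open>On \<open>amps\<close> the choice is the only fixed point in \<open>adm\<close>, by
  \<open>sol_unique\<close>; elsewhere its value is arbitrary.\<close>

definition sol :: "real \<Rightarrow> state" where "sol a = (SOME p. p \<in> adm \<and> picard c m a p = p)"

abbreviation sol_s :: "real \<Rightarrow> real" where "sol_s a \<equiv> fst (sol a)"
abbreviation sol_H :: "real \<Rightarrow> rfun" where "sol_H a \<equiv> fst (snd (sol a))"
abbreviation sol_G :: "real \<Rightarrow> rfun" where "sol_G a \<equiv> snd (snd (sol a))"

lemma sol:
  assumes "a \<in> amps"
  shows "sol a \<in> adm" "picard c m a (sol a) = sol a"
proof -
  have "\<exists>p. p \<in> adm \<and> picard c m a p = p"
    using fixed_point_exists[of a] assms unfolding amps_iff by blast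
  from someI_ex[OF this] have "sol a \<in> adm \<and> picard c m a (sol a) = sol a"
    unfolding sol_def .
  then show "sol a \<in> adm" "picard c m a (sol a) = sol a" by (rule conjunct1, rule conjunct2)
qed

lemma sol_near:
  assumes "a \<in> amps" "a' \<in> amps"
  shows "near (36 * \<bar>a - a'\<bar>) (sol a) (sol a')"
  by (rule fixed_points_near[OF sol(1)[OF assms(1)] sol(1)[OF assms(2)]
        assms(1)[unfolded amps_iff] assms(2)[unfolded amps_iff] sol(2)[OF assms(1)] sol(2)[OF assms(2)]])

lemma sol_unique:
  assumes "a \<in> amps" "p \<in> adm" "picard c m a p = p"
  shows "sol a = p"
proof -
  have "near 0 (sol a) p"
    using fixed_points_near[OF sol(1)[OF assms(1)] assms(2) assms(1)[unfolded amps_iff]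
        assms(1)[unfolded amps_iff] sol(2)[OF assms(1)] assms(3)] by simp
  then show ?thesis by (cases "sol a"; cases p) auto
qed

lemma sol_components:
  assumes "a \<in> amps"
  shows "next_s c m a (sol a) = sol_s a" "next_H c m a (sol a) = sol_H a" "next_G c m a (sol a) = sol_G a"
  using arg_cong[OF sol(2)[OF assms], of fst] arg_cong[OF sol(2)[OF assms], of "\<lambda>p. fst (snd p)"]
    arg_cong[OF sol(2)[OF assms], of "\<lambda>p. snd (snd p)"]
  unfolding picard_def by simp_all

lemma sol_mem: "a \<in> amps \<Longrightarrow> (sol_s a, sol_H a, sol_G a) \<in> adm"
  using sol(1) by simp

lemmas sol_adm = admD[OF sol_mem]

definition sol_H' :: "real \<Rightarrow> rfun" where
  "sol_H' a = (\<lambda>y. m / (2 + m * sol_s a) * prim (rhs1 c m a (sol a)) y)"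

definition sol_G' :: "real \<Rightarrow> rfun" where
  "sol_G' a = (\<lambda>y. cos y + cos y * prim (\<lambda>s. cos s * rhs2 c m a (sol a) s) y
     + sin y * prim (\<lambda>s. sin s * rhs2 c m a (sol a) s) y)"

text \<open>At a fixed point the derivative formulas for the iterates become the differential
  equations themselves.\<close>

lemma sol_deriv:
  assumes "a \<in> amps"
  shows "(sol_H a has_real_derivative sol_H' a y) (at y)"
    "(sol_H' a has_real_derivative m / (2 + m * sol_s a) * rhs1 c m a (sol a) y) (at y)"
    "(sol_G a has_real_derivative sol_G' a y) (at y)"
    "(sol_G' a has_real_derivative rhs2 c m a (sol a) y - sol_G a y) (at y)"
proof -
  have a: "\<bar>a\<bar> \<le> 1 / 1000000" using assms by (simp add: amps_iff)
  note H = next_H_deriv[OF sol(1)[OF assms] a, of y, unfolded sol_components[OF assms], folded sol_H'_def]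
  note G = next_G_deriv[OF sol(1)[OF assms] a, of y, unfolded sol_components[OF assms], folded sol_G'_def]
  show "(sol_H a has_real_derivative sol_H' a y) (at y)"
    using H(1) by (simp add: sol_H'_def)
  show "(sol_H' a has_real_derivative m / (2 + m * sol_s a) * rhs1 c m a (sol a) y) (at y)" by (rule H(2))
  show "(sol_G a has_real_derivative sol_G' a y) (at y)"
    using G(1) by (simp add: sol_G'_def)
  show "(sol_G' a has_real_derivative rhs2 c m a (sol a) y - sol_G a y) (at y)" by (rule G(2))
qed

definition sol_d :: "real \<Rightarrow> real" where "sol_d a = 2 * wspeed c m (sol_s a)"

lemma sol_s_bound: "a \<in> amps \<Longrightarrow> \<bar>sol_s a\<bar> \<le> 1 / 100"
  by (rule sol_adm(1))

lemma sol_diff: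
  assumes "a \<in> amps" "a' \<in> amps"
  shows "\<bar>sol_s a - sol_s a'\<bar> \<le> 36 * \<bar>a - a'\<bar>" "\<bar>sol_H a y - sol_H a' y\<bar> \<le> 36 * \<bar>a - a'\<bar>"
    "\<bar>sol_G a y - sol_G a' y\<bar> \<le> 36 * \<bar>a - a'\<bar>" "\<bar>sol_d a - sol_d a'\<bar> \<le> 36 * \<bar>a - a'\<bar>"
proof -
  show s: "\<bar>sol_s a - sol_s a'\<bar> \<le> 36 * \<bar>a - a'\<bar>" and "\<bar>sol_H a y - sol_H a' y\<bar> \<le> 36 * \<bar>a - a'\<bar>"
    "\<bar>sol_G a y - sol_G a' y\<bar> \<le> 36 * \<bar>a - a'\<bar>"
    using sol_near[OF assms] near.simps[of _ "sol_s a" "sol_H a" "sol_G a" "sol_s a'" "sol_H a'" "sol_G a'"]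
    by simp_all
  show "\<bar>sol_d a - sol_d a'\<bar> \<le> 36 * \<bar>a - a'\<bar>"
    unfolding sol_d_def by (rule order_trans[OF wspeed_diff[OF sol_s_bound sol_s_bound] s]) (use assms in auto)
qed

lemma lip_params:
  "lip_family amps n (\<lambda>a x. a)" "lip_family amps n (\<lambda>a x. sol_s a)"
  "lip_family amps n (\<lambda>a x. m / (2 + m * sol_s a))"
proof -
  show "lip_family amps n (\<lambda>a x. a)"
    by (rule lip_family_param[of _ _ 1 1]) (auto simp: amps_iff)
  show "lip_family amps n (\<lambda>a x. sol_s a)"
    by (rule lip_family_param[OF sol_s_bound sol_diff(1)])
  show "lip_family amps n (\<lambda>a x. m / (2 + m * sol_s a))"
  proof (rule lip_family_param)
    fix a a' assume A: "a \<in> amps" "a' \<in> amps"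
    show "\<bar>m / (2 + m * sol_s a)\<bar> \<le> m" by (rule lam_bounds[OF sol_s_bound[OF A(1)]])
    have "\<bar>m / (2 + m * sol_s a) - m / (2 + m * sol_s a')\<bar> \<le> m * \<bar>sol_s a - sol_s a'\<bar>"
      by (rule lam_diff[OF sol_s_bound sol_s_bound]) (use A in auto)
    also have "\<dots> \<le> m * (36 * \<bar>a - a'\<bar>)" using m sol_diff(1)[OF A] by (intro mult_left_mono) auto
    finally show "\<bar>m / (2 + m * sol_s a) - m / (2 + m * sol_s a')\<bar> \<le> (m * 36) * \<bar>a - a'\<bar>" by simp
  qed
qed

lemma lip_F:
  assumes "lip_family amps n sol_H" "lip_family amps n sol_G"
    "lip_family amps n (\<lambda>a y. sol_H a (y + sol_d a))" "lip_family amps n (\<lambda>a y. sol_G a (y + sol_d a))"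
    "lip_family amps n (\<lambda>a y. sol_H a (y + (- sol_d a)))" "lip_family amps n (\<lambda>a y. sol_G a (y + (- sol_d a)))"
  shows "lip_family amps n (\<lambda>a. rhs1 c m a (sol a))" "lip_family amps n (\<lambda>a. rhs2 c m a (sol a))"
proof -
  define X where "X = (\<lambda>a. Xf m a (sol_H a) (sol_G a))"
  define Y where "Y = (\<lambda>a. Yf m a (sol_H a) (sol_G a))"
  note lips = lip_family_add lip_family_diff lip_family_mult lip_family_const lip_params lip_family_sin_cos
  have XY: "lip_family amps n (\<lambda>a y. X a (y + e a))" "lip_family amps n (\<lambda>a y. Y a (y + e a))"
    if "lip_family amps n (\<lambda>a y. sol_H a (y + e a))" "lip_family amps n (\<lambda>a y. sol_G a (y + e a))" for e
    unfolding X_def Y_def Xf_def Yf_def by (intro lips that)+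
  note XYs = XY[OF assms(3,4)] XY[OF assms(5,6)] XY[of "\<lambda>a. 0", simplified, OF assms(1,2)]
  have rhs1: "rhs1 c m a (sol a) = row1 (sol_d a) (X a) (Y a)" for a
    by (cases "sol a") (simp add: rhs1_def X_def Y_def sol_d_def)
  \<comment> \<open>Division is turned into multiplication by a constant, so that the product rule
    for families applies.\<close>
  have half: "t / 2 = t * inverse 2" for t :: real by (simp only: divide_inverse)
  show "lip_family amps n (\<lambda>a. rhs1 c m a (sol a))"
    unfolding rhs1 row1_def half by (intro lips XYs)
  have defect: "defect c m a (sol a) = (\<lambda>y. 4 * a * (sol_H a y * sol_G a y) + m * row2 (sol_d a) (X a) (Y a) y
      - sol_s a * (sol_G a y - sin y))" for a
    by (cases "sol a") (simp add: defect_def nonlin_def X_def Y_def sol_d_def fun_eq_iff)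
  have "lip_family amps n (\<lambda>a y. m / (2 + m * sol_s a) * (sol_s a * sin y - defect c m a (sol a) y))"
    unfolding defect row2_def half by (intro lips XYs assms)
  then show "lip_family amps n (\<lambda>a. rhs2 c m a (sol a))"
    \<comment> \<open>At the fixed point \<open>next_s\<close> is s itself, whose dependence on a is
      already known.\<close>
    by (rule lip_family_cong) (simp add: rhs2_def sol_components)
qed

lemma lip_sol: "lip_family amps n sol_H" "lip_family amps n sol_G"
proof -
  have base: "lip_family amps 0 sol_H" "lip_family amps 0 sol_G"
    by (rule lip_family_0I[OF sol_adm(2) sol_diff(2)] lip_family_0I[OF sol_adm(10) sol_diff(3)]; assumption)+
  \<comment> \<open>The Lipschitz constants 1 and 2 required by \<open>adm\<close> serve here in
    place of derivative bounds.\<close>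
  have shift0: "lip_family amps 0 (\<lambda>a y. sol_H a (y + e a))" "lip_family amps 0 (\<lambda>a y. sol_G a (y + e a))"
    if "\<And>a a'. a \<in> amps \<Longrightarrow> a' \<in> amps \<Longrightarrow> \<bar>e a - e a'\<bar> \<le> 36 * \<bar>a - a'\<bar>" for e
    by (rule lip_family_shift_0[OF base(1), where L=1 and K=36], use that sol_adm in simp_all)
       (rule lip_family_shift_0[OF base(2), where L=2 and K=36], use that sol_adm in simp_all)
  have d: "\<bar>- sol_d a - - sol_d a'\<bar> \<le> 36 * \<bar>a - a'\<bar>" if "a \<in> amps" "a' \<in> amps" for a a'
    using sol_diff(4)[OF that] by argo
  note lips = lip_family_add lip_family_diff lip_family_mult lip_family_const lip_params lip_family_sin_cos
  have F0: "lip_family amps 0 (\<lambda>a. rhs1 c m a (sol a))" "lip_family amps 0 (\<lambda>a. rhs2 c m a (sol a))"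
    by (intro lip_F base shift0 sol_diff(4) d; assumption)+
  have mf: "mean_free (rhs1 c m a (sol a))" "mean_free (\<lambda>s. cos s * rhs2 c m a (sol a) s)"
    "mean_free (\<lambda>s. sin s * rhs2 c m a (sol a) s)" if "a \<in> amps" for a
    using rhs1_mean_free rhs2_mean_free sol(1)[OF that] that by (simp_all add: amps_iff)
  \<comment> \<open>Both first derivatives are given by integrals, so order 0 of the right-hand
    sides already yields order 1 of H and G.\<close>
  have D0: "lip_family amps 0 sol_H'" "lip_family amps 0 sol_G'"
    unfolding sol_H'_def sol_G'_def
    by (intro lips lip_family_prim F0 mf; assumption)+
  have "lip_family amps (Suc n) sol_H \<and> lip_family amps (Suc n) sol_G" for n
  proof (induct n)
    case 0
    show ?case
      by (intro conjI lip_family_SucI[OF base(1) sol_deriv(1) D0(1)] lip_family_SucI[OF base(2) sol_deriv(3) D0(2)])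
  next
    case (Suc n)
    then have H: "lip_family amps (Suc n) sol_H" and G: "lip_family amps (Suc n) sol_G" by auto
    note shifts = lip_family_shift[OF H sol_diff(4)] lip_family_shift[OF G sol_diff(4)]
      lip_family_shift[where d="\<lambda>a. - sol_d a", OF H d] lip_family_shift[where d="\<lambda>a. - sol_d a", OF G d]
    note F = lip_F[OF lip_family_lower[OF H] lip_family_lower[OF G] shifts]
    have "lip_family amps (Suc n) sol_H'"
      by (rule lip_family_SucI[OF D0(1) sol_deriv(2)], assumption) (intro lips F)
    moreover have "lip_family amps (Suc n) sol_G'"
      by (rule lip_family_SucI[OF D0(2) sol_deriv(4)], assumption) (intro lips F lip_family_lower[OF G])
    ultimately show ?case
      by (intro conjI lip_family_SucI[OF base(1) sol_deriv(1)] lip_family_SucI[OF base(2) sol_deriv(3)])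
  qed
  then have *: "lip_family amps (Suc n) sol_H" "lip_family amps (Suc n) sol_G" by auto
  show "lip_family amps n sol_H" by (rule lip_family_lower[OF *(1)])
  show "lip_family amps n sol_G" by (rule lip_family_lower[OF *(2)])
qed

end

subsection \<open>Reduction of the traveling wave equation\<close>

definition res1 :: "rfun \<Rightarrow> rfun \<Rightarrow> rfun" where
  "res1 z1 z2 = (\<lambda>x. (z1 (x + 2) + z2 (x + 2) - 2 * z1 x + z1 (x - 2) - z2 (x - 2)) / 2)"

definition res2 :: "real \<Rightarrow> rfun \<Rightarrow> rfun \<Rightarrow> rfun" where
  "res2 \<mu> z1 z2 = (\<lambda>x. - 2 * z2 x -
     \<mu> * ((z1 (x + 2) - z1 (x - 2) + z2 (x + 2) + 2 * z2 x + z2 (x - 2)) / 2))"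

lemma AopDop: "Aop (Dop f) = (\<lambda>x. (f (x + 2) - f (x - 2)) / 4)"
  by (rule ext) (simp add: Aop_def Dop_def shiftop_def add.assoc diff_divide_distrib add_divide_distrib)

lemma AopAop: "Aop (Aop f) = (\<lambda>x. (f (x + 2) + 2 * f x + f (x - 2)) / 4)"
  by (rule ext) (simp add: Aop_def shiftop_def add.assoc add_divide_distrib)

lemma DopDop: "Dop (Dop f) = (\<lambda>x. (f (x + 2) - 2 * f x + f (x - 2)) / 4)"
  by (rule ext) (simp add: Dop_def shiftop_def add.assoc diff_divide_distrib add_divide_distrib)

text \<open>In these coordinates \<open>Lmu\<close> splits into the local rows \<open>res1\<close>,
  \<open>res2\<close> and the coupling A \<delta> \<open>res2\<close>. The same coupling appears
  when \<open>Tmu_inv\<close> acts on the second derivatives.\<close>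

lemma Lmu_Tmu_inv:
  "fst (Lmu \<mu> (Tmu_inv \<mu> (z1, z2))) x = - (res1 z1 z2 x + (res2 \<mu> z1 z2 (x + 2) - res2 \<mu> z1 z2 (x - 2)) / 4)"
  "snd (Lmu \<mu> (Tmu_inv \<mu> (z1, z2))) x = - res2 \<mu> z1 z2 x"
proof -
  \<comment> \<open>Nested shifts are brought to a normal form so that equal arguments
    match.\<close>
  have sh: "x + 2 + 2 = x + 4" "x - 2 - 2 = x - 4" "x + 4 + 2 = x + 6" "x - 4 - 2 = x - 6"
    "x + 4 - 2 = x + 2" "x - 4 + 2 = x - 2" "x + 2 - 2 = x" "x - 2 + 2 = x"
    "x + 6 + 2 = x + 8" "x - 6 - 2 = x - 8" "x + 6 - 2 = x + 4" "x - 6 + 2 = x - 4"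
    by simp_all
  show "fst (Lmu \<mu> (Tmu_inv \<mu> (z1, z2))) x = - (res1 z1 z2 x + (res2 \<mu> z1 z2 (x + 2) - res2 \<mu> z1 z2 (x - 2)) / 4)"
    unfolding Lmu_def Tmu_inv_def Let_def fst_conv snd_conv AopAop AopDop DopDop res1_def res2_def sh
    by (simp add: field_simps)
  show "snd (Lmu \<mu> (Tmu_inv \<mu> (z1, z2))) x = - res2 \<mu> z1 z2 x"
    unfolding Lmu_def Tmu_inv_def Let_def fst_conv snd_conv AopAop AopDop DopDop res1_def res2_def sh
    by (simp add: field_simps power2_eq_square)
qed

lemma Lmu_add:
  "fst (Lmu \<mu> (\<lambda>x. f1 x + g1 x, \<lambda>x. f2 x + g2 x)) x = fst (Lmu \<mu> (f1, f2)) x + fst (Lmu \<mu> (g1, g2)) x"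
  "snd (Lmu \<mu> (\<lambda>x. f1 x + g1 x, \<lambda>x. f2 x + g2 x)) x = snd (Lmu \<mu> (f1, f2)) x + snd (Lmu \<mu> (g1, g2)) x"
  unfolding Lmu_def Let_def fst_conv snd_conv AopAop AopDop DopDop
  by (simp_all add: field_simps)

text \<open>Since \<open>Qmu\<close> is \<open>Q0\<close> conjugated by \<open>Tmu\<close>, linear
  and quadratic terms together are \<open>Tmu_inv\<close> of the local z. The triangular coupling
  then cancels, leaving one local equation per component.\<close>

lemma Gop_zero:
  assumes d1: "\<And>x. (g1 has_real_derivative g1' x) (at x)" "\<And>x. (g1' has_real_derivative g1'' x) (at x)"
    and d2: "\<And>x. (g2 has_real_derivative g2' x) (at x)" "\<And>x. (g2' has_real_derivative g2'' x) (at x)"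
    and z: "z1 = (\<lambda>x. g1 x + (g1 x * g1 x + g2 x * g2 x))" "z2 = (\<lambda>x. g2 x + (g1 x * g2 x + g2 x * g1 x))"
    and e1: "\<And>x. c\<^sup>2 * g1'' x = res1 z1 z2 x"
    and e2: "\<And>x. c\<^sup>2 * \<mu> * g2'' x = res2 \<mu> z1 z2 x"
  shows "Gop c (Tmu_inv \<mu> (g1, g2)) \<mu> = ((\<lambda>x. 0), (\<lambda>x. 0))"
proof -
  define h where "h = Tmu_inv \<mu> (g1, g2)"
  have "Tmu \<mu> h = (g1, g2)" by (simp add: h_def Tmu_def Tmu_inv_def)
  then have Q: "Qmu \<mu> h h = Tmu_inv \<mu> (\<lambda>x. g1 x * g1 x + g2 x * g2 x, \<lambda>x. g1 x * g2 x + g2 x * g1 x)"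
    by (simp add: Qmu_def Q0_def)
  have sum: "Tmu_inv \<mu> (z1, z2) = (\<lambda>x. fst h x + fst (Qmu \<mu> h h) x, \<lambda>x. snd h x + snd (Qmu \<mu> h h) x)"
    unfolding Q unfolding h_def by (simp add: Tmu_inv_def z AopDop fun_eq_iff field_simps)
  have L: "fst (Lmu \<mu> h) x + fst (Lmu \<mu> (Qmu \<mu> h h)) x = fst (Lmu \<mu> (Tmu_inv \<mu> (z1, z2))) x"
    "snd (Lmu \<mu> h) x + snd (Lmu \<mu> (Qmu \<mu> h h)) x = snd (Lmu \<mu> (Tmu_inv \<mu> (z1, z2))) x" for x
    unfolding sum Lmu_add by simp_all
  have sh: "((\<lambda>x. f (x + 2)) has_real_derivative f' (x + 2)) (at x)"
      "((\<lambda>x. f (x - 2)) has_real_derivative f' (x - 2)) (at x)"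
    if "\<And>x. (f has_real_derivative f' x) (at x)" for f f' and x :: real
    using that[of "x + 2"] that[of "x - 2"] DERIV_shift[of f _ x 2] DERIV_shift[of f _ x "-2"] by simp_all
  have h: "fst h = (\<lambda>x. g1 x + \<mu> * ((g2 (x + 2) - g2 (x - 2)) / 4))" "snd h = g2"
    by (simp_all add: h_def Tmu_inv_def AopDop)
  have "deriv (fst h) = (\<lambda>x. g1' x + \<mu> * ((g2' (x + 2) - g2' (x - 2)) / 4))"
    unfolding h by (intro ext DERIV_imp_deriv DERIV_add DERIV_cmult DERIV_cdivide DERIV_diff d1 sh d2)
  then have h1: "deriv (deriv (fst h)) = (\<lambda>x. g1'' x + \<mu> * ((g2'' (x + 2) - g2'' (x - 2)) / 4))"
    by (simp only:) (intro ext DERIV_imp_deriv DERIV_add DERIV_cmult DERIV_cdivide DERIV_diff d1 sh d2)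
  have "deriv g2 = g2'" "deriv g2' = g2''" by (intro ext DERIV_imp_deriv d2)+
  then have h2: "deriv (deriv (snd h)) = g2''" by (simp add: h)
  \<comment> \<open>The coupling term in the first component is the second equation taken at x + 2
    and x - 2.\<close>
  have "c\<^sup>2 * deriv (deriv (fst h)) x = res1 z1 z2 x + (res2 \<mu> z1 z2 (x + 2) - res2 \<mu> z1 z2 (x - 2)) / 4" for x
    using e1[of x] e2[of "x + 2"] e2[of "x - 2"] unfolding h1 by (simp add: algebra_simps diff_divide_distrib)
  then show ?thesis
    unfolding h_def[symmetric] Gop_def Let_def using L
    by (simp add: h2 e2 Lmu_Tmu_inv add.assoc)
qed

subsection \<open>The critical frequency\<close>

text \<open>A chain of witnesses again. It suits implicitly defined functions, whose derivative is
  an expression in the function itself.\<close>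

fun diff_upto :: "nat \<Rightarrow> real set \<Rightarrow> rfun \<Rightarrow> bool" where
  "diff_upto 0 S f \<longleftrightarrow> True"
| "diff_upto (Suc n) S f \<longleftrightarrow>
     (\<exists>f'. (\<forall>x\<in>S. (f has_real_derivative f' x) (at x)) \<and> diff_upto n S f')"

declare diff_upto.simps(2) [simp del]

lemma diff_upto_SucI:
  "(\<And>x. x \<in> S \<Longrightarrow> (f has_real_derivative f' x) (at x)) \<Longrightarrow> diff_upto n S f' \<Longrightarrow> diff_upto (Suc n) S f"
  unfolding diff_upto.simps(2) by blast

lemma diff_upto_SucE:
  assumes "diff_upto (Suc n) S f"
  obtains f' where "\<And>x. x \<in> S \<Longrightarrow> (f has_real_derivative f' x) (at x)" "diff_upto n S f'"
  using assms unfolding diff_upto.simps(2) by blast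

lemma diff_upto_lower: "diff_upto (Suc n) S f \<Longrightarrow> diff_upto n S f"
proof (induct n arbitrary: f)
  case (Suc n)
  obtain f' where f: "\<And>x. x \<in> S \<Longrightarrow> (f has_real_derivative f' x) (at x)" "diff_upto (Suc n) S f'"
    by (rule diff_upto_SucE[OF Suc.prems]) (rule that)
  show ?case by (rule diff_upto_SucI[OF f(1) Suc.hyps[OF f(2)]])
qed simp

lemma diff_upto_cong:
  assumes "open S" "diff_upto n S f" "\<And>x. x \<in> S \<Longrightarrow> f x = g x"
  shows "diff_upto n S g"
proof (cases n)
  case (Suc k)
  with assms(2) have "diff_upto (Suc k) S f" by simp
  then obtain f' where f: "\<And>x. x \<in> S \<Longrightarrow> (f has_real_derivative f' x) (at x)" "diff_upto k S f'"
    by (rule diff_upto_SucE) (rule that)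
  have "(g has_real_derivative f' x) (at x)" if "x \<in> S" for x
    by (rule has_field_derivative_transform_within_open[OF f(1)[OF that] assms(1) that assms(3)])
  then show ?thesis unfolding Suc by (rule diff_upto_SucI[OF _ f(2)])
qed simp

lemma diff_upto_const: "diff_upto n S (\<lambda>x. k)"
proof (cases n)
  case (Suc j)
  have z: "diff_upto i S (\<lambda>x. 0)" for i
  proof (induct i)
    case (Suc i)
    show ?case by (rule diff_upto_SucI[OF _ Suc]) auto
  qed simp
  show ?thesis unfolding Suc by (rule diff_upto_SucI[OF _ z]) auto
qed simp

lemma diff_upto_add: "diff_upto n S f \<Longrightarrow> diff_upto n S g \<Longrightarrow> diff_upto n S (\<lambda>x. f x + g x)"
proof (induct n arbitrary: f g)
  case (Suc n)
  obtain f' where f: "\<And>x. x \<in> S \<Longrightarrow> (f has_real_derivative f' x) (at x)" "diff_upto n S f'"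
    by (rule diff_upto_SucE[OF Suc.prems(1)]) (rule that)
  obtain g' where g: "\<And>x. x \<in> S \<Longrightarrow> (g has_real_derivative g' x) (at x)" "diff_upto n S g'"
    by (rule diff_upto_SucE[OF Suc.prems(2)]) (rule that)
  show ?case by (rule diff_upto_SucI[OF DERIV_add[OF f(1) g(1)] Suc.hyps[OF f(2) g(2)]])
qed simp

lemma diff_upto_mult: "diff_upto n S f \<Longrightarrow> diff_upto n S g \<Longrightarrow> diff_upto n S (\<lambda>x. f x * g x)"
proof (induct n arbitrary: f g)
  case (Suc n)
  obtain f' where f: "\<And>x. x \<in> S \<Longrightarrow> (f has_real_derivative f' x) (at x)" "diff_upto n S f'"
    by (rule diff_upto_SucE[OF Suc.prems(1)]) (rule that)
  obtain g' where g: "\<And>x. x \<in> S \<Longrightarrow> (g has_real_derivative g' x) (at x)" "diff_upto n S g'"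
    by (rule diff_upto_SucE[OF Suc.prems(2)]) (rule that)
  show ?case
    by (rule diff_upto_SucI[OF DERIV_mult[OF f(1) g(1)] diff_upto_add[OF
          Suc.hyps[OF f(2) diff_upto_lower[OF Suc.prems(2)]] Suc.hyps[OF g(2) diff_upto_lower[OF Suc.prems(1)]]]])
qed simp

lemma diff_upto_diff:
  assumes "diff_upto n S f" "diff_upto n S g"
  shows "diff_upto n S (\<lambda>x. f x - g x)"
  using diff_upto_add[OF assms(1) diff_upto_mult[OF diff_upto_const[of n S "-1"] assms(2)]] by simp

lemma diff_upto_power: "diff_upto n S f \<Longrightarrow> diff_upto n S (\<lambda>x. f x ^ k)"
  by (induct k) (auto intro: diff_upto_const diff_upto_mult)

lemma diff_upto_inverse:
  "diff_upto n S f \<Longrightarrow> (\<And>x. x \<in> S \<Longrightarrow> f x \<noteq> 0) \<Longrightarrow> diff_upto n S (\<lambda>x. inverse (f x))"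
proof (induct n)
  case (Suc n)
  obtain f' where f: "\<And>x. x \<in> S \<Longrightarrow> (f has_real_derivative f' x) (at x)" "diff_upto n S f'"
    by (rule diff_upto_SucE[OF Suc.prems(1)]) (rule that)
  have i: "diff_upto n S (\<lambda>x. inverse (f x))" using Suc.hyps diff_upto_lower Suc.prems by blast
  have d: "((\<lambda>x. inverse (f x)) has_real_derivative -1 * (f' x * (inverse (f x) * inverse (f x)))) (at x)"
    if "x \<in> S" for x
    using DERIV_inverse'[OF f(1)[OF that] Suc.prems(2)[OF that]] by (simp add: mult_ac)
  show ?case
    by (rule diff_upto_SucI[OF d], assumption) (intro diff_upto_mult diff_upto_const f i)
qed simp

lemma diff_upto_sin_cos:
  "diff_upto n S f \<Longrightarrow> diff_upto n S (\<lambda>x. sin (f x)) \<and> diff_upto n S (\<lambda>x. cos (f x))"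
proof (induct n)
  case (Suc n)
  obtain f' where f: "\<And>x. x \<in> S \<Longrightarrow> (f has_real_derivative f' x) (at x)" "diff_upto n S f'"
    by (rule diff_upto_SucE[OF Suc.prems(1)]) (rule that)
  have i: "diff_upto n S (\<lambda>x. sin (f x))" "diff_upto n S (\<lambda>x. cos (f x))"
    using Suc.hyps[OF diff_upto_lower[OF Suc.prems]] by auto
  have d: "((\<lambda>x. sin (f x)) has_real_derivative cos (f x) * f' x) (at x)"
    "((\<lambda>x. cos (f x)) has_real_derivative -1 * (sin (f x) * f' x)) (at x)" if "x \<in> S" for x
    using DERIV_fun_sin[OF f(1)[OF that]] DERIV_fun_cos[OF f(1)[OF that]] by simp_all
  have "diff_upto (Suc n) S (\<lambda>x. sin (f x))"
    by (rule diff_upto_SucI[OF d(1)], assumption) (intro diff_upto_mult f i)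
  moreover have "diff_upto (Suc n) S (\<lambda>x. cos (f x))"
    by (rule diff_upto_SucI[OF d(2)], assumption) (intro diff_upto_mult diff_upto_const f i)
  ultimately show ?case ..
qed simp

text \<open>Iterates of \<open>deriv\<close> agree with the witnesses on S only; openness makes this
  sufficient for the next derivative.\<close>

lemma smooth_onI_diff_upto:
  assumes "open S" "\<And>n. diff_upto n S f"
  shows "smooth_on S f"
proof -
  have *: "diff_upto n S ((deriv ^^ k) f)" for n k
  proof (induct k arbitrary: n)
    case (Suc k)
    obtain f' where f: "\<And>x. x \<in> S \<Longrightarrow> ((deriv ^^ k) f has_real_derivative f' x) (at x)" "diff_upto n S f'"
      by (rule diff_upto_SucE[OF Suc[of "Suc n"]]) (rule that)
    have "f' x = deriv ((deriv ^^ k) f) x" if "x \<in> S" for x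
      using DERIV_imp_deriv[OF f(1)[OF that]] by simp
    from diff_upto_cong[OF assms(1) f(2) this] show ?case by simp
  qed (simp add: assms)
  show ?thesis
    unfolding smooth_on_def
  proof (intro allI ballI)
    fix k x assume x: "x \<in> S"
    show "(deriv ^^ k) f differentiable at x"
      by (rule diff_upto_SucE[OF *[of "Suc 0"]]) (use x in \<open>auto simp: real_differentiable_def\<close>)
  qed
qed

text \<open>The dispersion relation solved for \<mu>, with k for \<open>c\<^sup>2\<close>. In terms
  of q = k w^2 it reads (2 q - 4 sin^2 w) / (q (q - 2)).\<close>

definition disp :: "real \<Rightarrow> real \<Rightarrow> real" where
  "disp k w = (2 * k * w ^ 2 - 4 * (sin w) ^ 2) / (k ^ 2 * w ^ 4 - 2 * k * w ^ 2)"

text \<open>The quotient is expressed by \<open>inverse\<close> and powers so that the closure rules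
  of \<open>diff_upto\<close> apply directly.\<close>

definition disp' :: "real \<Rightarrow> real \<Rightarrow> real" where
  "disp' k w = ((4 * k * w - 8 * sin w * cos w) * (k ^ 2 * w ^ 4 - 2 * k * w ^ 2)
     - (2 * k * w ^ 2 - 4 * (sin w) ^ 2) * (4 * k ^ 2 * w ^ 3 - 4 * k * w))
     * (inverse (k ^ 2 * w ^ 4 - 2 * k * w ^ 2)) ^ 2"

text \<open>For w \<ge> 10 the function behaves like 2 / (k w^2): the oscillating terms are too
  small to spoil strict monotonicity.\<close>

lemma disp_facts:
  assumes "2 \<le> k" "10 \<le> w"
  shows "200 \<le> k * w ^ 2" "0 < k ^ 2 * w ^ 4 - 2 * k * w ^ 2" "0 < disp k w"
    "(disp k has_real_derivative disp' k w) (at w)" "disp' k w < 0" "disp k w \<le> 2 / (k * w ^ 2 - 2)"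
proof -
  define q where "q = k * w ^ 2"
  have "2 * (10 ^ 2) \<le> k * w ^ 2" using assms by (intro mult_mono power_mono) auto
  then show q: "200 \<le> k * w ^ 2" by simp
  then have q: "200 \<le> q" by (simp add: q_def)
  have den: "k ^ 2 * w ^ 4 - 2 * k * w ^ 2 = q * (q - 2)"
    by (simp add: q_def algebra_simps power2_eq_square power4_eq_xxxx)
  show den0: "0 < k ^ 2 * w ^ 4 - 2 * k * w ^ 2" unfolding den using q by simp
  have s: "0 \<le> (sin w) ^ 2" "(sin w) ^ 2 \<le> 1" by (auto simp: abs_square_le_1)
  have num: "2 * k * w ^ 2 - 4 * (sin w) ^ 2 = 2 * q - 4 * (sin w)^2" by (simp add: q_def)
  show "0 < disp k w" unfolding disp_def using den0 num q s by (intro divide_pos_pos) auto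
  have "((\<lambda>w. 2 * k * w ^ 2 - 4 * (sin w) ^ 2) has_real_derivative 4 * k * w - 8 * sin w * cos w) (at w)"
    "((\<lambda>w. k ^ 2 * w ^ 4 - 2 * k * w ^ 2) has_real_derivative 4 * k ^ 2 * w ^ 3 - 4 * k * w) (at w)"
    by (auto intro!: derivative_eq_intros)
  from DERIV_divide[OF this] den0
  have "(disp k has_real_derivative ((4 * k * w - 8 * sin w * cos w) * (k ^ 2 * w ^ 4 - 2 * k * w ^ 2)
     - (2 * k * w ^ 2 - 4 * (sin w) ^ 2) * (4 * k ^ 2 * w ^ 3 - 4 * k * w))
     / ((k ^ 2 * w ^ 4 - 2 * k * w ^ 2) * (k ^ 2 * w ^ 4 - 2 * k * w ^ 2))) (at w)"
    unfolding disp_def[abs_def] by simp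
  moreover have "t / (e * e) = t * (inverse e) ^ 2" for t e :: real
    by (simp add: divide_inverse power2_eq_square)
  ultimately show "(disp k has_real_derivative disp' k w) (at w)" unfolding disp'_def by simp
  define v where "v = k * w"
  have v: "20 \<le> v" using mult_mono[of 2 k 10 w] assms by (simp add: v_def)
  have sc: "\<bar>sin w * cos w\<bar> \<le> 1"
    using mult_mono[of "\<bar>sin w\<bar>" 1 "\<bar>cos w\<bar>" 1] by (simp add: abs_mult)
  \<comment> \<open>With v = k w the positive term is at most 5 v q^2 and the negative one at least
    v q (8 q - 24) in size, which is larger since q \<ge> 200.\<close>
  have "(4 * k * w - 8 * sin w * cos w) * (k ^ 2 * w ^ 4 - 2 * k * w ^ 2) \<le> (4 * v + 8) * (q * (q - 2))"
    unfolding den using sc q by (intro mult_right_mono) (auto simp: v_def abs_le_iff)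
  also have "\<dots> \<le> (5 * v) * (q * q)" using v q by (intro mult_mono) auto
  also have "\<dots> = v * q * (5 * q)" by simp
  also have "\<dots> < v * q * (8 * q - 24)" using q v by (intro mult_strict_left_mono) auto
  also have "\<dots> \<le> (2 * q - 4) * (4 * v * q - 4 * v)" using v by (simp add: algebra_simps)
  also have "\<dots> \<le> (2 * k * w ^ 2 - 4 * (sin w) ^ 2) * (4 * v * q - 4 * v)"
    using s v q unfolding num by (intro mult_right_mono) auto
  also have "4 * v * q - 4 * v = 4 * k ^ 2 * w ^ 3 - 4 * k * w"
    by (simp add: v_def q_def power2_eq_square power3_eq_cube)
  finally show "disp' k w < 0"
    unfolding disp'_def using den0 by (intro mult_neg_pos) auto
  have "disp k w \<le> (2 * q) / (q * (q - 2))"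
    unfolding disp_def num den using s q by (intro divide_right_mono) auto
  then show "disp k w \<le> 2 / (k * w ^ 2 - 2)" using q by (simp add: q_def[symmetric])
qed

lemma disp_strict:
  assumes "2 \<le> k" "10 \<le> x" "x < y"
  shows "disp k y < disp k x"
proof (rule DERIV_neg_imp_decreasing[OF assms(3)])
  fix w assume "x \<le> w" "w \<le> y"
  then show "\<exists>y. (disp k has_real_derivative y) (at w) \<and> y < 0"
    using disp_facts(4,5)[OF assms(1), of w] assms(2) by auto
qed

lemma disp_inverse_exists:
  assumes "2 \<le> k" "0 < \<mu>" "\<mu> < disp k 10"
  shows "\<exists>w>10. disp k w = \<mu>"
proof -
  \<comment> \<open>Chosen so that W \<mu> > 2, hence 2 / W < \<mu>.\<close>
  define W where "W = 10 + 3 / \<mu>"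
  have W: "10 \<le> W" "10 < W" using assms by (simp_all add: W_def)
  have "2 / (k * W ^ 2 - 2) \<le> 2 / W"
  proof (rule divide_left_mono)
    have "W * W \<ge> 10 * W" using W by (intro mult_right_mono) auto
    moreover have "k * (W * W) \<ge> 2 * (W * W)" using assms(1) by (intro mult_right_mono) auto
    ultimately show *: "W \<le> k * W ^ 2 - 2" using W unfolding power2_eq_square by linarith
    show "0 < (k * W ^ 2 - 2) * W" using W * by (intro mult_pos_pos) auto
  qed auto
  also have "2 < W * \<mu>" using assms by (simp add: W_def algebra_simps add_pos_pos)
  then have "2 / W < \<mu>" using W by (simp add: divide_less_eq mult.commute)
  finally have "disp k W < \<mu>" using disp_facts(6)[OF assms(1) W(1)] by linarith
  moreover have "continuous_on {10..W} (disp k)"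
    using disp_facts(4)[OF assms(1)] by (intro continuous_at_imp_continuous_on ballI) (auto intro: DERIV_isCont)
  ultimately obtain w where "10 \<le> w" "disp k w = \<mu>"
    using IVT2'[of "disp k" W \<mu> 10] assms W by auto
  moreover have "w \<noteq> 10" using assms calculation by auto
  ultimately show ?thesis by (intro exI[of _ w]) auto
qed

text \<open>Dividing the squared dispersion relation by \<open>\<mu>\<close> makes it linear in \<open>\<mu>\<close>, so \<open>\<mu>\<close> is an explicit
  function of \<open>\<omega>\<close>; the other root of the quadratic would satisfy \<open>c\<^sup>2 \<mu> \<omega>\<^sup>2 < 2\<close>.\<close>

lemma crit_iff:
  assumes "2 < c\<^sup>2" "0 < \<mu>" "\<mu> < 1 / (50 * c\<^sup>2)"
  shows "\<omega> \<ge> 0 \<and> c^2 * \<mu> * \<omega>^2 = 1 + \<mu> + sqrt ((1 + \<mu>)^2 - 4 * \<mu> * (sin \<omega>)^2)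
    \<longleftrightarrow> 10 \<le> \<omega> \<and> disp (c\<^sup>2) \<omega> = \<mu>"
proof -
  define k where "k = c\<^sup>2"
  have k: "2 < k" and mu: "\<mu> < 1 / (50 * k)" using assms by (auto simp: k_def)
  define q where "q = k * \<omega> ^ 2"
  define s where "s = (sin \<omega>) ^ 2"
  have s: "0 \<le> s" "s \<le> 1" by (auto simp: s_def abs_square_le_1)
  have mu1: "50 * k * \<mu> < 1" using mu k by (simp add: field_simps)
  have "100 * \<mu> \<le> 50 * k * \<mu>" using k assms(2) by (intro mult_right_mono) auto
  then have mu1': "\<mu> < 1 / 100" using mu1 by linarith
  have D: "(1 + \<mu>)^2 - 4 * \<mu> * s \<ge> (1 - \<mu>)^2"
    using mult_left_mono[OF s(2), of "4 * \<mu>"] assms(2) by (simp add: power2_eq_square algebra_simps)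
  then have sq: "sqrt ((1 + \<mu>)^2 - 4 * \<mu> * s) \<ge> 1 - \<mu>" by (intro real_le_rsqrt)
  have D0: "(1 + \<mu>)^2 - 4 * \<mu> * s \<ge> 0" using D by (meson order_trans zero_le_power2)
  have sqD: "(sqrt ((1 + \<mu>)^2 - 4 * \<mu> * s)) ^ 2 = (1 + \<mu>)^2 - 4 * \<mu> * s" using D0 by simp
  have poly: "(\<mu> * q - (1 + \<mu>)) ^ 2 - ((1 + \<mu>)^2 - 4 * \<mu> * s) = \<mu> * (\<mu> * (q * (q - 2)) - (2 * q - 4 * s))"
    by (simp add: power2_eq_square algebra_simps)
  have den: "k ^ 2 * \<omega> ^ 4 - 2 * k * \<omega> ^ 2 = q * (q - 2)"
    by (simp add: q_def algebra_simps power2_eq_square power4_eq_xxxx)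
  have disp: "disp k \<omega> = (2 * q - 4 * s) / (q * (q - 2))"
    unfolding disp_def den by (simp add: q_def s_def)
  have "\<omega> \<ge> 0 \<and> \<mu> * q = 1 + \<mu> + sqrt ((1 + \<mu>)^2 - 4 * \<mu> * s) \<longleftrightarrow> 10 \<le> \<omega> \<and> disp k \<omega> = \<mu>"
  proof (intro iffI conjI; elim conjE)
    assume w: "\<omega> \<ge> 0" and eq: "\<mu> * q = 1 + \<mu> + sqrt ((1 + \<mu>)^2 - 4 * \<mu> * s)"
    have "2 \<le> \<mu> * q" using eq sq by simp
    \<comment> \<open>The bound 1 / (50 c^2) on \<mu> is made for this step: \<mu> q \<ge> 2 then
      forces w^2 \<ge> 100.\<close>
    have "100 * (k * \<mu>) \<le> \<mu> * q" using mu1 \<open>2 \<le> \<mu> * q\<close> by linarith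
    then have "(k * \<mu>) * 100 \<le> (k * \<mu>) * \<omega> ^ 2" by (simp add: q_def mult_ac)
    then have "10 ^ 2 \<le> \<omega> ^ 2" using k assms(2) by simp
    then show w10: "10 \<le> \<omega>" using w power2_le_imp_le by blast
    have "(\<mu> * q - (1 + \<mu>)) ^ 2 = (1 + \<mu>)^2 - 4 * \<mu> * s" using eq sqD by simp
    then have "\<mu> * (q * (q - 2)) = 2 * q - 4 * s" using poly assms(2) by simp
    moreover have "0 < q * (q - 2)" using disp_facts(2)[of k \<omega>] k w10 unfolding den by simp
    then have "q * (q - 2) \<noteq> 0" by linarith
    ultimately show "disp k \<omega> = \<mu>" unfolding disp by (simp add: field_simps)
  next
    assume w: "10 \<le> \<omega>" and eq: "disp k \<omega> = \<mu>"
    then show "0 \<le> \<omega>" by simp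
    have q: "200 \<le> q" using disp_facts(1)[of k \<omega>] k w by (simp add: q_def)
    then have e: "\<mu> * (q * (q - 2)) = 2 * q - 4 * s" using eq unfolding disp by (auto simp: field_simps)
    \<comment> \<open>The nonnegative right-hand side selects the larger root: \<mu> q \<ge> 2
      exceeds 1 + \<mu>, so the absolute value below opens with a plus sign.\<close>
    then have "(\<mu> * q - 2) * (q - 2) = 4 * (1 - s)" by (simp add: algebra_simps)
    then have "0 \<le> (\<mu> * q - 2) * (q - 2)" using s by simp
    then have "2 \<le> \<mu> * q" using q by (simp add: zero_le_mult_iff)
    moreover have "(\<mu> * q - (1 + \<mu>)) ^ 2 = (1 + \<mu>)^2 - 4 * \<mu> * s" using poly e by simp
    then have "\<bar>\<mu> * q - (1 + \<mu>)\<bar> = sqrt ((1 + \<mu>)^2 - 4 * \<mu> * s)" by (metis real_sqrt_abs)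
    ultimately show "\<mu> * q = 1 + \<mu> + sqrt ((1 + \<mu>)^2 - 4 * \<mu> * s)" using mu1' by simp
  qed
  then show ?thesis by (simp add: q_def k_def s_def mult_ac)
qed

text \<open>The first bound gives a frequency above 10 by the intermediate value theorem, the second
  excludes solutions below 10.\<close>

definition mu_max :: "real \<Rightarrow> real" where
  "mu_max c = min (disp (c\<^sup>2) 10) (1 / (50 * c\<^sup>2))"

lemma omega_crit_props:
  assumes "2 < c\<^sup>2" "0 < \<mu>" "\<mu> < mu_max c"
  shows "10 < omega_crit c \<mu>" "disp (c\<^sup>2) (omega_crit c \<mu>) = \<mu>"
    "c^2 * \<mu> * (omega_crit c \<mu>)^2 = 1 + \<mu> + sqrt ((1 + \<mu>)^2 - 4 * \<mu> * (sin (omega_crit c \<mu>))^2)"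
    "\<And>w. 10 \<le> w \<Longrightarrow> disp (c\<^sup>2) w = \<mu> \<Longrightarrow> w = omega_crit c \<mu>"
proof -
  have mu: "\<mu> < disp (c\<^sup>2) 10" "\<mu> < 1 / (50 * c\<^sup>2)" and k: "2 \<le> c\<^sup>2" using assms by (auto simp: mu_max_def)
  obtain w where w: "w > 10" "disp (c\<^sup>2) w = \<mu>"
    using disp_inverse_exists[OF k assms(2) mu(1)] by blast
  have uniq: "x = w" if "10 \<le> x" "disp (c\<^sup>2) x = \<mu>" for x
    using disp_strict[OF k, of x w] disp_strict[OF k, of w x] that w by (cases x w rule: linorder_cases) auto
  have "omega_crit c \<mu> = w"
    unfolding omega_crit_def crit_iff[OF assms(1,2) mu(2)] using w uniq by (intro the_equality) auto
  then show "10 < omega_crit c \<mu>" "disp (c\<^sup>2) (omega_crit c \<mu>) = \<mu>"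
    "\<And>w. 10 \<le> w \<Longrightarrow> disp (c\<^sup>2) w = \<mu> \<Longrightarrow> w = omega_crit c \<mu>"
    using w uniq by auto
  then show "c^2 * \<mu> * (omega_crit c \<mu>)^2 = 1 + \<mu> + sqrt ((1 + \<mu>)^2 - 4 * \<mu> * (sin (omega_crit c \<mu>))^2)"
    using crit_iff[OF assms(1,2) mu(2), of "omega_crit c \<mu>"] by auto
qed

lemma omega_crit_deriv:
  assumes "2 < c\<^sup>2" "0 < \<mu>" "\<mu> < mu_max c"
  shows "(omega_crit c has_real_derivative inverse (disp' (c\<^sup>2) (omega_crit c \<mu>))) (at \<mu>)"
proof -
  have k: "2 \<le> c\<^sup>2" using assms by simp
  note p = omega_crit_props[OF assms]
  \<comment> \<open>A larger mass ratio has a smaller frequency, still above 10. This leaves room to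
    the left of the frequency at \<mu>, so \<open>omega_crit\<close> inverts \<open>disp\<close> on
    a two-sided neighbourhood.\<close>
  define \<mu>1 where "\<mu>1 = (\<mu> + mu_max c) / 2"
  have mu1: "0 < \<mu>1" "\<mu>1 < mu_max c" "\<mu> < \<mu>1" using assms by (auto simp: \<mu>1_def)
  note p1 = omega_crit_props[OF assms(1) mu1(1,2)]
  have w: "omega_crit c \<mu>1 < omega_crit c \<mu>"
  proof (rule ccontr)
    assume "\<not> ?thesis"
    then have "disp (c\<^sup>2) (omega_crit c \<mu>1) \<le> disp (c\<^sup>2) (omega_crit c \<mu>)"
      using disp_strict[OF k, of "omega_crit c \<mu>" "omega_crit c \<mu>1"] p by (cases "omega_crit c \<mu> = omega_crit c \<mu>1") auto
    then show False using p p1 mu1 by simp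
  qed
  define d where "d = (omega_crit c \<mu> - omega_crit c \<mu>1) / 2"
  have inv: "10 < z \<and> omega_crit c (disp (c\<^sup>2) z) = z" if "\<bar>z - omega_crit c \<mu>\<bar> \<le> d" for z
  proof -
    have z: "omega_crit c \<mu>1 < z" using that w unfolding d_def by argo
    then have "disp (c\<^sup>2) z < \<mu>1" "10 < z" using disp_strict[OF k, of "omega_crit c \<mu>1" z] p1 by auto
    moreover have "0 < disp (c\<^sup>2) z" using disp_facts(3)[OF k, of z] \<open>10 < z\<close> by simp
    ultimately show ?thesis
      using omega_crit_props(4)[OF assms(1), of "disp (c\<^sup>2) z" z] mu1 by simp
  qed
  have "isCont (omega_crit c) (disp (c\<^sup>2) (omega_crit c \<mu>))"
    by (rule isCont_inverse_function[of d])
       (use inv w disp_facts(4)[OF k] in \<open>auto simp: d_def intro: DERIV_isCont order.strict_implies_order\<close>)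
  then have cont: "isCont (omega_crit c) \<mu>" by (simp add: p)
  show ?thesis
  proof (rule DERIV_inverse_function[where f="disp (c\<^sup>2)" and a=0 and b="mu_max c"])
    show "(disp (c\<^sup>2) has_real_derivative disp' (c\<^sup>2) (omega_crit c \<mu>)) (at (omega_crit c \<mu>))"
      and "disp' (c\<^sup>2) (omega_crit c \<mu>) \<noteq> 0"
      using disp_facts(4,5)[OF k, of "omega_crit c \<mu>"] p(1) by auto
  qed (use assms omega_crit_props cont in auto)
qed

text \<open>The derivative is a smooth expression in the frequency itself, so order n of the
  frequency gives order n + 1.\<close>

lemma omega_crit_smooth:
  assumes "2 < c\<^sup>2" "M \<le> mu_max c"
  shows "smooth_on {0<..<M} (omega_crit c)"
proof (rule smooth_onI_diff_upto)
  have k: "2 \<le> c\<^sup>2" using assms by simp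
  show "diff_upto n {0<..<M} (omega_crit c)" for n
  proof (induct n)
    case (Suc n)
    have w: "10 \<le> omega_crit c x" if "x \<in> {0<..<M}" for x
      using omega_crit_props(1)[OF assms(1), of x] assms that by auto
    have ne: "(c\<^sup>2) ^ 2 * omega_crit c x ^ 4 - 2 * c\<^sup>2 * omega_crit c x ^ 2 \<noteq> 0"
      "disp' (c\<^sup>2) (omega_crit c x) \<noteq> 0" if "x \<in> {0<..<M}" for x
      using disp_facts(2)[OF k w[OF that]] disp_facts(5)[OF k w[OF that]] by linarith+
    have "diff_upto n {0<..<M} (\<lambda>\<mu>. disp' (c\<^sup>2) (omega_crit c \<mu>))"
      unfolding disp'_def
      by (intro diff_upto_mult diff_upto_diff diff_upto_power diff_upto_inverse diff_upto_const
          diff_upto_sin_cos[THEN conjunct1] diff_upto_sin_cos[THEN conjunct2] Suc ne(1))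
    then have "diff_upto n {0<..<M} (\<lambda>\<mu>. inverse (disp' (c\<^sup>2) (omega_crit c \<mu>)))"
      by (rule diff_upto_inverse[OF _ ne(2)])
    moreover have "(omega_crit c has_real_derivative inverse (disp' (c\<^sup>2) (omega_crit c x))) (at x)"
      if "x \<in> {0<..<M}" for x
      using omega_crit_deriv[OF assms(1), of x] that assms(2) by auto
    ultimately show ?case by (rule diff_upto_SucI[rotated])
  qed simp
qed simp

text \<open>It serves twice: for the order \<mu>^(-1/2) of the frequency, and to place the linear
  mode in \<open>adm\<close>, since it gives 0 \<le> s \<le> 2 m.\<close>

lemma omega_crit_lam:
  assumes "2 < c\<^sup>2" "0 < \<mu>" "\<mu> < mu_max c"
  shows "2 \<le> c\<^sup>2 * \<mu> * (omega_crit c \<mu>)\<^sup>2" "c\<^sup>2 * \<mu> * (omega_crit c \<mu>)\<^sup>2 \<le> 2 + 2 * \<mu>"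
proof -
  define s where "s = (sin (omega_crit c \<mu>))^2"
  have s: "0 \<le> s" "s \<le> 1" by (auto simp: s_def abs_square_le_1)
  have D: "(1 + \<mu>)^2 - 4 * \<mu> * s \<ge> (1 - \<mu>)^2"
    using mult_left_mono[OF s(2), of "4 * \<mu>"] assms(2) by (simp add: power2_eq_square algebra_simps)
  then have "sqrt ((1 + \<mu>)^2 - 4 * \<mu> * s) \<ge> 1 - \<mu>" by (intro real_le_rsqrt)
  moreover have "sqrt ((1 + \<mu>)^2 - 4 * \<mu> * s) \<le> 1 + \<mu>"
    using s assms(2) by (intro real_le_lsqrt) auto
  ultimately show "2 \<le> c\<^sup>2 * \<mu> * (omega_crit c \<mu>)\<^sup>2" "c\<^sup>2 * \<mu> * (omega_crit c \<mu>)\<^sup>2 \<le> 2 + 2 * \<mu>"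
    using omega_crit_props(3)[OF assms] unfolding s_def by linarith+
qed

subsection \<open>Periodic traveling waves\<close>

context small
begin

lemma wspeed_sq:
  assumes "\<bar>s\<bar> \<le> 1 / 100"
  shows "c\<^sup>2 * m\<^sup>2 * (wspeed c m s)\<^sup>2 = 2 + m * s"
  using lam_bounds[OF assms] c m by (simp add: wspeed_def power_divide power_mult_distrib)

lemma Gop_sol:
  assumes "a \<in> amps"
  defines "w \<equiv> wspeed c m (sol_s a)"
  shows "Gop c (Tmu_inv (m\<^sup>2) (\<lambda>x. a * (m * sol_H a (w * x)), \<lambda>x. a * sol_G a (w * x))) (m\<^sup>2)
    = ((\<lambda>x. 0), (\<lambda>x. 0))"
proof (rule Gop_zero)
  define l where "l = 2 + m * sol_s a"
  define X Y where "X = Xf m a (sol_H a) (sol_G a)" and "Y = Yf m a (sol_H a) (sol_G a)"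
  have l: "l \<noteq> 0" and cw: "c\<^sup>2 * m\<^sup>2 * w\<^sup>2 = l"
    using lam_bounds[OF sol_s_bound[OF assms(1)]] wspeed_sq[OF sol_s_bound[OF assms(1)]]
    by (auto simp: l_def w_def)
  note d = sol_deriv[OF assms(1)]
  have chain: "((\<lambda>x. k * f (w * x)) has_real_derivative (k * w) * f' (w * x)) (at x)"
    if "\<And>y. (f has_real_derivative f' y) (at y)" for f f' k x
    using DERIV_cmult[OF DERIV_chain2[OF that, where g="\<lambda>x. w * x" and x=x and Db=w and s=UNIV], of k]
      DERIV_cmult[OF DERIV_ident, of w x] by (simp add: mult_ac)
  show "((\<lambda>x. a * (m * sol_H a (w * x))) has_real_derivative (a * m * w) * sol_H' a (w * x)) (at x)" for x
    using chain[OF d(1), of "a * m"] by (simp only: mult.assoc)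
  show "((\<lambda>x. (a * m * w) * sol_H' a (w * x)) has_real_derivative
      (a * m * w * w) * (m / (2 + m * sol_s a) * rhs1 c m a (sol a) (w * x))) (at x)" for x
    by (rule chain[OF d(2)])
  show "((\<lambda>x. a * sol_G a (w * x)) has_real_derivative (a * w) * sol_G' a (w * x)) (at x)" for x
    by (rule chain[OF d(3)])
  show "((\<lambda>x. (a * w) * sol_G' a (w * x)) has_real_derivative
      (a * w * w) * (rhs2 c m a (sol a) (w * x) - sol_G a (w * x))) (at x)" for x
    by (rule chain[OF d(4)])
  show "(\<lambda>x. a * X (w * x)) = (\<lambda>x. a * (m * sol_H a (w * x)) +
      (a * (m * sol_H a (w * x)) * (a * (m * sol_H a (w * x))) + a * sol_G a (w * x) * (a * sol_G a (w * x))))"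
    "(\<lambda>x. a * Y (w * x)) = (\<lambda>x. a * sol_G a (w * x) +
      (a * (m * sol_H a (w * x)) * (a * sol_G a (w * x)) + a * sol_G a (w * x) * (a * (m * sol_H a (w * x)))))"
    by (simp_all add: fun_eq_iff X_def Y_def Xf_def Yf_def algebra_simps power2_eq_square)
  have sh: "w * (x + 2) = w * x + 2 * w" "w * (x - 2) = w * x + (- (2 * w))" for x
    by (simp_all add: algebra_simps)
  have rhs1: "rhs1 c m a (sol a) = row1 (2 * w) X Y"
    by (cases "sol a") (simp add: rhs1_def X_def Y_def w_def)
  show "c\<^sup>2 * ((a * m * w * w) * (m / (2 + m * sol_s a) * rhs1 c m a (sol a) (w * x)))
    = res1 (\<lambda>x. a * X (w * x)) (\<lambda>x. a * Y (w * x)) x" for x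
  proof -
    have "c\<^sup>2 * ((a * m * w * w) * (m / l * t)) = (c\<^sup>2 * m\<^sup>2 * w\<^sup>2) / l * (a * t)" for t
      by (simp add: power2_eq_square)
    then have "c\<^sup>2 * ((a * m * w * w) * (m / l * t)) = a * t" for t unfolding cw using l by simp
    then have "c\<^sup>2 * ((a * m * w * w) * (m / l * rhs1 c m a (sol a) (w * x))) = a * row1 (2 * w) X Y (w * x)"
      unfolding rhs1 .
    also have "\<dots> = res1 (\<lambda>x. a * X (w * x)) (\<lambda>x. a * Y (w * x)) x"
      unfolding row1_def res1_def sh by (simp add: algebra_simps)
    finally show ?thesis unfolding l_def .
  qed
  have defect: "defect c m a (sol a) y = 4 * a * (sol_H a y * sol_G a y) + m * row2 (2 * w) X Y y
      - sol_s a * (sol_G a y - sin y)" for y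
    by (cases "sol a") (simp add: defect_def nonlin_def X_def Y_def w_def)
  show "c\<^sup>2 * m\<^sup>2 * ((a * w * w) * (rhs2 c m a (sol a) (w * x) - sol_G a (w * x)))
    = res2 (m\<^sup>2) (\<lambda>x. a * X (w * x)) (\<lambda>x. a * Y (w * x)) x" for x
  proof -
    define y where "y = w * x"
    have "l * rhs2 c m a (sol a) y = m * (sol_s a * sin y - defect c m a (sol a) y)"
      unfolding rhs2_def sol_components[OF assms(1)] l_def[symmetric] using l by simp
    then have "l * (rhs2 c m a (sol a) y - sol_G a y) = - 2 * Y y - m\<^sup>2 * row2 (2 * w) X Y y"
      unfolding right_diff_distrib by (simp add: defect l_def Y_def Yf_def algebra_simps power2_eq_square)
    then have G: "l * (rhs2 c m a (sol a) y - sol_G a y) * a = (- 2 * Y y - m\<^sup>2 * row2 (2 * w) X Y y) * a" by simp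
    have A: "c\<^sup>2 * m\<^sup>2 * ((a * w * w) * t) = (c\<^sup>2 * m\<^sup>2 * w\<^sup>2) * t * a" for t
      by (simp add: power2_eq_square)
    have "c\<^sup>2 * m\<^sup>2 * ((a * w * w) * (rhs2 c m a (sol a) y - sol_G a y))
        = (- 2 * Y y - m\<^sup>2 * row2 (2 * w) X Y y) * a" unfolding A cw G ..
    also have "\<dots> = res2 (m\<^sup>2) (\<lambda>x. a * X (w * x)) (\<lambda>x. a * Y (w * x)) x"
      unfolding res2_def row2_def sh y_def by (simp add: algebra_simps add_divide_distrib diff_divide_distrib)
    finally show ?thesis unfolding y_def .
  qed
qed

text \<open>At a = 0 the rows preserve the modes (k cos, sin). The first row forces the value of k,
  the second is then the dispersion relation, and uniqueness identifies this mode with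
  \<open>sol 0\<close>.\<close>

lemma sol_0:
  assumes "2 < c\<^sup>2" "m\<^sup>2 < mu_max c"
  defines "w \<equiv> omega_crit c (m\<^sup>2)"
  defines "k \<equiv> - 2 * m * sin w * cos w / (c\<^sup>2 * m\<^sup>2 * w\<^sup>2 - 2 * m\<^sup>2 * (sin w)\<^sup>2)"
  shows "wspeed c m (sol_s 0) = w" "sol_H 0 = (\<lambda>y. k * cos y)" "sol_G 0 = sin"
    "\<bar>k / m + sin w * cos w\<bar> \<le> 1"
proof -
  have mu0: "0 < m\<^sup>2" using m by simp
  have w10: "10 < w" using omega_crit_props(1)[OF assms(1) mu0 assms(2)] by (simp add: w_def)
  define l where "l = c\<^sup>2 * m\<^sup>2 * w\<^sup>2"
  define s where "s = (l - 2) / m"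
  define e where "e = l - 2 * m\<^sup>2 * (sin w)\<^sup>2"
  have lb: "2 \<le> l" "l \<le> 2 + 2 * m\<^sup>2"
    unfolding l_def w_def by (rule omega_crit_lam[OF assms(1) mu0 assms(2)])+
  have ls: "2 + m * s = l" using m by (simp add: s_def)
  have m2: "m\<^sup>2 \<le> 1 / 1000000"
    using m_small[of m 1] m by (simp add: power2_eq_square)
  have sc: "(sin w)\<^sup>2 \<le> 1" "0 \<le> (sin w)\<^sup>2" by (auto simp: abs_square_le_1)
  have "m\<^sup>2 * (sin w)\<^sup>2 \<le> m\<^sup>2 * 1" "0 \<le> m\<^sup>2 * (sin w)\<^sup>2" using sc by (intro mult_left_mono, auto)
  then have e2: "\<bar>e - 2\<bar> \<le> 2 * m\<^sup>2" using lb unfolding e_def by linarith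
  then have e: "1 \<le> e" using m2 by auto
  have k: "k = - 2 * m * sin w * cos w / e" by (simp add: k_def e_def l_def)
  have sincos: "\<bar>sin w * cos w\<bar> \<le> 1" using abs_mult_le[of "sin w" 1 "cos w" 1] by simp
  have ke: "k * e = - 2 * m * sin w * cos w" using e by (simp add: k)
  have k1: "\<bar>k\<bar> \<le> 1"
  proof -
    have "\<bar>k\<bar> * 1 \<le> \<bar>k\<bar> * e" using e by (intro mult_left_mono) auto
    also have "\<dots> = \<bar>k * e\<bar>" using e by (simp add: abs_mult)
    also have "\<dots> = \<bar>2 * (m * (sin w * cos w))\<bar>" unfolding ke by (simp add: mult.assoc)
    also have "\<dots> \<le> 1" using m_small[OF sincos] by simp
    finally show ?thesis by simp
  qed
  have s2: "\<bar>s\<bar> \<le> 1 / 100"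
  proof -
    have "\<bar>s\<bar> = (l - 2) / m" using lb m by (simp add: s_def)
    also have "\<dots> \<le> 2 * m" using lb m by (simp add: divide_le_eq power2_eq_square)
    finally show ?thesis using m by simp
  qed
  \<comment> \<open>The dispersion relation for l = \<open>c\<^sup>2 * m\<^sup>2 * w\<^sup>2\<close>
    with the root removed.\<close>
  have quad: "l\<^sup>2 - 2 * (1 + m\<^sup>2) * l + 4 * m\<^sup>2 * (sin w)\<^sup>2 = 0"
  proof -
    define r where "r = (1 + m\<^sup>2)^2 - 4 * m\<^sup>2 * (sin w)^2"
    have "r = (1 - m\<^sup>2)^2 + 4 * m\<^sup>2 * (1 - (sin w)^2)" by (simp add: r_def power2_eq_square algebra_simps)
    then have "0 \<le> r" using sc by simp
    moreover have "l = 1 + m\<^sup>2 + sqrt r"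
      using omega_crit_props(3)[OF assms(1) mu0 assms(2)] by (simp add: l_def w_def r_def)
    ultimately have "(l - (1 + m\<^sup>2))\<^sup>2 = r" by simp
    then show ?thesis by (simp add: r_def power2_eq_square algebra_simps)
  qed
  have c2: "(cos w)\<^sup>2 = 1 - (sin w)\<^sup>2" by (simp add: cos_squared_eq)
  \<comment> \<open>The second row on the linear mode. After multiplication by e, \<open>ke\<close>
    eliminates k and what remains is \<open>quad\<close>.\<close>
  have key: "m * s = m * (m * (2 * (cos w)\<^sup>2 - 2 * m * k * sin w * cos w))"
  proof -
    have "(l - 2 - 2 * m\<^sup>2 * (cos w)\<^sup>2) * e = 4 * m\<^sup>2 * m\<^sup>2 * (sin w)\<^sup>2 * (cos w)\<^sup>2"
      using quad unfolding e_def c2 by algebra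
    also have "\<dots> = - 2 * m\<^sup>2 * m * sin w * cos w * (k * e)"
      unfolding ke by (simp add: power2_eq_square)
    also have "\<dots> = (- 2 * m\<^sup>2 * m * sin w * cos w * k) * e" by (simp only: mult.assoc)
    finally have "l - 2 - 2 * m\<^sup>2 * (cos w)\<^sup>2 = - 2 * m\<^sup>2 * m * sin w * cos w * k"
      using e mult_right_cancel[of e] by (metis not_one_le_zero)
    then show ?thesis using ls by (simp add: power2_eq_square algebra_simps)
  qed
  have ws: "wspeed c m s = w"
    using ls w10 c m by (simp add: wspeed_def l_def real_sqrt_mult real_sqrt_abs)
  let ?p = "(s, \<lambda>y. k * cos y, sin)"
  have adm: "?p \<in> adm"
  proof -
    have "\<bar>k * cos x - k * cos y\<bar> \<le> 1 * \<bar>x - y\<bar>" for x y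
      by (rule lipschitz_of_deriv[where f'="\<lambda>y. k * - sin y"])
         (auto intro!: derivative_eq_intros simp: abs_mult mult_le_one k1)
    moreover have "\<bar>sin x - sin y\<bar> \<le> 2 * \<bar>x - y\<bar>" for x y :: real
      by (rule lipschitz_of_deriv[OF DERIV_sin]) (rule order_trans[OF abs_cos_le_one], simp)
    moreover have "\<bar>k * cos y\<bar> \<le> 1" for y using abs_mult_le[OF k1 abs_cos_le_one] by simp
    ultimately show ?thesis using s2 by (simp add: adm_def periodic_2pi_def)
  qed
  \<comment> \<open>The amplitude of \<open>rhs1\<close> on the linear mode; \<open>kk\<close> says
    that two integrations return k cos.\<close>
  define \<kappa> where "\<kappa> = 2 * sin w * cos w - 2 * m * k * (sin w)\<^sup>2"
  have kk: "m / l * \<kappa> = - k"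
    using ke lb unfolding \<kappa>_def e_def by (simp add: field_simps power2_eq_square)
  define D where "D = 2 * w"
  have s2w: "sin D = 2 * sin w * cos w" "cos D = 1 - 2 * (sin w)\<^sup>2"
    by (simp_all add: D_def sin_double cos_double_sin)
  have rhs1: "rhs1 c m 0 ?p = (\<lambda>y. \<kappa> * cos y)"
    unfolding rhs1_def prod.case ws row1_def Xf_def Yf_def \<kappa>_def D_def[symmetric]
    by (simp add: sin_add cos_add sin_diff cos_diff s2w fun_eq_iff field_simps)
  have nonlin: "nonlin c m 0 ?p y = s * sin y" for y
  proof -
    have "nonlin c m 0 ?p y = m * (2 * (cos w)\<^sup>2 - 2 * m * k * sin w * cos w) * sin y"
      unfolding nonlin_def prod.case ws row2_def Xf_def Yf_def c2 D_def[symmetric]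
      by (simp add: sin_add cos_add sin_diff cos_diff s2w field_simps)
    then show ?thesis using key m by simp
  qed
  have defect: "defect c m 0 ?p = (\<lambda>y. s * sin y)" by (simp add: defect_def nonlin fun_eq_iff)
  have "next_s c m 0 ?p = prim (\<lambda>y. s * (sin y * sin y) + 0 * (sin y * sin y)) (2 * pi) / pi"
    unfolding next_s_def defect by (simp add: mult.assoc)
  also have "\<dots> = s" by (subst prim_lincomb) (auto intro!: continuous_intros simp: prim_sin_sq)
  finally have ns: "next_s c m 0 ?p = s" .
  have rhs2: "rhs2 c m 0 ?p = (\<lambda>y. 0)" unfolding rhs2_def ns defect by simp
  have "prim (\<lambda>y. 0) y = 0" for y
    using prim_unique[of "\<lambda>y. 0" "\<lambda>y. 0"] by simp
  then have nG: "next_G c m 0 ?p = sin" unfolding next_G_def rhs2 by simp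
  have "prim (\<lambda>y. \<kappa> * cos y) = (\<lambda>y. \<kappa> * sin y)"
    by (rule ext, subst prim_unique[where g="\<lambda>y. \<kappa> * sin y"])
       (auto intro!: continuous_intros derivative_eq_intros)
  moreover have "prim (\<lambda>y. \<kappa> * sin y) y = \<kappa> - \<kappa> * cos y" for y
    by (subst prim_unique[where g="\<lambda>y. - \<kappa> * cos y"]) (auto intro!: continuous_intros derivative_eq_intros)
  moreover have "m / l * (\<kappa> - \<kappa> * cos y - \<kappa>) = - (m / l * \<kappa>) * cos y" for y
    by (simp add: algebra_simps)
  ultimately have nH: "next_H c m 0 ?p = (\<lambda>y. k * cos y)"
    unfolding next_H_def rhs1 fst_conv ls kk by (simp only: cos_pi_half mult_zero_right diff_zero kk minus_minus)
  have "sol 0 = ?p"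
    by (rule sol_unique[OF _ adm]) (simp_all add: amps_iff picard_def ns nH nG)
  then show "wspeed c m (sol_s 0) = w" "sol_H 0 = (\<lambda>y. k * cos y)" "sol_G 0 = sin" using ws by simp_all
  \<comment> \<open>Since k / m = - 2 sin w cos w / e with e close to 2, the leading terms cancel
    and the sum is of order \<mu>.\<close>
  have "k / m + sin w * cos w = (sin w * cos w) * ((e - 2) / e)"
    using e m by (simp add: k field_simps)
  also have "\<bar>\<dots>\<bar> \<le> 1 * 1"
    using e2 e m2 by (intro abs_mult_le sincos) (simp add: abs_mult divide_le_eq)
  finally show "\<bar>k / m + sin w * cos w\<bar> \<le> 1" by simp
qed

lemma periodic_branch:
  assumes \<mu>: "\<mu> = m\<^sup>2" and "2 < c\<^sup>2" "\<mu> < mu_max c"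
  shows "\<exists>(\<upsilon>::real) (\<omega>::real \<Rightarrow> real) (\<psi>1::real \<Rightarrow> rfun) (\<psi>2::real \<Rightarrow> rfun).
       \<bar>\<upsilon>\<bar> \<le> 1 \<and>
       (\<forall>a\<in>amps. Cinf_per_even (\<psi>1 a) \<and> Cinf_per_odd (\<psi>2 a)) \<and>
       (\<forall>a\<in>amps.
          Gop c ((\<lambda>x. a * (\<mu> * \<upsilon> * cos (\<omega> a * x)) + a * (\<mu> * \<psi>1 a (\<omega> a * x))),
                 (\<lambda>x. a * sin (\<omega> a * x) + a * \<psi>2 a (\<omega> a * x))) \<mu>
            = ((\<lambda>x. 0), (\<lambda>x. 0))) \<and>
       \<omega> 0 = omega_crit c \<mu> \<and>
       \<psi>1 0 = (\<lambda>x. 0) \<and> \<psi>2 0 = (\<lambda>x. 0) \<and>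
       (\<forall>s::nat. \<exists>C > 0. \<forall>a\<in>amps. \<forall>a'\<in>amps.
          \<bar>\<omega> a - \<omega> a'\<bar> + W_norm s (\<lambda>x. \<psi>1 a x - \<psi>1 a' x)
            + W_norm s (\<lambda>x. \<psi>2 a x - \<psi>2 a' x) \<le> C * \<bar>a - a'\<bar>)"
proof -
  define w where "w = omega_crit c (m\<^sup>2)"
  define k where "k = - 2 * m * sin w * cos w / (c\<^sup>2 * m\<^sup>2 * w\<^sup>2 - 2 * m\<^sup>2 * (sin w)\<^sup>2)"
  note s0 = sol_0[OF assms(2) assms(3)[unfolded \<mu>], folded w_def, folded k_def]
  \<comment> \<open>At a = 0 the difference of shifted sines contributes sin w cos w cos y and H / m
    contributes (k / m) cos y, so this choice makes \<psi>1 vanish there.\<close>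
  define \<upsilon> where "\<upsilon> = k / m + sin w * cos w"
  define \<omega> where "\<omega> = (\<lambda>a. wspeed c m (sol_s a))"
  \<comment> \<open>The first component of \<open>Tmu_inv\<close>, divided by a \<mu>, without its
    linear mode.\<close>
  define \<psi>1 where "\<psi>1 = (\<lambda>a y. inverse m * sol_H a y
      + inverse 4 * (sol_G a (y + sol_d a) - sol_G a (y + (- sol_d a))) - \<upsilon> * cos y)"
  define \<psi>2 where "\<psi>2 = (\<lambda>a y. sol_G a y - sin y)"
  have d: "sol_d a = 2 * \<omega> a" for a by (simp add: sol_d_def \<omega>_def)
  have d': "\<bar>- sol_d a - - sol_d a'\<bar> \<le> 36 * \<bar>a - a'\<bar>" if "a \<in> amps" "a' \<in> amps" for a a'
    using sol_diff(4)[OF that] by argo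
  have lip1: "lip_family amps n \<psi>1" and lip2: "lip_family amps n \<psi>2" for n
    unfolding \<psi>1_def \<psi>2_def
    by (intro lip_family_add lip_family_diff lip_family_mult lip_family_const lip_family_sin_cos lip_sol
        lip_family_shift[OF lip_sol(2) sol_diff(4)] lip_family_shift[where d="\<lambda>a. - sol_d a", OF lip_sol(2) d'];
        assumption)+
  have smooth: "smooth_on UNIV (\<psi>1 a)" "smooth_on UNIV (\<psi>2 a)" if "a \<in> amps" for a
    unfolding smooth_on_def using lip_family_smooth[OF lip1 that] lip_family_smooth[OF lip2 that] by auto
  have f1: "Cinf_per_even (\<psi>1 a)" if "a \<in> amps" for a
  proof -
    note p = sol_adm(4,5,8,9)[OF that]
    have G: "sol_G a (- y + e) = - sol_G a (y - e)" for y e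
      using p(4)[of "y - e"] by simp
    have "\<psi>1 a (-y) = \<psi>1 a y" for y
      using G[of y "sol_d a"] G[of y "- sol_d a"] p(2)[of y] unfolding \<psi>1_def by simp
    moreover have "periodic_2pi (\<psi>1 a)"
      using p(1) periodic_shift[OF p(3), of _ "sol_d a"] periodic_shift[OF p(3), of _ "- sol_d a"]
      by (simp add: \<psi>1_def periodic_2pi_def del: add_uminus_conv_diff)
    ultimately show ?thesis using smooth(1)[OF that] by (simp add: Cinf_per_even_def)
  qed
  have f2: "Cinf_per_odd (\<psi>2 a)" if "a \<in> amps" for a
    using sol_adm(8,9)[OF that] smooth(2)[OF that] by (simp add: Cinf_per_odd_def \<psi>2_def periodic_2pi_def)
  have f3: "Gop c ((\<lambda>x. a * (m\<^sup>2 * \<upsilon> * cos (\<omega> a * x)) + a * (m\<^sup>2 * \<psi>1 a (\<omega> a * x))),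
                 (\<lambda>x. a * sin (\<omega> a * x) + a * \<psi>2 a (\<omega> a * x))) (m\<^sup>2)
            = ((\<lambda>x. 0), (\<lambda>x. 0))" if "a \<in> amps" for a
  proof -
    have sh: "\<omega> a * (x + 2) = \<omega> a * x + 2 * \<omega> a" "\<omega> a * (x - 2) = \<omega> a * x - 2 * \<omega> a" for x
      by (simp_all add: algebra_simps)
    have mm: "m\<^sup>2 * (inverse m * t) = m * t" for t using m by (simp add: power2_eq_square)
    have "((\<lambda>x. a * (m\<^sup>2 * \<upsilon> * cos (\<omega> a * x)) + a * (m\<^sup>2 * \<psi>1 a (\<omega> a * x))),
        (\<lambda>x. a * sin (\<omega> a * x) + a * \<psi>2 a (\<omega> a * x)))
      = Tmu_inv (m\<^sup>2) (\<lambda>x. a * (m * sol_H a (\<omega> a * x)), \<lambda>x. a * sol_G a (\<omega> a * x))"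
      unfolding Tmu_inv_def AopDop fst_conv snd_conv \<psi>1_def \<psi>2_def d sh
      by (simp add: fun_eq_iff distrib_left right_diff_distrib mm)
    then show ?thesis using Gop_sol[OF that] by (simp add: \<omega>_def)
  qed
  have f4: "\<omega> 0 = w" using s0(1) by (simp add: \<omega>_def)
  have sw: "sin (w * 2) = cos w * (sin w * 2)" using sin_double[of w] by (simp add: mult_ac)
  have f5: "\<psi>1 0 = (\<lambda>x. 0)"
    unfolding \<psi>1_def s0 d \<open>\<omega> 0 = w\<close> \<upsilon>_def
    by (simp add: fun_eq_iff sin_add sin_diff field_simps sw)
  have f6: "\<psi>2 0 = (\<lambda>x. 0)" unfolding \<psi>2_def s0 by simp
  have f7: "\<exists>C>0. \<forall>a\<in>amps. \<forall>a'\<in>amps.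
          \<bar>\<omega> a - \<omega> a'\<bar> + W_norm s (\<lambda>x. \<psi>1 a x - \<psi>1 a' x)
            + W_norm s (\<lambda>x. \<psi>2 a x - \<psi>2 a' x) \<le> C * \<bar>a - a'\<bar>" for s
  proof -
    obtain C1 where C1: "0 \<le> C1" "\<forall>a\<in>amps. \<forall>a'\<in>amps. W_norm s (\<lambda>x. \<psi>1 a x - \<psi>1 a' x) \<le> C1 * \<bar>a - a'\<bar>"
      using lip_family_W_norm[OF lip1] by blast
    obtain C2 where C2: "0 \<le> C2" "\<forall>a\<in>amps. \<forall>a'\<in>amps. W_norm s (\<lambda>x. \<psi>2 a x - \<psi>2 a' x) \<le> C2 * \<bar>a - a'\<bar>"
      using lip_family_W_norm[OF lip2] by blast
    show ?thesis
    \<comment> \<open>\<open>sol_d\<close> is twice \<omega>, so 36 halves to 18; this term also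
      makes the constant positive.\<close>
    proof (intro exI[of _ "18 + C1 + C2"] conjI ballI)
      fix a a' assume A: "a \<in> amps" "a' \<in> amps"
      have "\<bar>\<omega> a - \<omega> a'\<bar> \<le> 18 * \<bar>a - a'\<bar>" using sol_diff(4)[OF A] unfolding d by argo
      moreover have "W_norm s (\<lambda>x. \<psi>1 a x - \<psi>1 a' x) \<le> C1 * \<bar>a - a'\<bar>"
        "W_norm s (\<lambda>x. \<psi>2 a x - \<psi>2 a' x) \<le> C2 * \<bar>a - a'\<bar>" using C1(2) C2(2) A by auto
      ultimately show "\<bar>\<omega> a - \<omega> a'\<bar> + W_norm s (\<lambda>x. \<psi>1 a x - \<psi>1 a' x)
            + W_norm s (\<lambda>x. \<psi>2 a x - \<psi>2 a' x) \<le> (18 + C1 + C2) * \<bar>a - a'\<bar>"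
        unfolding distrib_right by linarith
    qed (use C1(1) C2(1) in simp)
  qed
  have f8: "\<bar>\<upsilon>\<bar> \<le> 1" using s0(4) by (simp add: \<upsilon>_def)
  show ?thesis
    unfolding \<mu> w_def[symmetric]
    by (rule exI[of _ \<upsilon>], rule exI[of _ \<omega>], rule exI[of _ \<psi>1], rule exI[of _ \<psi>2])
       (intro conjI ballI allI f1 f2 f3 f4 f5 f6 f7 f8)
qed

end

theorem theorem5p1:
  fixes c :: real
  assumes "\<bar>c\<bar> > sqrt 2"
  shows "\<exists>\<mu>_per > 0. \<exists>a_per > 0.
    (\<exists>C1 C2. 0 < C1 \<and> C1 < C2 \<and>
       (\<forall>\<mu>\<in>{0<..<\<mu>_per}. C1 / sqrt \<mu> \<le> omega_crit c \<mu> \<and> omega_crit c \<mu> \<le> C2 / sqrt \<mu>)) \<and>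
    smooth_on {0<..<\<mu>_per} (omega_crit c) \<and>
    (\<forall>\<mu>\<in>{0<..<\<mu>_per}. \<exists>(\<upsilon>::real) (\<omega>::real \<Rightarrow> real) (\<psi>1::real \<Rightarrow> rfun) (\<psi>2::real \<Rightarrow> rfun).
       \<bar>\<upsilon>\<bar> \<le> 1 \<and>
       (\<forall>a\<in>{-a_per..a_per}. Cinf_per_even (\<psi>1 a) \<and> Cinf_per_odd (\<psi>2 a)) \<and>
       (\<forall>a\<in>{-a_per..a_per}.
          Gop c ((\<lambda>x. a * (\<mu> * \<upsilon> * cos (\<omega> a * x)) + a * (\<mu> * \<psi>1 a (\<omega> a * x))),
                 (\<lambda>x. a * sin (\<omega> a * x) + a * \<psi>2 a (\<omega> a * x))) \<mu>
            = ((\<lambda>x. 0), (\<lambda>x. 0))) \<and>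
       \<omega> 0 = omega_crit c \<mu> \<and>
       \<psi>1 0 = (\<lambda>x. 0) \<and> \<psi>2 0 = (\<lambda>x. 0) \<and>
       (\<forall>s::nat. \<exists>C > 0. \<forall>a\<in>{-a_per..a_per}. \<forall>a'\<in>{-a_per..a_per}.
          \<bar>\<omega> a - \<omega> a'\<bar> + W_norm s (\<lambda>x. \<psi>1 a x - \<psi>1 a' x)
            + W_norm s (\<lambda>x. \<psi>2 a x - \<psi>2 a' x) \<le> C * \<bar>a - a'\<bar>))"
proof -
  have c2: "2 < c\<^sup>2"
    using assms real_sqrt_less_iff[of 2 "c\<^sup>2"] by simp
  have "1 \<le> sqrt 2" by simp
  then have c1: "1 \<le> \<bar>c\<bar>" using assms by linarith
  \<comment> \<open>The bound 1/10^12 on \<mu> is the bound 1/1000000 on its square root.\<close>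
  define M where "M = min (mu_max c) (1 / 10 ^ 12)"
  have M: "0 < M" "M \<le> mu_max c"
    using disp_facts(3)[of "c\<^sup>2" 10] c2 by (auto simp: M_def mu_max_def)
  have m: "0 < sqrt \<mu>" "sqrt \<mu> \<le> 1 / 1000000" "(sqrt \<mu>)\<^sup>2 = \<mu>" "\<mu> < mu_max c" "0 < \<mu>"
    if "\<mu> \<in> {0<..<M}" for \<mu>
  proof -
    show "sqrt \<mu> \<le> 1 / 1000000"
      by (rule real_le_lsqrt) (use that in \<open>auto simp: M_def power2_eq_square\<close>)
  qed (use that in \<open>auto simp: M_def\<close>)
  have bounds: "sqrt 2 / \<bar>c\<bar> / sqrt \<mu> \<le> omega_crit c \<mu> \<and> omega_crit c \<mu> \<le> 2 / \<bar>c\<bar> / sqrt \<mu>"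
    if "\<mu> \<in> {0<..<M}" for \<mu>
  proof -
    note mu = m[OF that]
    have w: "0 \<le> omega_crit c \<mu>" using omega_crit_props(1)[OF c2 mu(5,4)] by simp
    have l: "sqrt (c\<^sup>2 * \<mu> * (omega_crit c \<mu>)\<^sup>2) = \<bar>c\<bar> * sqrt \<mu> * omega_crit c \<mu>"
      using w by (simp add: real_sqrt_mult)
    have "\<mu> \<le> 1" using that by (simp add: M_def)
    \<comment> \<open>Square roots of 2 \<le>
      \<open>c\<^sup>2 * \<mu> * (omega_crit c \<mu>)\<^sup>2\<close> \<le> 2 + 2 \<mu> \<le> 4 give
      the two constants.\<close>
    then have "sqrt 2 \<le> \<bar>c\<bar> * sqrt \<mu> * omega_crit c \<mu>" "\<bar>c\<bar> * sqrt \<mu> * omega_crit c \<mu> \<le> sqrt 4"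
      unfolding l[symmetric] using omega_crit_lam[OF c2 mu(5,4)] by (intro real_sqrt_le_mono; linarith)+
    then show ?thesis using c1 mu(1) by (simp add: field_simps)
  qed
  have small: "small c (sqrt \<mu>)" if "\<mu> \<in> {0<..<M}" for \<mu>
    using m[OF that] c1 by unfold_locales
  show ?thesis
  proof (rule exI[of _ M], intro conjI, rule M(1), rule exI[of _ "1 / 1000000"], intro conjI)
    show "\<exists>C1 C2. 0 < C1 \<and> C1 < C2 \<and>
       (\<forall>\<mu>\<in>{0<..<M}. C1 / sqrt \<mu> \<le> omega_crit c \<mu> \<and> omega_crit c \<mu> \<le> C2 / sqrt \<mu>)"
    proof (rule exI[of _ "sqrt 2 / \<bar>c\<bar>"], rule exI[of _ "2 / \<bar>c\<bar>"], intro conjI)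
      have "sqrt 2 < sqrt 4" by (rule real_sqrt_less_mono) simp
      then show "sqrt 2 / \<bar>c\<bar> < 2 / \<bar>c\<bar>" using c1 by (intro divide_strict_right_mono) auto
    qed (use bounds c1 in auto)
    show "smooth_on {0<..<M} (omega_crit c)" by (rule omega_crit_smooth[OF c2 M(2)])
    show "0 < (1 / 1000000 :: real)" by simp
  qed (rule ballI, rule small.periodic_branch[OF small m(3)[symmetric] c2 m(4), unfolded amps_def])
qed

end
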